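(* Let $d\ge2$ and let a simple graph $G$ embedded in $\mathbb{H}^d$ be connected, locally finite, transitive under isometries and such that its edges are geodesic segments. Let $p_0=p_0(G)$ and $g_p$ be as defined in the context. Then for any $p\in[0,1]$ with $p<p_0$ there exists $\psi=\psi(p)>0$ such that for every $r>0$, $$g_p(r)\le e^{-\psi r}.$$
   Context: Graph. Local finiteness: every compact subset of $\mathbb{H}^d$ meets only finitely many vertices and edges of $G$. Transitive under isometries: some group of isometries of $\mathbb{H}^d$ acts on $G$ by graph automorphisms, transitively on $V(G)$. A vertex $o$ of $G$ is fixed. $\mathbb{H}^d$ is considered in the upper half-space model $\mathbb{R}^{d-1}\times(0,\infty)$, chosen so that $o=(0,\dots,0,1)$. Percolation. $\omega$ is the random configuration of $p$-Bernoulli bond percolation on $G$ (all vertices are kept, each edge is kept (open) independently with probability $p$), with law $\mathrm{P}_p$; $C(o)$ is the connected component of $o$ in $\omega$, viewed as a subset of $\mathbb{H}^d$. Let $\partial\mathbb{H}^d$ be the set of points at infinity of $\mathbb{H}^d$ and, for $C\subseteq\mathbb{H}^d$, let $\partial C$ be the set of points of $\partial\mathbb{H}^d$ lying in the closure of $C$ in $\mathbb{H}^d\cup\partial\mathbb{H}^d$ (the standard compactification). Define $\mathcal N(G)=\{p\in[0,1]:\mathrm{P}_p(x\in\partial C(o))=0\text{ for all }x\in\partial\mathbb{H}^d\}$ and $p_0(G)=\sup\mathcal N(G)$. The function $g_p$. For $h\in(0,1]$ and $R\in O(d)$ let $\Phi^{(h,R)}$ be the unique isometry of $\mathbb{H}^d$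 with $\Phi^{(h,R)}(o)=(0,\dots,0,h)$ and ordinary derivative $D\Phi^{(h,R)}(o)=hR$. Put $G^{(h,R)}=\Phi^{(h,R)}[G]$ and $o^{(h,R)}=\Phi^{(h,R)}(o)$; the percolation configuration on $G^{(h,R)}$ is $\Phi^{(h,R)}[\omega]$. Let $L=\mathbb{R}^{d-1}\times(0,1]$. The graph $G^{(h,R)}\cap L$ has as vertices the vertices of $G^{(h,R)}$ in $L$ together with the intersection points of edges of $G^{(h,R)}$ with the topological boundary of $L$, and as edges the non-degenerate components of intersections of edges of $G^{(h,R)}$ with $L$; its percolation configuration is $\Phi^{(h,R)}[\omega]\cap L$ (a piece of an edge is open iff the edge is open). For sets or points $A,B$, "$A\leftrightarrow B$ in $G^{(h,R)}\cap L$" is the event that there is an open path of this configuration intersecting both $A$ and $B$. For $r>0$ let $S_r$ be the topological boundary in $\mathbb{H}^d$ of $B_r=\{y\in\mathbb{H}^d:\|\pi(y)\|_\infty\le r\}$, where $\pi:\mathbb{R}^{d-1}\times(0,\infty)\to\mathbb{R}^{d-1}\times\{0\}$ is the Euclidean orthogonal projection and $\|\cdot\|_\infty$ the maximum norm. Finally $$g_p(r)=\sup_{(h,R)\in(0,1]\times O(d)}\mathrm{P}_p\bigl(o^{(h,R)}\leftrightarrow S_r\text{ in }G^{(h,R)}\cap L\bigr).$$ *)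

theory Defs
  imports "HOL-Probability.Probability" "HOL-Algebra.Bij"
begin

text \<open>
  Points of the upper half-space model of dimension \<open>d = CARD('n) + 1\<close> are pairs of a horizontal
  part in \<open>real ^ 'n\<close> and a height. Since \<open>'n\<close> is a nonempty finite type, \<open>'n\<close> ranges over exactly
  the dimensions \<open>d \<ge> 2\<close>.
\<close>

type_synonym 'n hpoint = "(real ^ 'n) \<times> real"

definition hspace :: "('n::finite) hpoint set" where
  "hspace = {y. 0 < snd y}"

definition hdist :: "('n::finite) hpoint \<Rightarrow> 'n hpoint \<Rightarrow> real" where
  "hdist y z = arcosh (1 + (dist y z)\<^sup>2 / (2 * snd y * snd z))"

abbreviation hspace_top :: "('n::finite) hpoint topology" where
  "hspace_top \<equiv> top_of_set hspace"

definition base_point :: "('n::finite) hpoint" where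
  "base_point = (0, 1)"

text \<open>
  \<open>Bij\<close> makes isometries \<open>undefined\<close> outside \<open>hspace\<close>, so that they are determined by their action
  on hyperbolic space. This is what makes the definite description of \<open>Phi\<close> below meaningful.
\<close>

definition hisometries :: "('n::finite hpoint \<Rightarrow> 'n hpoint) set" where
  "hisometries = {\<phi> \<in> Bij hspace. \<forall>y\<in>hspace. \<forall>z\<in>hspace. hdist (\<phi> y) (\<phi> z) = hdist y z}"

definition geodesic_segment :: "('n::finite) hpoint set \<Rightarrow> bool" where
  "geodesic_segment S \<longleftrightarrow>
     (\<exists>l \<gamma>. 0 \<le> l \<and> \<gamma> ` {0..l} = S \<and> S \<subseteq> hspace \<and>
        (\<forall>s\<in>{0..l}. \<forall>t\<in>{0..l}. hdist (\<gamma> s) (\<gamma> t) = \<bar>s - t\<bar>))"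

text \<open>
  The compactification of hyperbolic space by its points at infinity is the closed half-space
  together with one further point \<open>None\<close>, the point at infinity of the vertical geodesics.
\<close>

definition hcompactification :: "('n::finite) hpoint option topology" where
  "hcompactification = Alexandroff_compactification (top_of_set {y. 0 \<le> snd y})"

definition points_at_infinity :: "('n::finite) hpoint option set" where
  "points_at_infinity = insert None (Some ` {y. snd y = 0})"

definition boundary_at_infinity :: "('n::finite) hpoint set \<Rightarrow> 'n hpoint option set" where
  "boundary_at_infinity C = points_at_infinity \<inter> (hcompactification closure_of (Some ` C))"

text \<open>
  A graph in hyperbolic space is given by its set \<open>V\<close> of vertices and its set \<open>E\<close> of edges, each
  edge being the set of points of an arc; its end points are the vertices lying on it.
\<close>

definition embedded_simple_graph :: "('n::finite) hpoint set \<Rightarrow> 'n hpoint set set \<Rightarrow> bool" where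
  "embedded_simple_graph V E \<longleftrightarrow>
     V \<subseteq> hspace \<and>
     (\<forall>e\<in>E. e \<subseteq> hspace \<and>
        (\<exists>\<gamma>. arc \<gamma> \<and> path_image \<gamma> = e \<and> e \<inter> V = {pathstart \<gamma>, pathfinish \<gamma>})) \<and>
     (\<forall>e\<in>E. \<forall>f\<in>E. e \<noteq> f \<longrightarrow> e \<inter> f \<subseteq> V \<and> e \<inter> V \<noteq> f \<inter> V)"

text \<open>
  A path is recorded by its successive vertices \<open>vs\<close> and edges \<open>es\<close>. A step is allowed between any
  two vertices lying on the same edge. For embedded graphs these are its two end points; in the part
  of a graph below a horosphere, an edge touching the horosphere from below contains
  the point of tangency as a third vertex.
\<close>

definition graph_path ::
  "('n::finite) hpoint set \<Rightarrow> 'n hpoint set set \<Rightarrow> 'n hpoint list \<Rightarrow> 'n hpoint set list \<Rightarrow> bool" where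
  "graph_path V E vs es \<longleftrightarrow>
     length vs = Suc (length es) \<and> set vs \<subseteq> V \<and> set es \<subseteq> E \<and> distinct vs \<and>
     (\<forall>i<length es. vs ! i \<in> es ! i \<and> vs ! Suc i \<in> es ! i)"

definition connects ::
  "('n::finite) hpoint set \<Rightarrow> 'n hpoint set set \<Rightarrow> 'n hpoint set \<Rightarrow> 'n hpoint set \<Rightarrow> bool" where
  "connects V E A B \<longleftrightarrow>
     (\<exists>vs es. graph_path V E vs es \<and>
        (set vs \<union> \<Union>(set es)) \<inter> A \<noteq> {} \<and> (set vs \<union> \<Union>(set es)) \<inter> B \<noteq> {})"

definition connected_graph :: "('n::finite) hpoint set \<Rightarrow> 'n hpoint set set \<Rightarrow> bool" where
  "connected_graph V E \<longleftrightarrow> (\<forall>u\<in>V. \<forall>v\<in>V. connects V E {u} {v})"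

definition locally_finite_graph :: "('n::finite) hpoint set \<Rightarrow> 'n hpoint set set \<Rightarrow> bool" where
  "locally_finite_graph V E \<longleftrightarrow>
     (\<forall>K. compact K \<and> K \<subseteq> hspace \<longrightarrow> finite (V \<inter> K) \<and> finite {e \<in> E. e \<inter> K \<noteq> {}})"

definition transitive_under_isometries :: "('n::finite) hpoint set \<Rightarrow> 'n hpoint set set \<Rightarrow> bool" where
  "transitive_under_isometries V E \<longleftrightarrow>
     (\<exists>\<Gamma>. subgroup \<Gamma> (BijGroup hspace) \<and> \<Gamma> \<subseteq> hisometries \<and>
        (\<forall>\<phi>\<in>\<Gamma>. \<phi> ` V = V \<and> (`) \<phi> ` E = E) \<and>
        (\<forall>u\<in>V. \<forall>v\<in>V. \<exists>\<phi>\<in>\<Gamma>. \<phi> u = v))"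

definition percolation :: "('n::finite) hpoint set set \<Rightarrow> real \<Rightarrow> ('n hpoint set \<Rightarrow> bool) measure" where
  "percolation E p = (\<Pi>\<^sub>M e\<in>E. measure_pmf (bernoulli_pmf p))"

definition open_edges :: "('n::finite) hpoint set set \<Rightarrow> ('n hpoint set \<Rightarrow> bool) \<Rightarrow> 'n hpoint set set" where
  "open_edges E \<omega> = {e \<in> E. \<omega> e}"

definition cluster ::
  "('n::finite) hpoint set \<Rightarrow> 'n hpoint set set \<Rightarrow> ('n hpoint set \<Rightarrow> bool) \<Rightarrow> 'n hpoint \<Rightarrow> 'n hpoint set" where
  "cluster V E \<omega> v = {x. connects V (open_edges E \<omega>) {v} {x}}"

definition null_boundary_params :: "('n::finite) hpoint set \<Rightarrow> 'n hpoint set set \<Rightarrow> real set" where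
  "null_boundary_params V E =
     {p \<in> {0..1}. \<forall>x\<in>points_at_infinity.
        \<P>(\<omega> in percolation E p. x \<in> boundary_at_infinity (cluster V E \<omega> base_point)) = 0}"

definition p0 :: "('n::finite) hpoint set \<Rightarrow> 'n hpoint set set \<Rightarrow> real" where
  "p0 V E = Sup (null_boundary_params V E)"

definition Phi :: "real \<Rightarrow> ('n::finite hpoint \<Rightarrow> 'n hpoint) \<Rightarrow> 'n hpoint \<Rightarrow> 'n hpoint" where
  "Phi h R = (THE \<phi>. \<phi> \<in> hisometries \<and> \<phi> base_point = (0, h) \<and>
                (\<phi> has_derivative (\<lambda>v. h *\<^sub>R R v)) (at base_point))"

definition lower_region :: "('n::finite) hpoint set" where
  "lower_region = {y. 0 < snd y \<and> snd y \<le> 1}"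

definition lower_vertices :: "('n::finite) hpoint set \<Rightarrow> 'n hpoint set set \<Rightarrow> 'n hpoint set" where
  "lower_vertices V E = (V \<inter> lower_region) \<union> (\<Union>E \<inter> (hspace_top frontier_of lower_region))"

definition lower_edges :: "('n::finite) hpoint set set \<Rightarrow> 'n hpoint set set" where
  "lower_edges E = {c. \<exists>e\<in>E. c \<in> components (e \<inter> lower_region) \<and> (\<nexists>x. c = {x})}"

definition side_boundary :: "real \<Rightarrow> ('n::finite) hpoint set" where
  "side_boundary r = hspace_top frontier_of {y \<in> hspace. infnorm (fst y) \<le> r}"

definition g_fun :: "('n::finite) hpoint set \<Rightarrow> 'n hpoint set set \<Rightarrow> real \<Rightarrow> real \<Rightarrow> real" where
  "g_fun V E p r =
     (SUP (h, R) \<in> {0<..1} \<times> {R. orthogonal_transformation R}.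
        \<P>(\<omega> in percolation E p.
           connects (lower_vertices (Phi h R ` V) ((`) (Phi h R) ` E))
                    (lower_edges ((`) (Phi h R) ` open_edges E \<omega>))
                    {Phi h R base_point} (side_boundary r)))"

end

theory Submission imports Defs begin

text \<open>
  The proof follows Duminil-Copin and Tassion. Let \<open>p < p'\<close> with \<open>p'\<close> a parameter at which the cluster of
  the base point almost surely has no given point at infinity in its closure. By compactness of the
  sphere at infinity there is a distance \<open>M\<close> such that, at \<open>p'\<close>, the probability that a vertex at height
  at most 1 is connected to horizontal distance \<open>M\<close> is small, uniformly over all isometric placements of
  the graph. For every finite set of edges below the horosphere, the differential inequality
  \<open>\<theta>' \<ge> 2 (1 - \<theta>)\<close>, valid where all \<open>\<phi>(S) \<ge> 1/2\<close>, then yields a set \<open>S\<close> of vertices within distance \<open>M\<close>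
  with \<open>\<phi>\<^sub>p(S) \<le> 1/2\<close>. Since edges below the horosphere have bounded Euclidean length and \<open>G\<close> is transitive,
  leaving \<open>S\<close> restarts the same problem from another placement, and each restart costs a factor \<open>1/2\<close>.
\<close>

section \<open>Finite Bernoulli percolation\<close>

text \<open>Probabilities are estimated for finite edge sets: \<open>bexp q F f\<close> is the
  expectation of \<open>f\<close> at the random set of open edges, a polynomial in q, so that
  Russo's formula is a finite induction. The bounds do not depend on \<open>F\<close> and pass to
  infinitely many edges by continuity from below. The horosphere makes hyperbolic and Euclidean
  scales comparable: an isometric copy of an edge with a point at height at most 1 has horizontal
  extent at most some \<open>K\<close>, uniformly over all copies, while higher edges may be
  arbitrarily long. One restart thus uses up horizontal distance at most \<open>M + K\<close>. The
  set \<open>S\<close> may depend on the starting vertex and on the placement; only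
  \<open>M\<close>, \<open>K\<close> and the factor 1/2 are uniform, which suffices for iterating.
  The number 2 in the differential inequality is 1/2 divided by the maximum 1/4 of q (1 - q). The
  claimed bound has no constant before the exponential, so a bound below 1 is required for
  arbitrarily small r too; it comes from the positive probability that all edges at the base point
  are closed.\<close>

definition bexp :: "real \<Rightarrow> 'e set \<Rightarrow> ('e set \<Rightarrow> real) \<Rightarrow> real" where
  "bexp q F f = (\<Sum>\<eta>\<in>Pow F. (\<Prod>e\<in>F. if e \<in> \<eta> then q else 1 - q) * f \<eta>)"

lemma bexp_empty [simp]: "bexp q {} f = f {}"
  by (simp add: bexp_def)

text \<open>Conditioning on the state of \<open>e\<close>; this recursion carries the inductions on
  \<open>F\<close> below.\<close>

lemma bexp_insert:
  assumes "finite F" "e \<notin> F"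
  shows "bexp q (insert e F) f = q * bexp q F (\<lambda>\<eta>. f (insert e \<eta>)) + (1 - q) * bexp q F f"
proof -
  let ?w = "\<lambda>F \<eta>. \<Prod>e\<in>F. if e \<in> \<eta> then q else 1 - q"
  have inj: "inj_on (insert e) (Pow F)"
    using assms(2) by (auto simp: inj_on_def)
  have disj: "Pow F \<inter> insert e ` Pow F = {}"
    using assms(2) by auto
  have w1: "?w (insert e F) \<eta> = (1 - q) * ?w F \<eta>" if "\<eta> \<in> Pow F" for \<eta>
    using that assms by auto
  have w2: "?w (insert e F) (insert e \<eta>) = q * ?w F \<eta>" if "\<eta> \<in> Pow F" for \<eta>
  proof -
    have "?w F (insert e \<eta>) = ?w F \<eta>"
      using assms(2) by (intro prod.cong) auto
    then show ?thesis using assms by simp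
  qed
  have "bexp q (insert e F) f =
      (\<Sum>\<eta>\<in>Pow F. ?w (insert e F) \<eta> * f \<eta>) + (\<Sum>\<eta>\<in>insert e ` Pow F. ?w (insert e F) \<eta> * f \<eta>)"
    unfolding bexp_def Pow_insert using assms(1) disj by (subst sum.union_disjoint) auto
  also have "(\<Sum>\<eta>\<in>insert e ` Pow F. ?w (insert e F) \<eta> * f \<eta>) = q * bexp q F (\<lambda>\<eta>. f (insert e \<eta>))"
    using inj w2 by (simp add: sum.reindex bexp_def sum_distrib_left mult.assoc)
  also have "(\<Sum>\<eta>\<in>Pow F. ?w (insert e F) \<eta> * f \<eta>) = (1 - q) * bexp q F f"
    using w1 by (simp add: bexp_def sum_distrib_left mult.assoc)
  finally show ?thesis by simp
qed

lemma bexp_cong: "(\<And>\<eta>. \<eta> \<subseteq> F \<Longrightarrow> f \<eta> = g \<eta>) \<Longrightarrow> bexp q F f = bexp q F g"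
  by (simp add: bexp_def)

lemma bexp_diff: "bexp q F (\<lambda>\<eta>. f \<eta> - g \<eta>) = bexp q F f - bexp q F g"
  by (simp add: bexp_def right_diff_distrib sum_subtractf)

lemma bexp_cmult: "bexp q F (\<lambda>\<eta>. c * f \<eta>) = c * bexp q F f"
  by (simp add: bexp_def sum_distrib_left mult_ac)

lemma bexp_sum: "bexp q F (\<lambda>\<eta>. \<Sum>i\<in>I. f i \<eta>) = (\<Sum>i\<in>I. bexp q F (f i))"
  unfolding bexp_def sum_distrib_left by (rule sum.swap)

lemma bexp_const: "finite F \<Longrightarrow> bexp q F (\<lambda>_. c) = c"
  by (induction F rule: finite_induct) (auto simp: bexp_insert algebra_simps)

lemma bexp_mono:
  assumes "0 \<le> q" "q \<le> 1" "\<And>\<eta>. \<eta> \<subseteq> F \<Longrightarrow> f \<eta> \<le> g \<eta>"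
  shows "bexp q F f \<le> bexp q F g"
  unfolding bexp_def using assms by (intro sum_mono mult_left_mono prod_nonneg) auto

lemma bexp_nonneg:
  assumes "0 \<le> q" "q \<le> 1" "\<And>\<eta>. \<eta> \<subseteq> F \<Longrightarrow> 0 \<le> f \<eta>"
  shows "0 \<le> bexp q F f"
  unfolding bexp_def using assms by (intro sum_nonneg mult_nonneg_nonneg prod_nonneg) auto

lemma bexp_le_1:
  assumes "finite F" "0 \<le> q" "q \<le> 1" "\<And>\<eta>. \<eta> \<subseteq> F \<Longrightarrow> f \<eta> \<le> 1"
  shows "bexp q F f \<le> 1"
  using bexp_mono[OF assms(2,3), of F f "\<lambda>_. 1"] assms(1,4) by (simp add: bexp_const)

text \<open>Each edge matters to at most one of the two factors, so the recursion on
  \<open>F\<close> can always pull the other factor out. The hypotheses range over all \<eta>, not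
  only subsets of \<open>F\<close>, so that they pass to \<eta> \<mapsto>
  \<open>f (insert e \<eta>)\<close> in the induction step.\<close>

lemma bexp_indep:
  assumes "finite F" "\<And>\<eta>. f \<eta> = f (\<eta> \<inter> A)" "\<And>\<eta>. g \<eta> = g (\<eta> - A)"
  shows "bexp q F (\<lambda>\<eta>. f \<eta> * g \<eta>) = bexp q F f * bexp q F g"
  using assms
proof (induction F arbitrary: f g rule: finite_induct)
  case (insert e F)
  have fe: "f (insert e \<eta>) = f (insert e (\<eta> \<inter> A))" for \<eta>
  proof -
    have "insert e \<eta> \<inter> A = insert e (\<eta> \<inter> A) \<inter> A" by blast
    then show ?thesis
      by (subst insert.prems(1), subst (2) insert.prems(1)) (rule arg_cong)
  qed
  have ge: "g (insert e \<eta>) = g (insert e (\<eta> - A))" for \<eta>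
  proof -
    have "insert e \<eta> - A = insert e (\<eta> - A) - A" by blast
    then show ?thesis
      by (subst insert.prems(2), subst (2) insert.prems(2)) (rule arg_cong)
  qed
  have IHs: "bexp q F (\<lambda>\<eta>. f (insert e \<eta>) * g (insert e \<eta>)) =
       bexp q F (\<lambda>\<eta>. f (insert e \<eta>)) * bexp q F (\<lambda>\<eta>. g (insert e \<eta>))"
       "bexp q F (\<lambda>\<eta>. f \<eta> * g \<eta>) = bexp q F f * bexp q F g"
    by (rule insert.IH[of "\<lambda>\<eta>. f (insert e \<eta>)" "\<lambda>\<eta>. g (insert e \<eta>)", OF fe ge])
       (rule insert.IH[of f g, OF insert.prems])
  show ?case
  proof (cases "e \<in> A")
    case True
    then have "g (insert e \<eta>) = g \<eta>" for \<eta>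
      using insert.prems(2)[of "insert e \<eta>"] insert.prems(2)[of \<eta>] by (simp add: insert_Diff_if)
    then show ?thesis using insert.hyps IHs by (simp add: bexp_insert algebra_simps)
  next
    case False
    then have "f (insert e \<eta>) = f \<eta>" for \<eta>
      using insert.prems(1)[of "insert e \<eta>"] insert.prems(1)[of \<eta>] by (simp add: Int_insert_left)
    then show ?thesis using insert.hyps IHs by (simp add: bexp_insert algebra_simps)
  qed
qed simp

lemma bexp_open_mult:
  assumes "finite F" "e \<in> F" "\<And>\<eta>. g (insert e \<eta>) = g \<eta>"
  shows "bexp q F (\<lambda>\<eta>. of_bool (e \<in> \<eta>) * g \<eta>) = q * bexp q F g"
    and "bexp q F (\<lambda>\<eta>. of_bool (e \<notin> \<eta>) * g \<eta>) = (1 - q) * bexp q F g"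
proof -
  define F' where "F' = F - {e}"
  have F: "F = insert e F'" "finite F'" "e \<notin> F'"
    using assms by (auto simp: F'_def)
  have "bexp q F' (\<lambda>\<eta>. of_bool (e \<in> \<eta>) * g \<eta>) = bexp q F' (\<lambda>\<eta>. 0)"
    using F by (intro bexp_cong) auto
  moreover have "bexp q F' (\<lambda>\<eta>. of_bool (e \<notin> \<eta>) * g \<eta>) = bexp q F' g"
    using F by (intro bexp_cong) auto
  ultimately show "bexp q F (\<lambda>\<eta>. of_bool (e \<in> \<eta>) * g \<eta>) = q * bexp q F g"
    and "bexp q F (\<lambda>\<eta>. of_bool (e \<notin> \<eta>) * g \<eta>) = (1 - q) * bexp q F g"
    using F by (simp_all add: bexp_insert assms(3) bexp_const algebra_simps)
qed

text \<open>The integrand ignores the state of \<open>e\<close>, so averaging over that state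
  changes nothing. For an increasing indicator it is the event that \<open>e\<close> is
  pivotal.\<close>

lemma bexp_insert_diff:
  assumes "finite F" "e \<in> F"
  shows "bexp q F (\<lambda>\<eta>. f (insert e \<eta>) - f (\<eta> - {e})) =
         bexp q (F - {e}) (\<lambda>\<eta>. f (insert e \<eta>)) - bexp q (F - {e}) f"
proof -
  define F' where "F' = F - {e}"
  have F: "F = insert e F'" "finite F'" "e \<notin> F'"
    using assms by (auto simp: F'_def)
  have "bexp q F' (\<lambda>\<eta>. f (insert e \<eta>) - f (\<eta> - {e})) = bexp q F' (\<lambda>\<eta>. f (insert e \<eta>) - f \<eta>)"
  proof (rule bexp_cong)
    fix \<eta> assume "\<eta> \<subseteq> F'"
    then have "\<eta> - {e} = \<eta>" using F by blast
    then show "f (insert e \<eta>) - f (\<eta> - {e}) = f (insert e \<eta>) - f \<eta>" by simp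
  qed
  moreover have "bexp q F' (\<lambda>\<eta>. f (insert e (insert e \<eta>)) - f (insert e \<eta> - {e})) = bexp q F' (\<lambda>\<eta>. f (insert e \<eta>) - f \<eta>)"
  proof (rule bexp_cong)
    fix \<eta> assume "\<eta> \<subseteq> F'"
    then have "insert e \<eta> - {e} = \<eta>" using F by blast
    then show "f (insert e (insert e \<eta>)) - f (insert e \<eta> - {e}) = f (insert e \<eta>) - f \<eta>" by simp
  qed
  ultimately show ?thesis
    unfolding F'_def[symmetric] using F by (simp add: bexp_insert algebra_simps bexp_diff)
qed

text \<open>Russo's formula for an arbitrary real function. The recursion writes the expectation as
  a mixture with weights q and 1 - q; differentiating the weights gives the term of the new edge,
  differentiating the two parts gives the terms of the old ones.\<close>

lemma russo_formula:
  assumes "finite F"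
  shows "((\<lambda>q. bexp q F f) has_real_derivative
           (\<Sum>e\<in>F. bexp q F (\<lambda>\<eta>. f (insert e \<eta>) - f (\<eta> - {e})))) (at q)"
  using assms
proof (induction F arbitrary: f rule: finite_induct)
  case (insert e F)
  have eq: "(\<Sum>a\<in>insert e F. bexp q (insert e F) (\<lambda>\<eta>. f (insert a \<eta>) - f (\<eta> - {a}))) =
     q * (\<Sum>a\<in>F. bexp q F (\<lambda>\<eta>. f (insert e (insert a \<eta>)) - f (insert e (\<eta> - {a})))) +
     (1 - q) * (\<Sum>a\<in>F. bexp q F (\<lambda>\<eta>. f (insert a \<eta>) - f (\<eta> - {a}))) +
     bexp q F (\<lambda>\<eta>. f (insert e \<eta>)) - bexp q F f"
  proof -
    have "bexp q (insert e F) (\<lambda>\<eta>. f (insert e \<eta>) - f (\<eta> - {e})) = bexp q F (\<lambda>\<eta>. f (insert e \<eta>)) - bexp q F f"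
      using insert.hyps by (subst bexp_insert_diff) auto
    moreover have "(\<Sum>a\<in>F. bexp q (insert e F) (\<lambda>\<eta>. f (insert a \<eta>) - f (\<eta> - {a}))) =
      q * (\<Sum>a\<in>F. bexp q F (\<lambda>\<eta>. f (insert e (insert a \<eta>)) - f (insert e (\<eta> - {a})))) +
     (1 - q) * (\<Sum>a\<in>F. bexp q F (\<lambda>\<eta>. f (insert a \<eta>) - f (\<eta> - {a})))"
      unfolding sum_distrib_left sum.distrib[symmetric]
    proof (intro sum.cong refl)
      fix a assume "a \<in> F"
      then have "insert e \<eta> - {a} = insert e (\<eta> - {a})" for \<eta>
        using insert.hyps by auto
      then show "bexp q (insert e F) (\<lambda>\<eta>. f (insert a \<eta>) - f (\<eta> - {a})) =
         q * bexp q F (\<lambda>\<eta>. f (insert e (insert a \<eta>)) - f (insert e (\<eta> - {a}))) +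
         (1 - q) * bexp q F (\<lambda>\<eta>. f (insert a \<eta>) - f (\<eta> - {a}))"
        using insert.hyps by (simp add: bexp_insert insert_commute)
    qed
    ultimately show ?thesis using insert.hyps by simp
  qed
  show ?case
    unfolding eq unfolding bexp_insert[OF insert.hyps]
    by (rule derivative_eq_intros insert.IH[of f] insert.IH[of "\<lambda>\<eta>. f (insert e \<eta>)"] refl)+
       (simp add: algebra_simps)
qed simp

text \<open>All influences of an increasing function are nonnegative, so Russo's formula takes the
  place of the usual coupling.\<close>

lemma bexp_mono_param:
  assumes "finite F" "\<And>\<eta> \<eta>'. \<eta> \<subseteq> \<eta>' \<Longrightarrow> f \<eta> \<le> f \<eta>'" "0 \<le> p" "p \<le> q" "q \<le> 1"
  shows "bexp p F f \<le> bexp q F f"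
proof (rule DERIV_nonneg_imp_nondecreasing[OF \<open>p \<le> q\<close>])
  fix x assume "p \<le> x" "x \<le> q"
  then have "0 \<le> (\<Sum>e\<in>F. bexp x F (\<lambda>\<eta>. f (insert e \<eta>) - f (\<eta> - {e})))"
    using assms by (intro sum_nonneg bexp_nonneg) (auto intro: assms(2))
  then show "\<exists>y. ((\<lambda>q. bexp q F f) has_real_derivative y) (at x) \<and> 0 \<le> y"
    using russo_formula[OF assms(1)] by blast
qed

lemma bexp_reindex:
  assumes "inj_on k F"
  shows "bexp q (k ` F) f = bexp q F (\<lambda>\<eta>. f (k ` \<eta>))"
proof -
  have inj: "inj_on ((`) k) (Pow F)"
    using assms by (simp add: inj_on_image_Pow)
  have P: "Pow (k ` F) = (`) k ` Pow F"
    by (simp add: image_Pow_surj)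
  have "(\<Prod>e\<in>k ` F. if e \<in> k ` \<eta> then q else 1 - q) = (\<Prod>e\<in>F. if e \<in> \<eta> then q else 1 - q)"
    if "\<eta> \<in> Pow F" for \<eta>
    using that assms by (subst prod.reindex) (auto intro!: prod.cong simp: inj_on_image_mem_iff)
  then show ?thesis
    unfolding bexp_def P using inj by (simp add: sum.reindex)
qed

section \<open>Connectivity through open edges and the sets that it determines\<close>

definition conn :: "('e \<Rightarrow> 'v set) \<Rightarrow> 'e set \<Rightarrow> 'v \<Rightarrow> 'v \<Rightarrow> bool" where
  "conn inc \<eta> = (\<lambda>x y. \<exists>e\<in>\<eta>. x \<in> inc e \<and> y \<in> inc e)\<^sup>*\<^sup>*"

lemma conn_refl [simp]: "conn inc \<eta> x x"
  by (simp add: conn_def)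

lemma conn_step: "e \<in> \<eta> \<Longrightarrow> x \<in> inc e \<Longrightarrow> y \<in> inc e \<Longrightarrow> conn inc \<eta> x y"
  unfolding conn_def by (rule r_into_rtranclp) blast

lemma conn_trans: "conn inc \<eta> x y \<Longrightarrow> conn inc \<eta> y z \<Longrightarrow> conn inc \<eta> x z"
  unfolding conn_def by (rule rtranclp_trans)

lemma conn_mono: "conn inc \<eta> x y \<Longrightarrow> \<eta> \<subseteq> \<eta>' \<Longrightarrow> conn inc \<eta>' x y"
  unfolding conn_def by (erule rtranclp_mono[THEN predicate2D, rotated]) blast

lemma conn_induct [consumes 1, case_names refl step]:
  assumes "conn inc \<eta> x y" "P x"
    and "\<And>y z e. conn inc \<eta> x y \<Longrightarrow> e \<in> \<eta> \<Longrightarrow> y \<in> inc e \<Longrightarrow> z \<in> inc e \<Longrightarrow> P y \<Longrightarrow> P z"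
  shows "P y"
  using assms(1) unfolding conn_def
proof (induction rule: rtranclp_induct)
  case base show ?case by (rule assms(2))
next
  case (step y z)
  then show ?case using assms(3)[of y _ z] unfolding conn_def by blast
qed

text \<open>Works from the far end of the path; it follows connections to a target set and later
  finds the last exit from a cluster.\<close>

lemma conn_converse_induct [consumes 1, case_names refl step]:
  assumes "conn inc \<eta> x y" "P y"
    and "\<And>x z e. conn inc \<eta> z y \<Longrightarrow> e \<in> \<eta> \<Longrightarrow> x \<in> inc e \<Longrightarrow> z \<in> inc e \<Longrightarrow> P z \<Longrightarrow> P x"
  shows "P x"
  using assms(1) unfolding conn_def
proof (induction rule: converse_rtranclp_induct)
  case base show ?case by (rule assms(2))
next
  case (step x z)
  then show ?case using assms(3)[of z _ x] unfolding conn_def by blast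
qed

lemma conn_finite:
  assumes "conn inc \<eta> x y"
  shows "\<exists>\<eta>'. finite \<eta>' \<and> \<eta>' \<subseteq> \<eta> \<and> conn inc \<eta>' x y"
  using assms
proof (induction rule: conn_induct)
  case refl
  then show ?case by (intro exI[of _ "{}"]) simp
next
  case (step y z e)
  then obtain \<eta>' where "finite \<eta>'" "\<eta>' \<subseteq> \<eta>" "conn inc \<eta>' x y" by blast
  then show ?case
    using step.hyps by (intro exI[of _ "insert e \<eta>'"])
      (auto intro: conn_trans[OF conn_mono conn_step])
qed

lemma conn_stays:
  assumes "conn inc {e \<in> \<eta>. inc e \<subseteq> S} x y" "x \<in> S"
  shows "y \<in> S"
  using assms by (induction rule: conn_induct) auto

abbreviation reaches :: "('e \<Rightarrow> 'v set) \<Rightarrow> 'e set \<Rightarrow> 'v \<Rightarrow> 'v set \<Rightarrow> bool" where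
  "reaches inc \<eta> x T \<equiv> \<exists>t\<in>T. conn inc \<eta> x t"

lemma reaches_mono: "reaches inc \<eta> x T \<Longrightarrow> \<eta> \<subseteq> \<eta>' \<Longrightarrow> reaches inc \<eta>' x T"
  using conn_mono by (metis (no_types))

definition edge_boundary :: "('e \<Rightarrow> 'v set) \<Rightarrow> 'e set \<Rightarrow> 'v set \<Rightarrow> 'e set" where
  "edge_boundary inc F S = {e \<in> F. inc e \<inter> S \<noteq> {} \<and> \<not> inc e \<subseteq> S}"

text \<open>The quantity \<open>\<phi>\<^sub>q(S)\<close> of Duminil-Copin and Tassion.\<close>

definition dct_sum :: "real \<Rightarrow> 'e set \<Rightarrow> ('e \<Rightarrow> 'v set) \<Rightarrow> 'v \<Rightarrow> 'v set \<Rightarrow> real" where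
  "dct_sum q F inc v S =
     q * (\<Sum>e\<in>edge_boundary inc F S. bexp q F (\<lambda>\<eta>. of_bool (reaches inc {f \<in> \<eta>. inc f \<subseteq> S} v (inc e))))"

lemma dct_sum_mono:
  assumes "finite F" "0 \<le> p" "p \<le> q" "q \<le> 1"
  shows "dct_sum p F inc v S \<le> dct_sum q F inc v S"
proof -
  have "bexp p F (\<lambda>\<eta>. of_bool (reaches inc {f \<in> \<eta>. inc f \<subseteq> S} v (inc e)))
      \<le> bexp q F (\<lambda>\<eta>. of_bool (reaches inc {f \<in> \<eta>. inc f \<subseteq> S} v (inc e)))" for e
  proof (rule bexp_mono_param[OF assms(1) _ assms(2-4)])
    fix \<eta> \<eta>' :: "'a set" assume "\<eta> \<subseteq> \<eta>'"
    then have "{f \<in> \<eta>. inc f \<subseteq> S} \<subseteq> {f \<in> \<eta>'. inc f \<subseteq> S}" by blast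
    from reaches_mono[OF _ this, of "inc e" inc v]
    show "of_bool (reaches inc {f \<in> \<eta>. inc f \<subseteq> S} v (inc e)) \<le> (of_bool (reaches inc {f \<in> \<eta>'. inc f \<subseteq> S} v (inc e)) :: real)"
      by (simp only: of_bool_def) auto
  qed
  then show ?thesis
    unfolding dct_sum_def using assms
    by (intro mult_mono sum_mono sum_nonneg bexp_nonneg) auto
qed

text \<open>If \<open>S\<close> is the set of vertices not connected to \<open>T\<close>, a path
  from outside \<open>S\<close> to \<open>T\<close> never enters \<open>S\<close>. So this event can
  be read off the edges not contained in \<open>S\<close>, and is independent of what is open inside
  \<open>S\<close>.\<close>

lemma unreached_determined:
  fixes inc :: "'e \<Rightarrow> 'v set" and T :: "'v set"
  defines "U \<equiv> \<lambda>\<eta>. {x. \<not> reaches inc \<eta> x T}"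
  shows "U \<eta> = S \<longleftrightarrow> U {e \<in> \<eta>. \<not> inc e \<subseteq> S} = S"
proof -
  let ?\<eta> = "{e \<in> \<eta>. \<not> inc e \<subseteq> S}"
  have 1: "U \<eta> \<subseteq> U ?\<eta>"
    unfolding U_def using reaches_mono[of T inc ?\<eta> _ \<eta>] by blast
  show ?thesis
  proof
    assume S: "U \<eta> = S"
    have "reaches inc ?\<eta> x T" if "conn inc \<eta> x t" "t \<in> T" for x t
      using that
    proof (induction rule: conn_converse_induct)
      case refl
      then show ?case by (intro bexI[of _ t]) auto
    next
      case (step x z e)
      then have "z \<notin> S" using S by (auto simp: U_def)
      then have "conn inc ?\<eta> x z" using step by (intro conn_step[of e]) auto
      then show ?case using step by (meson conn_trans)
    qed
    then have "U ?\<eta> \<subseteq> U \<eta>" unfolding U_def by blast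
    with 1 S show "U ?\<eta> = S" by blast
  next
    assume S: "U ?\<eta> = S"
    have "x \<notin> S" if "conn inc \<eta> x t" "t \<in> T" for x t
      using that
    proof (induction rule: conn_converse_induct)
      case refl
      have "reaches inc ?\<eta> t T" using refl by (intro bexI[of _ t]) auto
      then have "t \<notin> U ?\<eta>" by (simp add: U_def)
      then show ?case using S by simp
    next
      case (step x z e)
      then have "z \<notin> S" by simp
      then have "reaches inc ?\<eta> z T" using S by (auto simp: U_def)
      moreover have "conn inc ?\<eta> x z" using step \<open>z \<notin> S\<close> by (intro conn_step[of e]) auto
      ultimately have "reaches inc ?\<eta> x T" by (meson conn_trans)
      then have "x \<notin> U ?\<eta>" by (simp add: U_def)
      then show ?case using S by simp
    qed
    then have "S \<subseteq> U \<eta>" unfolding U_def by blast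
    with 1 S show "U \<eta> = S" by blast
  qed
qed

text \<open>Exploring the cluster of \<open>v\<close> reveals only edges that touch it; the rest of
  the configuration is never consulted.\<close>

lemma cluster_determined:
  fixes inc :: "'e \<Rightarrow> 'v set" and v :: 'v
  shows "{x. conn inc \<eta> v x} = C \<longleftrightarrow> {x. conn inc {e \<in> \<eta>. inc e \<inter> C \<noteq> {}} v x} = C"
proof -
  let ?\<eta> = "{e \<in> \<eta>. inc e \<inter> C \<noteq> {}}"
  have 1: "{x. conn inc ?\<eta> v x} \<subseteq> {x. conn inc \<eta> v x}"
    by (auto elim: conn_mono)
  show ?thesis
  proof
    assume C: "{x. conn inc \<eta> v x} = C"
    have "conn inc ?\<eta> v x" if "conn inc \<eta> v x" for x
      using that
    proof (induction rule: conn_induct)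
      case (step y z e)
      then have "y \<in> C" using C by blast
      then have "conn inc ?\<eta> y z" using step by (intro conn_step[of e]) auto
      with step.IH show ?case by (rule conn_trans)
    qed simp
    with 1 C show "{x. conn inc ?\<eta> v x} = C" by blast
  next
    assume C: "{x. conn inc ?\<eta> v x} = C"
    have "x \<in> C" if "conn inc \<eta> v x" for x
      using that
    proof (induction rule: conn_induct)
      case refl
      then show ?case using C by auto
    next
      case (step y z e)
      then have "conn inc ?\<eta> y z" by (intro conn_step[of e]) auto
      moreover have "conn inc ?\<eta> v y" using step C by blast
      ultimately have "conn inc ?\<eta> v z" using C conn_trans[of inc ?\<eta> v y z] by blast
      then show ?case using C by blast
    qed
    with 1 C show "{x. conn inc \<eta> v x} = C" by blast
  qed
qed

text \<open>Total probability over the values of \<open>h\<close>. These are finitely many because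
  \<open>F\<close> is finite, even where they are subsets of an infinite vertex set.\<close>

lemma bexp_partition:
  assumes "finite F"
  shows "bexp q F f = (\<Sum>c\<in>h ` Pow F. bexp q F (\<lambda>\<eta>. of_bool (h \<eta> = c) * f \<eta>))"
proof -
  have "f \<eta> = (\<Sum>c\<in>h ` Pow F. of_bool (h \<eta> = c) * f \<eta>)" if "\<eta> \<subseteq> F" for \<eta>
  proof -
    have "(\<Sum>c\<in>h ` Pow F. of_bool (h \<eta> = c) * f \<eta>) = (\<Sum>c\<in>{h \<eta>}. of_bool (h \<eta> = c) * f \<eta>)"
      using that assms by (intro sum.mono_neutral_right) auto
    then show ?thesis by simp
  qed
  then have "bexp q F f = bexp q F (\<lambda>\<eta>. \<Sum>c\<in>h ` Pow F. of_bool (h \<eta> = c) * f \<eta>)"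
    by (rule bexp_cong)
  then show ?thesis by (simp add: bexp_sum)
qed

text \<open>Let U be the set of vertices not connected to \<open>T\<close>, and \<theta> the
  probability that \<open>v\<close> reaches \<open>T\<close>. Given U = S with v in S, the boundary
  edges of \<open>S\<close> that \<open>v\<close> reaches inside \<open>S\<close> are closed and
  pivotal, and by independence their expected number is \<open>dct_sum q F inc v S\<close> / q.
  Summing over \<open>S\<close> bounds (1 - q) times the derivative from below by (1 - \<theta>) /
  (2 q).\<close>

lemma dct_derivative_bound:
  fixes inc :: "'e \<Rightarrow> 'v set"
  assumes F: "finite F" and q: "0 < q" "q < 1"
    and large: "\<And>S. v \<in> S \<Longrightarrow> S \<inter> T = {} \<Longrightarrow> 1 / 2 \<le> dct_sum q F inc v S"
  defines "f \<equiv> \<lambda>\<eta>. of_bool (reaches inc \<eta> v T)"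
  shows "2 * (1 - bexp q F f) \<le> (\<Sum>e\<in>F. bexp q F (\<lambda>\<eta>. f (insert e \<eta>) - f (\<eta> - {e})))"
proof -
  define U where "U = (\<lambda>\<eta>. {x. \<not> reaches inc \<eta> x T})"
  let ?in = "\<lambda>S \<eta> e. reaches inc {f \<in> \<eta>. inc f \<subseteq> S} v (inc e)"
  let ?D = "\<lambda>e. bexp q F (\<lambda>\<eta>. f (insert e \<eta>) - f (\<eta> - {e}))"
  let ?N = "\<lambda>\<eta> S. \<Sum>e\<in>edge_boundary inc F S. of_bool (?in S \<eta> e) :: real"
  have f_mono: "f \<eta> \<le> f \<eta>'" if "\<eta> \<subseteq> \<eta>'" for \<eta> \<eta>'
    using reaches_mono[OF _ that, of T inc v] by (simp only: f_def of_bool_def) auto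
  \<comment> \<open>The difference ignores \<open>e\<close>, so asking in addition that
    \<open>e\<close> be closed costs exactly the factor 1 - q.\<close>
  have closed: "(1 - q) * ?D e = bexp q F (\<lambda>\<eta>. of_bool (e \<notin> \<eta>) * (f (insert e \<eta>) - f \<eta>))" if "e \<in> F" for e
  proof -
    have "(1 - q) * ?D e = bexp q F (\<lambda>\<eta>. of_bool (e \<notin> \<eta>) * (f (insert e \<eta>) - f (\<eta> - {e})))"
      by (rule bexp_open_mult(2)[OF F that, symmetric]) simp
    also have "\<dots> = bexp q F (\<lambda>\<eta>. of_bool (e \<notin> \<eta>) * (f (insert e \<eta>) - f \<eta>))"
      by (rule bexp_cong) (simp add: of_bool_def)
    finally show ?thesis .
  qed
  \<comment> \<open>A counted edge joins a vertex reached from \<open>v\<close> to a vertex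
    connected to \<open>T\<close>. It is closed, as otherwise the former would be connected to
    \<open>T\<close> too, and opening it connects \<open>v\<close> to \<open>T\<close>.\<close>
  have pivotal: "of_bool (v \<in> U \<eta>) * ?N \<eta> (U \<eta>) \<le> (\<Sum>e\<in>F. of_bool (e \<notin> \<eta>) * (f (insert e \<eta>) - f \<eta>))"
    if "\<eta> \<subseteq> F" for \<eta>
  proof -
    have inc0: "0 \<le> of_bool (e \<notin> \<eta>) * (f (insert e \<eta>) - f \<eta>)" for e
      using f_mono[of \<eta> "insert e \<eta>"] by auto
    have fin: "finite (edge_boundary inc F (U \<eta>))" "edge_boundary inc F (U \<eta>) \<subseteq> F"
      using F by (auto simp: edge_boundary_def)
    show ?thesis
    proof (cases "v \<in> U \<eta>")
      case True
      have "of_bool (?in (U \<eta>) \<eta> e) \<le> of_bool (e \<notin> \<eta>) * (f (insert e \<eta>) - f \<eta>)"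
        if e: "e \<in> edge_boundary inc F (U \<eta>)" for e
      proof (cases "?in (U \<eta>) \<eta> e")
        case True
        then obtain x where x: "x \<in> inc e" "conn inc {f \<in> \<eta>. inc f \<subseteq> U \<eta>} v x" by blast
        have xU: "x \<in> U \<eta>" using conn_stays[OF x(2) \<open>v \<in> U \<eta>\<close>] .
        obtain y where y: "y \<in> inc e" "y \<notin> U \<eta>" using e by (auto simp: edge_boundary_def)
        then obtain t where t: "t \<in> T" "conn inc \<eta> y t" by (auto simp: U_def)
        have "e \<notin> \<eta>"
        proof
          assume "e \<in> \<eta>"
          then have "conn inc \<eta> x y" using x y by (auto intro: conn_step)
          then have "conn inc \<eta> x t" using t conn_trans by metis
          then show False using xU t by (auto simp: U_def)
        qed
        moreover have "conn inc (insert e \<eta>) v t"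
        proof -
          have "conn inc (insert e \<eta>) v x" using x(2) by (rule conn_mono) auto
          moreover have "conn inc (insert e \<eta>) x y" using x y by (auto intro: conn_step)
          moreover have "conn inc (insert e \<eta>) y t" using t(2) by (rule conn_mono) auto
          ultimately show ?thesis using conn_trans by metis
        qed
        ultimately show ?thesis
          using \<open>v \<in> U \<eta>\<close> t by (auto simp: f_def U_def)
      next
        case False
        then show ?thesis using inc0[of e] by simp
      qed
      then have "?N \<eta> (U \<eta>) \<le> (\<Sum>e\<in>edge_boundary inc F (U \<eta>). of_bool (e \<notin> \<eta>) * (f (insert e \<eta>) - f \<eta>))"
        by (rule sum_mono)
      also have "\<dots> \<le> (\<Sum>e\<in>F. of_bool (e \<notin> \<eta>) * (f (insert e \<eta>) - f \<eta>))"
        using F fin inc0 by (intro sum_mono2) auto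
      finally show ?thesis using True by simp
    next
      case False
      then show ?thesis using inc0 by (simp add: sum_nonneg)
    qed
  qed
  have UT: "S \<inter> T = {}" if "S \<in> U ` Pow F" for S
    using that by (force simp: U_def)
  have pos: "0 < q * (1 - q)" using q by simp
  have quarter: "q * (1 - q) \<le> 1 / 4"
    using zero_le_power2[of "q - 1/2"] by (simp add: power2_eq_square algebra_simps)
  have "(1 - bexp q F f) / 2 = bexp q F (\<lambda>\<eta>. of_bool (v \<in> U \<eta>)) / 2"
  proof -
    have "1 - bexp q F f = bexp q F (\<lambda>\<eta>. 1 - f \<eta>)"
      using F by (simp add: bexp_diff bexp_const)
    also have "\<dots> = bexp q F (\<lambda>\<eta>. of_bool (v \<in> U \<eta>))"
      by (rule bexp_cong) (auto simp: f_def U_def)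
    finally show ?thesis by simp
  qed
  also have "\<dots> = (\<Sum>S\<in>U ` Pow F. bexp q F (\<lambda>\<eta>. of_bool (U \<eta> = S) * of_bool (v \<in> U \<eta>)) / 2)"
    by (subst bexp_partition[OF F, of _ _ U]) (simp add: sum_divide_distrib)
  also have "\<dots> \<le> (\<Sum>S\<in>U ` Pow F. q * bexp q F (\<lambda>\<eta>. of_bool (U \<eta> = S) * (of_bool (v \<in> U \<eta>) * ?N \<eta> (U \<eta>))))"
  proof (rule sum_mono)
    fix S assume S: "S \<in> U ` Pow F"
    have rw: "bexp q F (\<lambda>\<eta>. of_bool (U \<eta> = S) * (of_bool (v \<in> U \<eta>) * ?N \<eta> (U \<eta>))) =
          of_bool (v \<in> S) * bexp q F (\<lambda>\<eta>. ?N \<eta> S * of_bool (U \<eta> = S))"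
      unfolding bexp_cmult[symmetric] by (rule bexp_cong) (auto simp: of_bool_def)
    \<comment> \<open>Connections inside \<open>S\<close> use only edges contained in
      \<open>S\<close>; the event U = S depends only on the others.\<close>
    have "bexp q F (\<lambda>\<eta>. ?N \<eta> S * of_bool (U \<eta> = S)) = bexp q F (\<lambda>\<eta>. ?N \<eta> S) * bexp q F (\<lambda>\<eta>. of_bool (U \<eta> = S))"
    proof (rule bexp_indep[OF F, where A = "{e. inc e \<subseteq> S}"])
      fix \<eta>
      have eqs: "{f \<in> \<eta> \<inter> {e. inc e \<subseteq> S}. inc f \<subseteq> S} = {f \<in> \<eta>. inc f \<subseteq> S}"
        "\<eta> - {e. inc e \<subseteq> S} = {e \<in> \<eta>. \<not> inc e \<subseteq> S}" by auto
      show "?N \<eta> S = ?N (\<eta> \<inter> {e. inc e \<subseteq> S}) S" unfolding eqs ..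
      show "of_bool (U \<eta> = S) = of_bool (U (\<eta> - {e. inc e \<subseteq> S}) = S)"
        unfolding eqs using unreached_determined[of T inc \<eta> S] by (simp add: U_def)
    qed
    then have "q * bexp q F (\<lambda>\<eta>. ?N \<eta> S * of_bool (U \<eta> = S)) = dct_sum q F inc v S * bexp q F (\<lambda>\<eta>. of_bool (U \<eta> = S))"
      by (simp add: dct_sum_def bexp_sum)
    moreover have "1 / 2 * bexp q F (\<lambda>\<eta>. of_bool (U \<eta> = S)) \<le> dct_sum q F inc v S * bexp q F (\<lambda>\<eta>. of_bool (U \<eta> = S))"
      if "v \<in> S" using large[OF that UT[OF S]] q by (intro mult_right_mono bexp_nonneg) auto
    moreover have "bexp q F (\<lambda>\<eta>. of_bool (U \<eta> = S) * of_bool (v \<in> U \<eta>)) = of_bool (v \<in> S) * bexp q F (\<lambda>\<eta>. of_bool (U \<eta> = S))"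
      unfolding bexp_cmult[symmetric] by (rule bexp_cong) (auto simp: of_bool_def)
    ultimately show "bexp q F (\<lambda>\<eta>. of_bool (U \<eta> = S) * of_bool (v \<in> U \<eta>)) / 2
        \<le> q * bexp q F (\<lambda>\<eta>. of_bool (U \<eta> = S) * (of_bool (v \<in> U \<eta>) * ?N \<eta> (U \<eta>)))"
      unfolding rw by (cases "v \<in> S") auto
  qed
  also have "\<dots> = q * bexp q F (\<lambda>\<eta>. of_bool (v \<in> U \<eta>) * ?N \<eta> (U \<eta>))"
    by (subst (2) bexp_partition[OF F, of _ _ U]) (simp add: sum_distrib_left)
  also have "\<dots> \<le> q * bexp q F (\<lambda>\<eta>. \<Sum>e\<in>F. of_bool (e \<notin> \<eta>) * (f (insert e \<eta>) - f \<eta>))"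
    using q pivotal by (intro mult_left_mono bexp_mono) auto
  also have "\<dots> = q * (\<Sum>e\<in>F. (1 - q) * ?D e)"
    by (simp add: bexp_sum closed)
  also have "\<dots> = q * (1 - q) * (\<Sum>e\<in>F. ?D e)"
    by (simp add: sum_distrib_left mult.assoc)
  finally have main: "(1 - bexp q F f) / 2 \<le> q * (1 - q) * (\<Sum>e\<in>F. ?D e)" .
  moreover have "0 \<le> (\<Sum>e\<in>F. ?D e)"
    using q by (intro sum_nonneg bexp_nonneg) (auto intro: f_mono)
  then have "q * (1 - q) * (\<Sum>e\<in>F. ?D e) \<le> 1 / 4 * (\<Sum>e\<in>F. ?D e)"
    using quarter by (intro mult_right_mono)
  ultimately show ?thesis by linarith
qed

text \<open>If every \<open>S\<close> has \<open>dct_sum p F inc v S\<close> above 1/2, the same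
  holds at all q between p and p', and the differential inequality makes (1 - \<theta>(q)) exp (2 q)
  nonincreasing there, \<theta>(q) being the probability of reaching \<open>T\<close>. Comparing the
  two ends gives the first alternative.\<close>

lemma dct_dichotomy:
  fixes inc :: "'e \<Rightarrow> 'v set"
  assumes F: "finite F" and p: "0 \<le> p" "p < p'" "p' \<le> 1" and v: "v \<notin> T"
  shows "1 - exp (- 2 * (p' - p)) \<le> bexp p' F (\<lambda>\<eta>. of_bool (reaches inc \<eta> v T)) \<or>
         (\<exists>S. v \<in> S \<and> S \<inter> T = {} \<and> dct_sum p F inc v S \<le> 1 / 2)"
proof (rule disjCI)
  assume neg: "\<nexists>S. v \<in> S \<and> S \<inter> T = {} \<and> dct_sum p F inc v S \<le> 1 / 2"
  define f where "f = (\<lambda>\<eta>. of_bool (reaches inc \<eta> v T) :: real)"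
  define D where "D = (\<lambda>q. \<Sum>e\<in>F. bexp q F (\<lambda>\<eta>. f (insert e \<eta>) - f (\<eta> - {e})))"
  \<comment> \<open>At p = 0 the set {v}, disjoint from \<open>T\<close> because
    \<open>v \<notin> T\<close>, would contradict \<open>neg\<close>.\<close>
  have "dct_sum 0 F inc v {v} = 0" by (simp add: dct_sum_def)
  with neg v p have "0 < p" by (cases "p = 0") auto
  have deriv: "((\<lambda>q. (1 - bexp q F f) * exp (2 * q)) has_real_derivative
          (2 * (1 - bexp q F f) - D q) * exp (2 * q)) (at q)" for q
    unfolding D_def
    by (rule derivative_eq_intros russo_formula[OF F] refl)+ (simp add: algebra_simps)
  have "(1 - bexp p' F f) * exp (2 * p') \<le> (1 - bexp p F f) * exp (2 * p)"
  proof (rule DERIV_nonpos_imp_decreasing_open[OF less_imp_le[OF \<open>p < p'\<close>]])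
    fix q assume q: "p < q" "q < p'"
    have "1 / 2 \<le> dct_sum q F inc v S" if "v \<in> S" "S \<inter> T = {}" for S
    proof -
      have "1 / 2 \<le> dct_sum p F inc v S"
        using neg that linear by blast
      also have "\<dots> \<le> dct_sum q F inc v S"
        using p q by (intro dct_sum_mono[OF F]) auto
      finally show ?thesis .
    qed
    then have "2 * (1 - bexp q F f) \<le> D q"
      unfolding D_def f_def using \<open>0 < p\<close> p q F by (intro dct_derivative_bound) auto
    then have "(2 * (1 - bexp q F f) - D q) * exp (2 * q) \<le> 0"
      by (simp add: mult_nonpos_nonneg)
    then show "\<exists>y. ((\<lambda>q. (1 - bexp q F f) * exp (2 * q)) has_real_derivative y) (at q) \<and> y \<le> 0"
      using deriv by blast
  next
    show "continuous_on {p..p'} (\<lambda>q. (1 - bexp q F f) * exp (2 * q))"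
      using deriv by (intro DERIV_continuous_on) (blast intro: has_field_derivative_at_within)
  qed
  also have "\<dots> \<le> exp (2 * p)"
  proof -
    have "0 \<le> bexp p F f" using p by (intro bexp_nonneg) (auto simp: f_def)
    then show ?thesis by (simp add: mult_left_le_one_le bexp_le_1 F p f_def)
  qed
  finally have "(1 - bexp p' F f) \<le> exp (2 * p) / exp (2 * p')"
    by (simp add: field_simps)
  then show "1 - exp (- 2 * (p' - p)) \<le> bexp p' F (\<lambda>\<eta>. of_bool (reaches inc \<eta> v T))"
    by (simp add: f_def exp_diff[symmetric] algebra_simps)
qed

text \<open>
  The last exit of an open path from the cluster of \<open>v\<close> inside \<open>S\<close> decouples the path into three
  pieces determined by disjoint sets of edges.
\<close>

lemma dct_iteration:
  fixes inc :: "'e \<Rightarrow> 'v set"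
  assumes F: "finite F" and q: "0 \<le> q" "q \<le> 1" and v: "v \<in> S" and T: "S \<inter> T = {}"
    and pairs: "\<And>e. e \<in> F \<Longrightarrow> \<exists>x y. inc e = {x, y}"
    and B: "\<And>e. e \<in> edge_boundary inc F S \<Longrightarrow>
              bexp q F (\<lambda>\<eta>. of_bool (\<exists>y\<in>inc e - S. reaches inc \<eta> y T)) \<le> B"
  shows "bexp q F (\<lambda>\<eta>. of_bool (reaches inc \<eta> v T)) \<le> dct_sum q F inc v S * B"
proof -
  \<comment> \<open>The cluster of \<open>v\<close> inside \<open>S\<close>; exploring it looks only
    at edges contained in \<open>S\<close>.\<close>
  define K where "K = (\<lambda>\<eta>. {x. conn inc {f \<in> \<eta>. inc f \<subseteq> S} v x})"
  let ?off = "\<lambda>C \<eta> e. \<exists>y\<in>inc e - S. reaches inc {f \<in> \<eta>. inc f \<inter> C = {}} y T"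
  let ?I = "edge_boundary inc F S"
  have KS: "K \<eta> \<subseteq> S" for \<eta>
    using conn_stays v by (fastforce simp: K_def)
  have vK: "v \<in> K \<eta>" for \<eta>
    by (simp add: K_def)
  \<comment> \<open>The path is followed backwards from t. While it stays off the cluster it uses no
    edge touching the cluster; the edge on which it first enters the cluster cannot lie inside
    \<open>S\<close>, so it is a boundary edge whose outer end is outside \<open>S\<close>.\<close>
  have exit: "\<exists>e\<in>?I. e \<in> \<eta> \<and> inc e \<inter> K \<eta> \<noteq> {} \<and> ?off (K \<eta>) \<eta> e"
    if "\<eta> \<subseteq> F" "conn inc \<eta> v t" "t \<in> T" for \<eta> t
  proof -
    have "(x \<notin> K \<eta> \<and> conn inc {f \<in> \<eta>. inc f \<inter> K \<eta> = {}} x t) \<or>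
          (\<exists>e\<in>?I. e \<in> \<eta> \<and> inc e \<inter> K \<eta> \<noteq> {} \<and> ?off (K \<eta>) \<eta> e)"
      if "conn inc \<eta> x t" for x
      using that
    proof (induction rule: conn_converse_induct)
      case refl
      then show ?case using \<open>t \<in> T\<close> T KS[of \<eta>] by auto
    next
      case (step x z e)
      show ?case
      proof (cases "z \<notin> K \<eta> \<and> conn inc {f \<in> \<eta>. inc f \<inter> K \<eta> = {}} z t")
        case False
        with step show ?thesis by blast
      next
        case True
        have eF: "e \<in> F" using step \<open>\<eta> \<subseteq> F\<close> by blast
        show ?thesis
        proof (cases "x \<in> K \<eta>")
          case False
          show ?thesis
          \<comment> \<open>If x = z, the other end of e may lie in the cluster, but then the step
            has not moved at all.\<close>
          proof (cases "x = z")
            case True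
            with \<open>z \<notin> K \<eta> \<and> _\<close> show ?thesis by simp
          next
            case xz: False
            from False have "inc e \<inter> K \<eta> = {}"
              using pairs[OF eF] step True xz by auto
            then have "conn inc {f \<in> \<eta>. inc f \<inter> K \<eta> = {}} x z"
              using step by (intro conn_step[of e]) auto
            then have "conn inc {f \<in> \<eta>. inc f \<inter> K \<eta> = {}} x t"
              by (rule conn_trans[OF _ conjunct2[OF True]])
            then show ?thesis using False by blast
          qed
        next
          case xK: True
          have "\<not> inc e \<subseteq> S"
          proof
            assume "inc e \<subseteq> S"
            then have "conn inc {f \<in> \<eta>. inc f \<subseteq> S} x z"
              using step by (intro conn_step[of e]) auto
            then have "z \<in> K \<eta>" using xK conn_trans[of inc "{f \<in> \<eta>. inc f \<subseteq> S}" v x z] by (simp add: K_def)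
            with True show False by simp
          qed
          moreover have "x \<in> S" "x \<in> inc e" using xK KS step by auto
          moreover have "inc e = {x, z}"
            using pairs[OF eF] step(2-4) True xK by auto
          ultimately have "e \<in> ?I" "z \<notin> S"
            using eF by (simp_all add: edge_boundary_def)
          then show ?thesis
            using True step xK \<open>t \<in> T\<close> by blast
        qed
      qed
    qed
    from this[OF \<open>conn inc \<eta> v t\<close>] vK show ?thesis by blast
  qed
  have "bexp q F (\<lambda>\<eta>. of_bool (reaches inc \<eta> v T)) \<le>
     bexp q F (\<lambda>\<eta>. \<Sum>e\<in>?I. of_bool (inc e \<inter> K \<eta> \<noteq> {}) * (of_bool (e \<in> \<eta>) * of_bool (?off (K \<eta>) \<eta> e)))"
  proof (rule bexp_mono[OF q])
    fix \<eta> assume \<eta>: "\<eta> \<subseteq> F"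
    let ?g = "\<lambda>e. of_bool (inc e \<inter> K \<eta> \<noteq> {}) * (of_bool (e \<in> \<eta>) * of_bool (?off (K \<eta>) \<eta> e)) :: real"
    show "of_bool (reaches inc \<eta> v T) \<le> sum ?g ?I"
    proof (cases "reaches inc \<eta> v T")
      case True
      then obtain e where e: "e \<in> ?I" "e \<in> \<eta>" "inc e \<inter> K \<eta> \<noteq> {}" "?off (K \<eta>) \<eta> e"
        using exit[OF \<eta>] by blast
      have "finite ?I" using F by (simp add: edge_boundary_def)
      then have "?g e \<le> sum ?g ?I" using e(1) by (intro member_le_sum) auto
      moreover have "?g e = 1" using e by simp
      ultimately show ?thesis using True by simp
    qed (simp add: sum_nonneg)
  qed
  also have "\<dots> = (\<Sum>e\<in>?I. bexp q F (\<lambda>\<eta>. of_bool (inc e \<inter> K \<eta> \<noteq> {}) * (of_bool (e \<in> \<eta>) * of_bool (?off (K \<eta>) \<eta> e))))"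
    by (rule bexp_sum)
  also have "\<dots> \<le> (\<Sum>e\<in>?I. q * bexp q F (\<lambda>\<eta>. of_bool (reaches inc {f \<in> \<eta>. inc f \<subseteq> S} v (inc e))) * B)"
  proof (rule sum_mono)
    fix e assume e: "e \<in> ?I"
    then have eF: "e \<in> F" and eS: "\<not> inc e \<subseteq> S" by (auto simp: edge_boundary_def)
    have "bexp q F (\<lambda>\<eta>. of_bool (inc e \<inter> K \<eta> \<noteq> {}) * (of_bool (e \<in> \<eta>) * of_bool (?off (K \<eta>) \<eta> e))) =
      (\<Sum>C\<in>K ` Pow F. bexp q F (\<lambda>\<eta>. of_bool (K \<eta> = C) *
           (of_bool (inc e \<inter> K \<eta> \<noteq> {}) * (of_bool (e \<in> \<eta>) * of_bool (?off (K \<eta>) \<eta> e)))))"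
      by (rule bexp_partition[OF F])
    also have "\<dots> \<le> (\<Sum>C\<in>K ` Pow F. q * B * bexp q F (\<lambda>\<eta>. of_bool (K \<eta> = C) * of_bool (inc e \<inter> K \<eta> \<noteq> {})))"
    proof (rule sum_mono)
      fix C assume "C \<in> K ` Pow F"
      show "bexp q F (\<lambda>\<eta>. of_bool (K \<eta> = C) *
           (of_bool (inc e \<inter> K \<eta> \<noteq> {}) * (of_bool (e \<in> \<eta>) * of_bool (?off (K \<eta>) \<eta> e)))) \<le>
           q * B * bexp q F (\<lambda>\<eta>. of_bool (K \<eta> = C) * of_bool (inc e \<inter> K \<eta> \<noteq> {}))"
      proof (cases "inc e \<inter> C = {}")
        case True
        have "bexp q F (\<lambda>\<eta>. of_bool (K \<eta> = C) * (of_bool (inc e \<inter> K \<eta> \<noteq> {}) * g \<eta>)) = bexp q F (\<lambda>\<eta>. 0)" for g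
          using True by (intro bexp_cong) (auto simp: of_bool_def)
        from this[of "\<lambda>_. 1"] this[of "\<lambda>\<eta>. of_bool (e \<in> \<eta>) * of_bool (?off (K \<eta>) \<eta> e)"] show ?thesis
          using F by (simp add: bexp_const)
      next
        case False
        \<comment> \<open>The value of the cluster is decided by the edges inside \<open>S\<close>
          that touch \<open>C\<close>. The edge \<open>e\<close> is not inside \<open>S\<close>, and
          the remaining path avoids all edges touching \<open>C\<close>, so both are independent of
          that value.\<close>
        let ?A = "{f. inc f \<inter> C \<noteq> {} \<and> inc f \<subseteq> S}"
        have "bexp q F (\<lambda>\<eta>. of_bool (K \<eta> = C) *
           (of_bool (inc e \<inter> K \<eta> \<noteq> {}) * (of_bool (e \<in> \<eta>) * of_bool (?off (K \<eta>) \<eta> e)))) =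
           bexp q F (\<lambda>\<eta>. of_bool (K \<eta> = C) * (of_bool (e \<in> \<eta>) * of_bool (?off C \<eta> e)))"
          using False by (intro bexp_cong) (auto simp: of_bool_def)
        also have "\<dots> = bexp q F (\<lambda>\<eta>. of_bool (K \<eta> = C)) * bexp q F (\<lambda>\<eta>. of_bool (e \<in> \<eta>) * of_bool (?off C \<eta> e))"
        proof (rule bexp_indep[OF F, where A = ?A])
          fix \<eta>
          have "{e \<in> {f \<in> \<eta>. inc f \<subseteq> S}. inc e \<inter> C \<noteq> {}} = {e \<in> {f \<in> \<eta> \<inter> ?A. inc f \<subseteq> S}. inc e \<inter> C \<noteq> {}}"
            by auto
          then show "of_bool (K \<eta> = C) = of_bool (K (\<eta> \<inter> ?A) = C)"
            using cluster_determined[of inc "{f \<in> \<eta>. inc f \<subseteq> S}" v C]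
              cluster_determined[of inc "{f \<in> \<eta> \<inter> ?A. inc f \<subseteq> S}" v C]
            unfolding K_def by simp
          have "{f \<in> \<eta> - ?A. inc f \<inter> C = {}} = {f \<in> \<eta>. inc f \<inter> C = {}}" by auto
          then show "of_bool (e \<in> \<eta>) * of_bool (?off C \<eta> e) =
              of_bool (e \<in> \<eta> - ?A) * of_bool (?off C (\<eta> - ?A) e)"
            using eS by simp
        qed
        \<comment> \<open>\<open>e\<close> touches \<open>C\<close>, so the connection off
          \<open>C\<close> does not see it, and its being open contributes the factor q.\<close>
        also have "bexp q F (\<lambda>\<eta>. of_bool (e \<in> \<eta>) * of_bool (?off C \<eta> e)) = q * bexp q F (\<lambda>\<eta>. of_bool (?off C \<eta> e))"
        proof (rule bexp_open_mult(1)[OF F eF])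
          fix \<eta>
          have "{f \<in> insert e \<eta>. inc f \<inter> C = {}} = {f \<in> \<eta>. inc f \<inter> C = {}}" using False by auto
          then show "of_bool (?off C (insert e \<eta>) e) = of_bool (?off C \<eta> e)" by simp
        qed
        \<comment> \<open>Allowing the remaining connection to use all open edges only increases its
          probability and gives the form bounded by \<open>B\<close>.\<close>
        also have "bexp q F (\<lambda>\<eta>. of_bool (K \<eta> = C)) * (q * bexp q F (\<lambda>\<eta>. of_bool (?off C \<eta> e))) \<le>
            bexp q F (\<lambda>\<eta>. of_bool (K \<eta> = C)) * (q * bexp q F (\<lambda>\<eta>. of_bool (\<exists>y\<in>inc e - S. reaches inc \<eta> y T)))"
        proof (intro mult_left_mono bexp_nonneg q)
          show "bexp q F (\<lambda>\<eta>. of_bool (?off C \<eta> e)) \<le> bexp q F (\<lambda>\<eta>. of_bool (\<exists>y\<in>inc e - S. reaches inc \<eta> y T))"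
          proof (rule bexp_mono[OF q])
            fix \<eta>
            have "?off C \<eta> e \<Longrightarrow> \<exists>y\<in>inc e - S. reaches inc \<eta> y T"
              using reaches_mono[of T inc "{f \<in> \<eta>. inc f \<inter> C = {}}" _ \<eta>] by blast
            then show "of_bool (?off C \<eta> e) \<le> (of_bool (\<exists>y\<in>inc e - S. reaches inc \<eta> y T) :: real)"
              unfolding of_bool_def by auto
          qed
        qed simp
        also have "\<dots> \<le> bexp q F (\<lambda>\<eta>. of_bool (K \<eta> = C)) * (q * B)"
          by (intro mult_left_mono bexp_nonneg q B[OF e]) simp
        finally have "bexp q F (\<lambda>\<eta>. of_bool (K \<eta> = C) *
           (of_bool (inc e \<inter> K \<eta> \<noteq> {}) * (of_bool (e \<in> \<eta>) * of_bool (?off (K \<eta>) \<eta> e)))) \<le>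
            q * B * bexp q F (\<lambda>\<eta>. of_bool (K \<eta> = C))"
          by (simp only: mult_ac)
        also have "bexp q F (\<lambda>\<eta>. of_bool (K \<eta> = C)) = bexp q F (\<lambda>\<eta>. of_bool (K \<eta> = C) * of_bool (inc e \<inter> K \<eta> \<noteq> {}))"
          using False by (intro bexp_cong) (auto simp: of_bool_def)
        finally show ?thesis .
      qed
    qed
    also have "\<dots> = q * B * bexp q F (\<lambda>\<eta>. of_bool (inc e \<inter> K \<eta> \<noteq> {}))"
      unfolding bexp_partition[OF F, of q "\<lambda>\<eta>. of_bool (inc e \<inter> K \<eta> \<noteq> {})" K] sum_distrib_left ..
    also have "bexp q F (\<lambda>\<eta>. of_bool (inc e \<inter> K \<eta> \<noteq> {})) = bexp q F (\<lambda>\<eta>. of_bool (reaches inc {f \<in> \<eta>. inc f \<subseteq> S} v (inc e)))"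
      by (intro bexp_cong arg_cong[of _ _ of_bool]) (auto simp: K_def)
    finally show "bexp q F (\<lambda>\<eta>. of_bool (inc e \<inter> K \<eta> \<noteq> {}) * (of_bool (e \<in> \<eta>) * of_bool (?off (K \<eta>) \<eta> e)))
        \<le> q * bexp q F (\<lambda>\<eta>. of_bool (reaches inc {f \<in> \<eta>. inc f \<subseteq> S} v (inc e))) * B"
      by (simp add: mult_ac)
  qed
  also have "\<dots> = dct_sum q F inc v S * B"
    by (simp add: dct_sum_def sum_distrib_left sum_distrib_right mult.assoc)
  finally show ?thesis .
qed

section \<open>The ball model and the isometries of hyperbolic space\<close>

lemma norm_base_point [simp]: "norm (base_point :: 'n::finite hpoint) = 1"
  by (simp add: base_point_def norm_Pair)

lemma base_point_nonzero [simp]: "base_point \<noteq> (0 :: 'n::finite hpoint)"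
  by (simp add: base_point_def prod_eq_iff)

lemma fst_snd_base_point [simp]: "fst (base_point :: 'n::finite hpoint) = 0" "snd (base_point :: 'n::finite hpoint) = 1"
  by (simp_all add: base_point_def)

lemma inner_base_point [simp]: "y \<bullet> (base_point :: 'n::finite hpoint) = snd y" "base_point \<bullet> y = snd y"
  by (simp_all add: base_point_def inner_prod_def)

lemma base_point_hspace [simp]: "base_point \<in> hspace"
  by (simp add: base_point_def hspace_def)

lemma hspace_add_base_point: "y \<in> hspace \<Longrightarrow> y + base_point \<noteq> 0"
  by (auto simp: hspace_def base_point_def prod_eq_iff)

text \<open>
  The inversion exchanging the half-space model and the ball model; it is an involution and maps
  the point \<open>(0, -1)\<close> of the sphere, which corresponds to the point \<open>None\<close> at infinity, to itself
  because of \<open>1 / 0 = 0\<close>.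
\<close>

definition cayley :: "'n::finite hpoint \<Rightarrow> 'n hpoint" where
  "cayley y = (2 / (norm (y + base_point))\<^sup>2) *\<^sub>R (y + base_point) - base_point"

lemma norm_cayley_add: "norm (cayley y + base_point) = 2 / norm (y + base_point)"
  by (simp add: cayley_def power2_eq_square)

lemma cayley_cayley [simp]: "cayley (cayley y) = y"
proof -
  have "cayley (cayley y) = (2 / (2 / norm (y + base_point))\<^sup>2) *\<^sub>R (cayley y + base_point) - base_point"
    unfolding cayley_def[of "cayley y"] norm_cayley_add ..
  also have "\<dots> = y"
    by (cases "y + base_point = 0") (simp_all add: cayley_def power2_eq_square add_eq_0_iff2)
  finally show ?thesis .
qed

text \<open>\<open>cayley\<close> is the inversion in the sphere of squared radius 2 about -
  \<open>base_point\<close>; an inversion of squared radius k about c changes distances by the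
  factor k / (|x - c| |y - c|).\<close>

lemma dist_cayley:
  assumes "x + base_point \<noteq> 0" "y + base_point \<noteq> 0"
  shows "(dist (cayley x) (cayley y))\<^sup>2 =
           4 * (dist x y)\<^sup>2 / ((norm (x + base_point))\<^sup>2 * (norm (y + base_point))\<^sup>2)"
proof -
  define a b where "a = x + base_point" and "b = y + base_point"
  have 0: "a \<noteq> 0" "b \<noteq> 0" using assms by (simp_all add: a_def b_def)
  have "(dist (cayley x) (cayley y))\<^sup>2 = (norm ((2 / (norm a)\<^sup>2) *\<^sub>R a - (2 / (norm b)\<^sup>2) *\<^sub>R b))\<^sup>2"
    by (simp add: cayley_def dist_norm a_def b_def)
  also have "\<dots> = 4 * ((a \<bullet> a) - 2 * (a \<bullet> b) + b \<bullet> b) / ((a \<bullet> a) * (b \<bullet> b))"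
    using 0 unfolding power2_norm_eq_inner
    by (simp add: inner_diff_left inner_diff_right inner_commute divide_simps)
  also have "(a \<bullet> a) - 2 * (a \<bullet> b) + b \<bullet> b = (norm (a - b))\<^sup>2"
    unfolding power2_norm_eq_inner by (simp add: inner_diff_left inner_diff_right inner_commute)
  also have "a - b = x - y" by (simp add: a_def b_def)
  finally show ?thesis by (simp add: dist_norm a_def b_def power2_norm_eq_inner)
qed

text \<open>Up to scaling, the height becomes the defect 1 - |u|^2 of the ball model; so the
  half-space corresponds to the open unit ball, and height 0 to the unit sphere.\<close>

lemma norm_cayley:
  assumes "y + base_point \<noteq> 0"
  shows "1 - (norm (cayley y))\<^sup>2 = 4 * snd y / (norm (y + base_point))\<^sup>2"
proof -
  define a where "a = y + base_point"
  have 0: "a \<noteq> 0" using assms by (simp add: a_def)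
  have "(norm (cayley y))\<^sup>2 = (norm ((2 / (norm a)\<^sup>2) *\<^sub>R a - base_point))\<^sup>2"
    by (simp add: cayley_def a_def)
  also have "\<dots> = 4 / (norm a)\<^sup>2 - 4 * snd a / (norm a)\<^sup>2 + 1"
    using 0 unfolding power2_norm_eq_inner
    by (simp add: inner_diff_left inner_diff_right inner_commute divide_simps)
  finally show ?thesis
    using 0 by (simp add: a_def base_point_def field_simps)
qed

lemma cayley_hspace_iff:
  assumes "u + base_point \<noteq> 0"
  shows "cayley u \<in> hspace \<longleftrightarrow> norm u < 1"
proof -
  have 1: "cayley u + base_point \<noteq> 0"
    using norm_cayley_add[of u] assms by auto
  have "1 - (norm u)\<^sup>2 = 4 * snd (cayley u) / (norm (cayley u + base_point))\<^sup>2"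
    using norm_cayley[OF 1] by simp
  then have "0 < snd (cayley u) \<longleftrightarrow> 0 < 1 - (norm u)\<^sup>2"
    using 1 by (simp add: zero_less_divide_iff)
  then show ?thesis
    by (simp add: hspace_def power_less_one_iff abs_square_less_1)
qed

lemma norm_less_1_add_base_point: "norm u < 1 \<Longrightarrow> u + base_point \<noteq> (0 :: 'n::finite hpoint)"
  using norm_base_point by (metis add_eq_0_iff2 less_irrefl norm_minus_cancel)

lemma norm_cayley_less_1: "y \<in> hspace \<Longrightarrow> norm (cayley y) < 1"
  using cayley_hspace_iff[of "cayley y"] norm_cayley_add[of y] hspace_add_base_point[of y]
  by (metis cayley_cayley divide_eq_0_iff norm_eq_zero zero_neq_numeral)

lemma cayley_hspace: "norm u < 1 \<Longrightarrow> cayley u \<in> hspace"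
  using cayley_hspace_iff norm_less_1_add_base_point by blast

lemma cayley_base_point [simp]: "cayley base_point = 0"
  by (simp add: cayley_def base_point_def norm_Pair zero_prod_def)

lemma cayley_0 [simp]: "cayley 0 = base_point"
  using cayley_cayley[of base_point] by simp

text \<open>This is 2 (cosh d - 1) for the hyperbolic distance d of points of \<open>hspace\<close>.
  Being rational in the coordinates and squared distances, it turns isometry into algebra.\<close>

definition hratio :: "'n::finite hpoint \<Rightarrow> 'n hpoint \<Rightarrow> real" where
  "hratio y z = (dist y z)\<^sup>2 / (snd y * snd z)"

lemma hratio_nonneg: "y \<in> hspace \<Longrightarrow> z \<in> hspace \<Longrightarrow> 0 \<le> hratio y z"
  by (simp add: hratio_def hspace_def)

lemma cosh_hdist: "y \<in> hspace \<Longrightarrow> z \<in> hspace \<Longrightarrow> cosh (hdist y z) = 1 + hratio y z / 2"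
  using hratio_nonneg[of y z] by (simp add: hdist_def hratio_def field_simps)

lemma hdist_hratio: "hdist y z = arcosh (1 + hratio y z / 2)"
  by (simp add: hdist_def hratio_def field_simps)

lemma hdist_eq_iff:
  "y \<in> hspace \<Longrightarrow> z \<in> hspace \<Longrightarrow> y' \<in> hspace \<Longrightarrow> z' \<in> hspace \<Longrightarrow>
     hdist y z = hdist y' z' \<longleftrightarrow> hratio y z = hratio y' z'"
  by (metis add_left_cancel cosh_hdist divide_cancel_right hdist_hratio zero_neq_numeral)

lemma hratio_cayley:
  assumes "y \<in> hspace" "z \<in> hspace"
  shows "hratio y z = 4 * (dist (cayley y) (cayley z))\<^sup>2 / ((1 - (norm (cayley y))\<^sup>2) * (1 - (norm (cayley z))\<^sup>2))"
proof -
  have "y + base_point \<noteq> 0" "z + base_point \<noteq> 0"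
    using assms by (simp_all add: hspace_add_base_point)
  moreover have "0 < snd y" "0 < snd z" using assms by (auto simp: hspace_def)
  ultimately show ?thesis
    by (simp add: dist_cayley norm_cayley hratio_def field_simps)
qed

text \<open>Isometries without the extensionality that \<open>hisometries\<close> demands, so that
  translations, dilations and compositions can be written as plain functions.\<close>

definition hiso :: "('n::finite hpoint \<Rightarrow> 'n hpoint) \<Rightarrow> bool" where
  "hiso \<phi> \<longleftrightarrow> bij_betw \<phi> hspace hspace \<and> (\<forall>y\<in>hspace. \<forall>z\<in>hspace. hratio (\<phi> y) (\<phi> z) = hratio y z)"

lemma hiso_hspace: "hiso \<phi> \<Longrightarrow> y \<in> hspace \<Longrightarrow> \<phi> y \<in> hspace"
  unfolding hiso_def bij_betw_def by blast

lemma hiso_inj: "hiso \<phi> \<Longrightarrow> inj_on \<phi> hspace"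
  unfolding hiso_def bij_betw_def by blast

lemma hiso_hratio: "hiso \<phi> \<Longrightarrow> y \<in> hspace \<Longrightarrow> z \<in> hspace \<Longrightarrow> hratio (\<phi> y) (\<phi> z) = hratio y z"
  unfolding hiso_def by blast

lemma hisometries_iff: "\<phi> \<in> hisometries \<longleftrightarrow> \<phi> \<in> extensional hspace \<and> hiso \<phi>"
proof -
  have "hdist (\<phi> y) (\<phi> z) = hdist y z \<longleftrightarrow> hratio (\<phi> y) (\<phi> z) = hratio y z"
    if "bij_betw \<phi> hspace hspace" "y \<in> hspace" "z \<in> hspace" for y z
    using that by (intro hdist_eq_iff) (auto dest: bij_betwE)
  then show ?thesis
    unfolding hisometries_def hiso_def Bij_def by blast
qed

lemma hiso_comp: "hiso \<phi> \<Longrightarrow> hiso \<gamma> \<Longrightarrow> hiso (\<lambda>y. \<phi> (\<gamma> y))"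
  using bij_betw_trans[of \<gamma> hspace hspace \<phi> hspace]
  by (auto simp: hiso_def o_def dest: bij_betwE)

lemma hiso_affine:
  assumes "0 < c"
  shows "hiso (\<lambda>y. c *\<^sub>R (y - (a, 0)))"
proof -
  have "bij_betw (\<lambda>y. c *\<^sub>R (y - (a, 0))) hspace hspace"
    by (rule bij_betw_byWitness[where f' = "\<lambda>y. (1 / c) *\<^sub>R y + (a, 0)"])
       (use assms in \<open>auto simp: hspace_def\<close>)
  moreover have "hratio (c *\<^sub>R (y - (a, 0))) (c *\<^sub>R (z - (a, 0))) = hratio y z" for y z
    using assms by (simp add: hratio_def dist_norm scaleR_diff_right[symmetric] power_mult_distrib power2_eq_square)
  ultimately show ?thesis by (simp add: hiso_def)
qed

text \<open>In the ball model the distance to the centre determines the Euclidean norm, after which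
  mutual hyperbolic distances determine Euclidean ones; polarisation then gives the inner
  products.\<close>

lemma cayley_inner_eq:
  assumes "hiso \<phi>" "\<phi> base_point = base_point" "y \<in> hspace" "z \<in> hspace"
  shows "cayley (\<phi> y) \<bullet> cayley (\<phi> z) = cayley y \<bullet> cayley z"
proof -
  have norm_eq: "(norm (cayley (\<phi> w)))\<^sup>2 = (norm (cayley w))\<^sup>2" if w: "w \<in> hspace" for w
  proof -
    have "hratio (\<phi> w) base_point = hratio w base_point"
      using hiso_hratio[OF assms(1) w, of base_point] assms(2) by simp
    moreover have "1 - (norm (cayley w))\<^sup>2 > 0" "1 - (norm (cayley (\<phi> w)))\<^sup>2 > 0"
      using norm_cayley_less_1[OF w] norm_cayley_less_1[OF hiso_hspace[OF assms(1) w]]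
      by (simp_all add: power_less_one_iff abs_square_less_1)
    ultimately show ?thesis
      using w hiso_hspace[OF assms(1) w]
      by (simp add: hratio_cayley field_simps)
  qed
  have "1 - (norm (cayley y))\<^sup>2 > 0" "1 - (norm (cayley z))\<^sup>2 > 0"
    using norm_cayley_less_1 assms by (simp_all add: power_less_one_iff abs_square_less_1)
  moreover have "hratio (\<phi> y) (\<phi> z) = hratio y z"
    using assms hiso_hratio by blast
  ultimately have dist_eq: "(dist (cayley (\<phi> y)) (cayley (\<phi> z)))\<^sup>2 = (dist (cayley y) (cayley z))\<^sup>2"
    using assms hiso_hspace[OF assms(1)] norm_eq by (simp add: hratio_cayley)
  have inner_eq: "a \<bullet> b = ((norm a)\<^sup>2 + (norm b)\<^sup>2 - (dist a b)\<^sup>2) / 2" for a b :: "'a hpoint"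
    unfolding dist_norm by (rule dot_norm_neg)
  show ?thesis
    unfolding inner_eq[of "cayley (\<phi> y)" "cayley (\<phi> z)"] inner_eq[of "cayley y" "cayley z"]
      norm_eq[OF assms(3)] norm_eq[OF assms(4)] dist_eq ..
qed

text \<open>Up to scaling, this reflection is the derivative of the inversion \<open>cayley\<close>
  both at \<open>base_point\<close> and at 0, so conjugation by it translates a derivative at
  \<open>base_point\<close> into one at the centre of the ball.\<close>

definition flip :: "'n::finite hpoint \<Rightarrow> 'n hpoint" where
  "flip v = (fst v, - snd v)"

lemma flip_flip [simp]: "flip (flip v) = v"
  by (simp add: flip_def)

lemma flip_inner [simp]: "flip v \<bullet> flip w = v \<bullet> w"
  by (simp add: flip_def inner_prod_def)

lemma flip_scaleR: "flip (c *\<^sub>R v) = c *\<^sub>R flip v"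
  by (simp add: flip_def)

lemma flip_eq: "flip v = v - (2 * snd v) *\<^sub>R base_point"
  by (simp add: flip_def base_point_def prod_eq_iff)

lemma orthogonal_transformation_flip: "orthogonal_transformation flip"
  unfolding orthogonal_transformation_def flip_inner by (auto simp: flip_def intro!: linearI)

lemma cayley_has_derivative:
  assumes "y + base_point \<noteq> 0"
  shows "(cayley has_derivative (\<lambda>v. (2 / (norm (y + base_point))\<^sup>2) *\<^sub>R v -
            (4 * ((y + base_point) \<bullet> v) / (norm (y + base_point)) ^ 4) *\<^sub>R (y + base_point))) (at y)"
proof -
  have eq: "cayley = (\<lambda>y. (2 / ((y + base_point) \<bullet> (y + base_point))) *\<^sub>R (y + base_point) - base_point)"
    by (simp add: cayley_def fun_eq_iff power2_norm_eq_inner)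
  have 4: "norm (y + base_point) ^ 4 = ((y + base_point) \<bullet> (y + base_point))\<^sup>2"
    by (simp add: power2_norm_eq_inner[symmetric])
  show ?thesis
    unfolding eq 4 power2_norm_eq_inner using assms
    by (auto intro!: derivative_eq_intros simp: fun_eq_iff inner_commute power2_eq_square scaleR_diff_left[symmetric] divide_simps)
qed

lemma cayley_has_derivative_base_point: "(cayley has_derivative (\<lambda>v. (1 / 2) *\<^sub>R flip v)) (at base_point)"
proof -
  have "norm (base_point + base_point :: 'a hpoint) = 2"
    by (simp add: base_point_def norm_Pair)
  moreover have "base_point + base_point = (2 :: real) *\<^sub>R (base_point :: 'a hpoint)"
    by (rule scaleR_2[symmetric])
  ultimately show ?thesis
    using cayley_has_derivative[of "base_point :: 'a hpoint"]
    by (simp add: flip_eq scaleR_diff_right)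
qed

lemma cayley_has_derivative_0: "(cayley has_derivative (\<lambda>v. 2 *\<^sub>R flip v)) (at 0)"
  using cayley_has_derivative[of "0 :: 'a hpoint"] norm_base_point[where 'n = 'a]
  by (auto simp: flip_eq scaleR_diff_right simp del: norm_base_point)

text \<open>In the ball model an isometry fixing the centre is linear, here \<open>R\<close>
  conjugated by \<open>flip\<close>; the dilation by \<open>h\<close> then moves
  \<open>base_point\<close> to height \<open>h\<close>. The restriction supplies the extensionality
  in \<open>hisometries\<close>.\<close>

lemma Phi_exists:
  fixes R :: "'n::finite hpoint \<Rightarrow> 'n hpoint"
  assumes h: "0 < h" and R: "orthogonal_transformation R"
  defines "\<phi> \<equiv> restrict (\<lambda>y. h *\<^sub>R cayley (flip (R (flip (cayley y))))) hspace"
  shows "\<phi> \<in> hisometries" "\<phi> base_point = (0, h)"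
    "(\<phi> has_derivative (\<lambda>v. h *\<^sub>R R v)) (at base_point)"
proof -
  define \<psi> where "\<psi> = (\<lambda>(R :: 'n hpoint \<Rightarrow> 'n hpoint) y. cayley (flip (R (flip (cayley y)))))"
  have norm: "norm (flip (R (flip u))) = norm u" if "orthogonal_transformation R" for R u
    by (simp add: orthogonal_transformation_norm[OF that] orthogonal_transformation_norm[OF orthogonal_transformation_flip])
  have hsp: "\<psi> R y \<in> hspace" if "orthogonal_transformation R" "y \<in> hspace" for R y
    unfolding \<psi>_def using that norm_cayley_less_1 by (intro cayley_hspace) (simp add: norm)
  have conj: "orthogonal_transformation (\<lambda>u. flip (R (flip u)))"
    by (rule orthogonal_transformation_compose[unfolded o_def, of flip "\<lambda>u. R (flip u)",
          OF orthogonal_transformation_flip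
             orthogonal_transformation_compose[unfolded o_def, of R flip, OF R orthogonal_transformation_flip]])
  have inv: "orthogonal_transformation (inv_into UNIV R)"
    by (rule orthogonal_transformation_inv[OF R])
  have Rinv: "R (inv_into UNIV R u) = u" "inv_into UNIV R (R u) = u" for u
    using R by (simp_all add: orthogonal_transformation_surj orthogonal_transformation_inj surj_f_inv_f inv_f_f)
  have "bij_betw (\<psi> R) hspace hspace"
    by (rule bij_betw_byWitness[where f' = "\<psi> (inv_into UNIV R)"])
       (auto simp: hsp[OF R] hsp[OF inv] Rinv, auto simp: \<psi>_def Rinv)
  moreover have "hratio (\<psi> R y) (\<psi> R z) = hratio y z" if "y \<in> hspace" "z \<in> hspace" for y z
  proof -
    have "dist (flip (R (flip u))) (flip (R (flip v))) = dist u v" for u v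
      using conj unfolding orthogonal_transformation_isometry by blast
    then show ?thesis
      using that hsp[OF R] by (simp add: hratio_cayley) (simp add: \<psi>_def norm[OF R])
  qed
  ultimately have "hiso (\<psi> R)" by (simp add: hiso_def)
  from hiso_comp[OF hiso_affine[OF h, of 0] this] have "hiso (\<lambda>y. h *\<^sub>R \<psi> R y)"
    by (simp add: zero_prod_def[symmetric])
  then have "hiso \<phi>"
    unfolding hiso_def \<phi>_def \<psi>_def by (auto cong: bij_betw_cong)
  then show "\<phi> \<in> hisometries"
    by (simp add: hisometries_iff \<phi>_def)
  have R0: "R 0 = 0" "flip 0 = 0"
    using linear_0[OF orthogonal_transformation_linear[OF R]] by (simp_all add: flip_def prod_eq_iff)
  then show "\<phi> base_point = (0, h)"
    by (simp add: \<phi>_def R0) (simp add: base_point_def)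
  have bl: "bounded_linear (\<lambda>u. flip (R (flip u)))"
    by (intro linear_conv_bounded_linear[THEN iffD1] orthogonal_transformation_linear conj)
  have "((\<lambda>y. flip (R (flip (cayley y)))) has_derivative (\<lambda>v. flip (R (flip ((1 / 2) *\<^sub>R flip v))))) (at base_point)"
    by (rule bounded_linear.has_derivative[OF bl cayley_has_derivative_base_point])
  then have "((\<lambda>y. cayley (flip (R (flip (cayley y))))) has_derivative
      (\<lambda>v. 2 *\<^sub>R flip (flip (R (flip ((1 / 2) *\<^sub>R flip v)))))) (at base_point)"
    by (rule has_derivative_compose) (simp add: R0 cayley_has_derivative_0)
  then have "((\<lambda>y. h *\<^sub>R cayley (flip (R (flip (cayley y))))) has_derivative
      (\<lambda>v. h *\<^sub>R (2 *\<^sub>R flip (flip (R (flip ((1 / 2) *\<^sub>R flip v))))))) (at base_point)"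
    by (rule has_derivative_scaleR_right)
  moreover have "(\<lambda>v. h *\<^sub>R (2 *\<^sub>R flip (flip (R (flip ((1 / 2) *\<^sub>R flip v)))))) = (\<lambda>v. h *\<^sub>R R v)"
    using R by (simp add: flip_scaleR orthogonal_transformation_scaleR)
  ultimately have "((\<lambda>y. h *\<^sub>R cayley (flip (R (flip (cayley y))))) has_derivative (\<lambda>v. h *\<^sub>R R v)) (at base_point)"
    by simp
  then show "(\<phi> has_derivative (\<lambda>v. h *\<^sub>R R v)) (at base_point)"
  proof (rule has_derivative_transform_within_open)
    show "open (hspace :: 'n hpoint set)"
      unfolding hspace_def by (intro open_Collect_less continuous_intros)
  qed (auto simp: \<phi>_def)
qed

text \<open>
  In the ball model an isometry fixing the origin preserves inner products. Testing it against its
  values near the origin, where it is given by the derivative, identifies it with the derivative.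
\<close>

lemma Phi_unique:
  fixes R :: "'n::finite hpoint \<Rightarrow> 'n hpoint"
  assumes h: "0 < h" and R: "orthogonal_transformation R"
    and \<phi>: "\<phi> \<in> hisometries" "\<phi> base_point = (0, h)"
    "(\<phi> has_derivative (\<lambda>v. h *\<^sub>R R v)) (at base_point)"
  shows "\<phi> = restrict (\<lambda>y. h *\<^sub>R cayley (flip (R (flip (cayley y))))) hspace"
proof -
  define \<xi> where "\<xi> = (\<lambda>y. (1 / h) *\<^sub>R \<phi> y)"
  have iso: "hiso \<xi>"
    using hiso_comp[OF hiso_affine[of "1 / h" 0], of \<phi>] h \<phi>(1)
    by (simp add: \<xi>_def hisometries_iff zero_prod_def[symmetric])
  have fix_o: "\<xi> base_point = base_point"
    using \<phi>(2) h by (simp add: \<xi>_def base_point_def)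
  have "(\<xi> has_derivative (\<lambda>v. (1 / h) *\<^sub>R (h *\<^sub>R R v))) (at base_point)"
    unfolding \<xi>_def by (rule has_derivative_scaleR_right[OF \<phi>(3)])
  then have deriv: "(\<xi> has_derivative R) (at base_point)" using h by simp
  have "((\<lambda>u. \<xi> (cayley u)) has_derivative (\<lambda>v. R (2 *\<^sub>R flip v))) (at 0)"
    by (rule has_derivative_compose[OF cayley_has_derivative_0]) (simp add: deriv)
  then have "((\<lambda>u. cayley (\<xi> (cayley u))) has_derivative (\<lambda>v. (1 / 2) *\<^sub>R flip (R (2 *\<^sub>R flip v)))) (at 0)"
    by (rule has_derivative_compose) (simp add: fix_o cayley_has_derivative_base_point)
  then have D: "((\<lambda>u. cayley (\<xi> (cayley u))) has_derivative (\<lambda>v. flip (R (flip v)))) (at 0)"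
    using R by (simp add: flip_scaleR orthogonal_transformation_scaleR)
  have "cayley (\<xi> y) = flip (R (flip (cayley y)))" if y: "y \<in> hspace" for y
  proof -
    have *: "cayley (\<xi> y) \<bullet> flip (R (flip v)) = cayley y \<bullet> v" for v
    proof -
      have line: "((\<lambda>t::real. t *\<^sub>R v) has_derivative (\<lambda>t. t *\<^sub>R v)) (at 0)"
        by (auto intro!: derivative_eq_intros)
      have "((\<lambda>t. cayley (\<xi> (cayley (t *\<^sub>R v)))) has_derivative (\<lambda>t. flip (R (flip (t *\<^sub>R v))))) (at 0)"
        by (rule has_derivative_compose[OF line]) (simp add: D)
      then have "((\<lambda>t. cayley (\<xi> y) \<bullet> cayley (\<xi> (cayley (t *\<^sub>R v)))) has_derivative
          (\<lambda>t. cayley (\<xi> y) \<bullet> flip (R (flip (t *\<^sub>R v))))) (at 0)"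
        by (rule has_derivative_inner_right)
      moreover have "((\<lambda>t. cayley (\<xi> y) \<bullet> cayley (\<xi> (cayley (t *\<^sub>R v)))) has_derivative
          (\<lambda>t. t * (cayley y \<bullet> v))) (at 0)"
      proof (rule has_derivative_transform_within_open)
        show "((\<lambda>t. t * (cayley y \<bullet> v)) has_derivative (\<lambda>t. t * (cayley y \<bullet> v))) (at 0)"
          by (auto intro!: derivative_eq_intros)
        show "open {t::real. norm (t *\<^sub>R v) < 1}"
          by (intro open_Collect_less continuous_intros)
        show "t * (cayley y \<bullet> v) = cayley (\<xi> y) \<bullet> cayley (\<xi> (cayley (t *\<^sub>R v)))"
          if "t \<in> {t. norm (t *\<^sub>R v) < 1}" for t
        proof -
          have "cayley (t *\<^sub>R v) \<in> hspace" using that by (intro cayley_hspace) simp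
          from cayley_inner_eq[OF iso fix_o y this] show ?thesis by simp
        qed
      qed simp
      ultimately have "(\<lambda>t. cayley (\<xi> y) \<bullet> flip (R (flip (t *\<^sub>R v)))) = (\<lambda>t. t * (cayley y \<bullet> v))"
        by (rule has_derivative_unique)
      from fun_cong[OF this, of 1] show ?thesis by simp
    qed
    have "cayley (\<xi> y) \<bullet> w = flip (R (flip (cayley y))) \<bullet> w" for w
    proof -
      obtain v where v: "w = flip (R (flip v))"
        using orthogonal_transformation_surj[OF R] by (metis flip_flip surjD)
      have "flip (R (flip (cayley y))) \<bullet> flip (R (flip v)) = cayley y \<bullet> v"
        using R unfolding orthogonal_transformation_def flip_inner by (metis flip_inner)
      then show ?thesis using * v by simp
    qed
    then show ?thesis by (metis vector_eq_ldot inner_commute)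
  qed
  then have \<xi>: "\<xi> y = cayley (flip (R (flip (cayley y))))" if "y \<in> hspace" for y
    using that by (metis cayley_cayley)
  have "\<phi> y = h *\<^sub>R cayley (flip (R (flip (cayley y))))" if "y \<in> hspace" for y
  proof -
    have "\<phi> y = h *\<^sub>R \<xi> y" using h by (simp add: \<xi>_def)
    then show ?thesis using \<xi>[OF that] by simp
  qed
  moreover have "\<phi> \<in> extensional hspace"
    using \<phi>(1) by (simp add: hisometries_iff)
  ultimately show ?thesis by (intro extensionalityI[of _ hspace]) auto
qed

text \<open>Justifies the definite description. The later estimates hold for every isometry with
  these two properties and \<open>h \<le> 1\<close>, hence uniformly in \<open>h\<close> and
  \<open>R\<close>.\<close>

lemma Phi:
  assumes "0 < h" "orthogonal_transformation R"
  shows "hiso (Phi h R)" "Phi h R base_point = (0, h)"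
proof -
  have "\<exists>!\<phi>. \<phi> \<in> hisometries \<and> \<phi> base_point = (0, h) \<and> (\<phi> has_derivative (\<lambda>v. h *\<^sub>R R v)) (at base_point)"
    using Phi_exists[OF assms] Phi_unique[OF assms]
    by (intro ex1I[where a = "restrict (\<lambda>y. h *\<^sub>R cayley (flip (R (flip (cayley y))))) hspace"]) blast+
  from theI'[OF this] show "hiso (Phi h R)" "Phi h R base_point = (0, h)"
    unfolding Phi_def hisometries_iff by blast+
qed

text \<open>With \<open>y\<close> at height at most 1, the vertical part of the distance forces
  \<open>z\<close> to height at most c + 2; then the squared Euclidean distance is at most c (c +
  2).\<close>

lemma hratio_bounds_horizontal:
  assumes "y \<in> hspace" "z \<in> hspace" "snd y \<le> 1" "hratio y z \<le> c"
  shows "norm (fst y - fst z) \<le> 2 * (c + 1)"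
proof -
  have pos: "0 < snd y" "0 < snd z" using assms by (auto simp: hspace_def)
  have c: "0 \<le> c" using hratio_nonneg[OF assms(1,2)] assms(4) by simp
  have d: "(dist y z)\<^sup>2 \<le> c * (snd y * snd z)"
    using assms(4) pos by (simp add: hratio_def pos_divide_le_eq)
  have "(snd z - snd y)\<^sup>2 \<le> (dist y z)\<^sup>2"
    by (simp add: dist_norm norm_prod_def power2_commute)
  then have "(snd z)\<^sup>2 \<le> (c + 2) * snd y * snd z"
  proof -
    have "(snd z - snd y)\<^sup>2 = (snd z)\<^sup>2 - 2 * (snd y * snd z) + (snd y)\<^sup>2"
      by (simp add: power2_diff)
    moreover have "(c + 2) * snd y * snd z = c * (snd y * snd z) + 2 * (snd y * snd z)"
      by (simp add: algebra_simps)
    ultimately show ?thesis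
      using d \<open>(snd z - snd y)\<^sup>2 \<le> (dist y z)\<^sup>2\<close> zero_le_power2[of "snd y"] by linarith
  qed
  then have "snd z \<le> (c + 2) * snd y" using pos by (simp add: power2_eq_square)
  also have "\<dots> \<le> c + 2" using c assms(3) pos by (simp add: mult_left_le)
  finally have z: "snd z \<le> c + 2" .
  have "(norm (fst y - fst z))\<^sup>2 \<le> (dist y z)\<^sup>2"
    by (simp add: dist_norm norm_prod_def)
  also have "\<dots> \<le> c * (1 * (c + 2))"
    using d by (rule order_trans) (use c z pos assms(3) in \<open>intro mult_left_mono mult_mono\<close>, auto)
  also have "\<dots> \<le> (2 * (c + 1))\<^sup>2"
    using c by (simp add: power2_eq_square algebra_simps)
  finally show ?thesis
    using c by (simp add: abs_le_square_iff[symmetric])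
qed

section \<open>Points at infinity and percolation events\<close>

text \<open>Identifies the unit sphere, the boundary of the ball model, with the points at infinity.
  The pole - \<open>base_point\<close> has its own clause because \<open>cayley\<close> fixes
  it.\<close>

definition ideal_point :: "'n::finite hpoint \<Rightarrow> 'n hpoint option" where
  "ideal_point \<xi> = (if \<xi> = - base_point then None else Some (cayley \<xi>))"

lemma snd_cayley_sphere:
  assumes "norm \<xi> = 1" "\<xi> \<noteq> - base_point"
  shows "snd (cayley \<xi>) = 0"
proof -
  have "\<xi> + base_point \<noteq> 0"
    using assms(2) by (simp add: add_eq_0_iff2)
  then have 1: "cayley \<xi> + base_point \<noteq> 0"
    using norm_cayley_add[of \<xi>] by auto
  from norm_cayley[OF 1] assms(1) 1 show ?thesis by simp
qed

lemma isCont_cayley: "y + base_point \<noteq> 0 \<Longrightarrow> isCont cayley y"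
  using cayley_has_derivative has_derivative_continuous by blast

text \<open>Closure in the one-point compactification becomes Euclidean approach in the closed ball:
  \<open>cayley\<close> is continuous at the finite boundary points, and leaving every compact set
  means approaching the pole. Countably many radii make the event a countable intersection.\<close>

lemma ideal_point_boundary_iff:
  fixes C :: "'n::finite hpoint set"
  assumes C: "C \<subseteq> hspace" and \<xi>: "norm \<xi> = 1"
  shows "ideal_point \<xi> \<in> boundary_at_infinity C \<longleftrightarrow>
           (\<forall>m. \<exists>y\<in>C. norm (cayley y - \<xi>) \<le> inverse (real (Suc m)))"
proof -
  define X :: "'n hpoint set" where "X = {y. 0 \<le> snd y}"
  have CX: "C \<subseteq> X" using C by (auto simp: X_def hspace_def)
  have X0: "y + base_point \<noteq> 0" if "y \<in> X" for y
    using that by (auto simp: X_def prod_eq_iff)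
  have top: "hcompactification = Alexandroff_compactification (top_of_set X)"
    by (simp add: hcompactification_def X_def)
  have "closed X" unfolding X_def by (intro closed_Collect_le continuous_intros)
  show ?thesis
  proof (cases "\<xi> = - base_point")
    case True
    have cn: "norm (cayley y - \<xi>) = 2 / norm (y + base_point)" for y
      using norm_cayley_add[of y] True by simp
    have "ideal_point \<xi> \<in> boundary_at_infinity C \<longleftrightarrow>
        (\<forall>T. None \<in> T \<and> openin hcompactification T \<longrightarrow> (\<exists>y\<in>C. Some y \<in> T))"
      using True by (auto simp: ideal_point_def boundary_at_infinity_def points_at_infinity_def in_closure_of top)
    also have "\<dots> \<longleftrightarrow> (\<forall>m. \<exists>y\<in>C. norm (cayley y - \<xi>) \<le> inverse (real (Suc m)))"
    proof (intro iffI allI impI)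
      fix m assume L: "\<forall>T. None \<in> T \<and> openin hcompactification T \<longrightarrow> (\<exists>y\<in>C. Some y \<in> T)"
      \<comment> \<open>By \<open>cn\<close>, leaving this ball is the same as coming closer to the
        pole than 1 / (m + 1).\<close>
      let ?K = "X \<inter> cball (- base_point) (2 * real (Suc m))"
      have "compact ?K" using \<open>closed X\<close> by (simp add: closed_Int_compact)
      then have "compactin (top_of_set X) ?K" "closedin (top_of_set X) ?K"
        by (auto simp: compactin_subtopology compactin_euclidean_iff intro: closedin_closed_Int)
      then have "openin hcompactification (insert None (Some ` (X - ?K)))"
        unfolding top openin_Alexandroff_compactification by auto
      with L obtain y where y: "y \<in> C" "y \<in> X - ?K" by blast
      then have "2 * real (Suc m) < norm (y + base_point)"
        by (auto simp: dist_norm norm_minus_commute add.commute)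
      moreover have "0 < 2 * real (Suc m)" by simp
      ultimately have "2 / norm (y + base_point) \<le> 2 / (2 * real (Suc m))"
        by (intro divide_left_mono mult_pos_pos) linarith+
      also have "\<dots> = inverse (real (Suc m))"
        by (simp add: inverse_eq_divide del: of_nat_Suc)
      finally have "norm (cayley y - \<xi>) \<le> inverse (real (Suc m))" by (simp add: cn)
      then show "\<exists>y\<in>C. norm (cayley y - \<xi>) \<le> inverse (real (Suc m))"
        using y by blast
    next
      fix T :: "'n hpoint option set"
      assume R: "\<forall>m. \<exists>y\<in>C. norm (cayley y - \<xi>) \<le> inverse (real (Suc m))"
        and T: "None \<in> T \<and> openin hcompactification T"
      then obtain K where K: "compactin (top_of_set X) K" "T = insert None (Some ` (X - K))"
        unfolding top openin_Alexandroff_compactification by auto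
      then have "compact K" by (simp add: compactin_subtopology compactin_euclidean_iff)
      then obtain b where b: "\<And>y. y \<in> K \<Longrightarrow> norm y \<le> b"
        using compact_imp_bounded bounded_iff by metis
      obtain m where m: "b + 1 < real m" using reals_Archimedean2 by blast
      obtain y where y: "y \<in> C" "norm (cayley y - \<xi>) \<le> inverse (real (Suc m))" using R by blast
      have "0 < norm (y + base_point)" using X0[OF subsetD[OF CX y(1)]] by simp
      then have "2 * real (Suc m) \<le> norm (y + base_point)"
        using y(2) by (simp add: cn field_simps)
      also have "\<dots> \<le> norm y + 1" using norm_triangle_ineq[of y base_point] by simp
      finally have "y \<notin> K" using m b[of y] by auto
      then show "\<exists>y\<in>C. Some y \<in> T" using K y(1) CX by blast
    qed
    finally show ?thesis .
  next
    case False
    define x where "x = cayley \<xi>"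
    have \<xi>0: "\<xi> + base_point \<noteq> 0"
      using False by (simp add: add_eq_0_iff2)
    have x: "snd x = 0" "cayley x = \<xi>"
      using snd_cayley_sphere[OF \<xi> False] by (simp_all add: x_def)
    have xX: "x \<in> X" using x by (simp add: X_def)
    have "ideal_point \<xi> \<in> boundary_at_infinity C \<longleftrightarrow>
        (\<forall>T. Some x \<in> T \<and> openin hcompactification T \<longrightarrow> (\<exists>y\<in>C. Some y \<in> T))"
      using False x xX
      by (auto simp: ideal_point_def boundary_at_infinity_def points_at_infinity_def in_closure_of top x_def[symmetric])
    also have "\<dots> \<longleftrightarrow> (\<forall>m. \<exists>y\<in>C. norm (cayley y - \<xi>) \<le> inverse (real (Suc m)))"
    proof (intro iffI allI impI)
      fix m assume L: "\<forall>T. Some x \<in> T \<and> openin hcompactification T \<longrightarrow> (\<exists>y\<in>C. Some y \<in> T)"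
      have "continuous_on X cayley"
        using X0 isCont_cayley by (intro continuous_at_imp_continuous_on) auto
      then have "openin (top_of_set X) (X \<inter> cayley -` ball \<xi> (inverse (real (Suc m))))"
        by (intro continuous_openin_preimage_gen) auto
      then have op: "openin hcompactification (Some ` (X \<inter> cayley -` ball \<xi> (inverse (real (Suc m)))))"
        by (simp add: top)
      have mem: "Some x \<in> Some ` (X \<inter> cayley -` ball \<xi> (inverse (real (Suc m))))"
        using xX x by auto
      from L[rule_format, OF conjI[OF mem op]]
      obtain y where "y \<in> C" "cayley y \<in> ball \<xi> (inverse (real (Suc m)))"
        by blast
      then show "\<exists>y\<in>C. norm (cayley y - \<xi>) \<le> inverse (real (Suc m))"
        by (intro bexI[of _ y]) (auto simp: dist_norm norm_minus_commute)
    next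
      fix T assume R: "\<forall>m. \<exists>y\<in>C. norm (cayley y - \<xi>) \<le> inverse (real (Suc m))"
        and T: "Some x \<in> T \<and> openin hcompactification T"
      have "continuous_map (top_of_set X) hcompactification Some"
        unfolding top by (rule continuous_map_Some)
      then have "openin (top_of_set X) {y \<in> X. Some y \<in> T}"
        using T openin_continuous_map_preimage by fastforce
      then obtain W where W: "open W" "{y \<in> X. Some y \<in> T} = X \<inter> W"
        by (auto simp: openin_open)
      then have "x \<in> W" using T xX by auto
      then obtain \<epsilon> where \<epsilon>: "0 < \<epsilon>" "ball x \<epsilon> \<subseteq> W"
        using W(1) open_contains_ball by blast
      obtain \<delta> where \<delta>: "0 < \<delta>" "\<And>u. dist u \<xi> < \<delta> \<Longrightarrow> dist (cayley u) (cayley \<xi>) < \<epsilon>"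
        using isCont_cayley[OF \<xi>0] \<epsilon>(1) unfolding continuous_at_eps_delta by (metis dist_commute)
      obtain m where m: "inverse (real (Suc m)) < \<delta>" using reals_Archimedean \<delta>(1) by blast
      obtain y where y: "y \<in> C" "norm (cayley y - \<xi>) \<le> inverse (real (Suc m))" using R by blast
      have "dist (cayley (cayley y)) (cayley \<xi>) < \<epsilon>"
        using y(2) m by (intro \<delta>) (simp add: dist_norm)
      then have "y \<in> W" using \<epsilon>(2) by (auto simp: x_def dist_commute)
      then show "\<exists>y\<in>C. Some y \<in> T" using W y(1) CX by blast
    qed
    finally show ?thesis .
  qed
qed

lemma ideal_point_at_infinity: "norm \<xi> = 1 \<Longrightarrow> ideal_point \<xi> \<in> points_at_infinity"
  by (auto simp: ideal_point_def points_at_infinity_def snd_cayley_sphere)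

section \<open>The percolation measure and connection events\<close>

lemma space_percolation: "space (percolation E p) = PiE E (\<lambda>_. UNIV)"
  by (simp add: percolation_def space_PiM)

lemma prob_space_percolation: "prob_space (percolation E p)"
  unfolding percolation_def by (intro prob_space_PiM) (simp add: measure_pmf.prob_space_axioms)

lemma edge_open_measurable: "e \<in> E \<Longrightarrow> {\<omega> \<in> space (percolation E p). \<omega> e} \<in> sets (percolation E p)"
proof -
  assume "e \<in> E"
  then have "(\<lambda>\<omega>. \<omega> e) \<in> measurable (percolation E p) (measure_pmf (bernoulli_pmf p))"
    unfolding percolation_def by (rule measurable_component_singleton)
  from measurable_sets[OF this, of "{True}"]
  have "(\<lambda>\<omega>. \<omega> e) -` {True} \<inter> space (percolation E p) \<in> sets (percolation E p)" by simp
  moreover have "(\<lambda>\<omega>. \<omega> e) -` {True} \<inter> space (percolation E p) = {\<omega> \<in> space (percolation E p). \<omega> e}"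
    by auto
  ultimately show ?thesis by simp
qed

text \<open>The link from \<open>bexp\<close> to the product measure: the traces on \<open>F\<close>
  split the event into finitely many cylinders, whose measures are the weights in
  \<open>bexp\<close>.\<close>

lemma percolation_finite:
  assumes F: "finite F" "F \<subseteq> E" and p: "0 \<le> p" "p \<le> 1"
  shows "{\<omega> \<in> space (percolation E p). Q {e \<in> F. \<omega> e}} \<in> sets (percolation E p)"
    and "\<P>(\<omega> in percolation E p. Q {e \<in> F. \<omega> e}) = bexp p F (\<lambda>\<eta>. of_bool (Q \<eta>))"
proof -
  interpret product_prob_space "\<lambda>_. measure_pmf (bernoulli_pmf p)" E
    by unfold_locales
  let ?M = "percolation E p"
  let ?N = "\<lambda>_. measure_pmf (bernoulli_pmf p)"
  let ?A = "\<lambda>\<eta>. {\<omega> \<in> space ?M. {e \<in> F. \<omega> e} = \<eta>}"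
  have A: "?A \<eta> = prod_emb E ?N F (PiE F (\<lambda>e. {e \<in> \<eta>}))" if "\<eta> \<subseteq> F" for \<eta>
    using that F by (auto simp: prod_emb_def space_percolation PiE_iff restrict_def extensional_def)
  have sets: "?A \<eta> \<in> sets ?M" if "\<eta> \<subseteq> F" for \<eta>
    unfolding A[OF that] unfolding percolation_def using F by (intro sets_PiM_I) auto
  have meas: "measure ?M (?A \<eta>) = (\<Prod>e\<in>F. if e \<in> \<eta> then p else 1 - p)" if "\<eta> \<subseteq> F" for \<eta>
  proof -
    have "measure ?M (?A \<eta>) = (\<Prod>e\<in>F. measure (measure_pmf (bernoulli_pmf p)) {e \<in> \<eta>})"
      unfolding A[OF that] unfolding percolation_def using F by (intro measure_PiM_emb) auto
    also have "\<dots> = (\<Prod>e\<in>F. if e \<in> \<eta> then p else 1 - p)"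
      using p by (intro prod.cong) (auto simp: measure_pmf_single)
    finally show ?thesis .
  qed
  have un: "{\<omega> \<in> space ?M. Q {e \<in> F. \<omega> e}} = (\<Union>\<eta>\<in>{\<eta> \<in> Pow F. Q \<eta>}. ?A \<eta>)"
    by auto
  have fin: "finite {\<eta> \<in> Pow F. Q \<eta>}" using F by simp
  show "{\<omega> \<in> space ?M. Q {e \<in> F. \<omega> e}} \<in> sets ?M"
    unfolding un using fin sets by (intro sets.finite_UN) auto
  have "measure ?M (\<Union>\<eta>\<in>{\<eta> \<in> Pow F. Q \<eta>}. ?A \<eta>) = (\<Sum>\<eta>\<in>{\<eta> \<in> Pow F. Q \<eta>}. measure ?M (?A \<eta>))"
    using prob_space_percolation fin sets
    by (intro finite_measure.finite_measure_finite_Union prob_space.finite_measure)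
       (auto simp: disjoint_family_on_def)
  also have "\<dots> = (\<Sum>\<eta>\<in>{\<eta> \<in> Pow F. Q \<eta>}. \<Prod>e\<in>F. if e \<in> \<eta> then p else 1 - p)"
    by (intro sum.cong refl meas) auto
  also have "\<dots> = bexp p F (\<lambda>\<eta>. of_bool (Q \<eta>))"
    unfolding bexp_def using F by (intro sum.mono_neutral_cong_left) auto
  finally show "\<P>(\<omega> in percolation E p. Q {e \<in> F. \<omega> e}) = bexp p F (\<lambda>\<eta>. of_bool (Q \<eta>))"
    unfolding un .
qed

lemma graph_path_open_edges:
  "graph_path V (open_edges E \<omega>) vs es \<longleftrightarrow> graph_path V E vs es \<and> (\<forall>e\<in>set es. \<omega> e)"
  by (auto simp: graph_path_def open_edges_def)

text \<open>A path is a pair of finite lists over countable sets, so the event is a countable union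
  of events on finitely many edges.\<close>

lemma connects_measurable:
  assumes "countable V" "countable E"
  shows "{\<omega> \<in> space (percolation E p). connects V (open_edges E \<omega>) A B} \<in> sets (percolation E p)"
proof -
  let ?M = "percolation E p"
  let ?meets = "\<lambda>vs es. (set vs \<union> \<Union>(set es)) \<inter> A \<noteq> {} \<and> (set vs \<union> \<Union>(set es)) \<inter> B \<noteq> {}"
  define P where "P = {(vs, es). graph_path V E vs es \<and> ?meets vs es}"
  have "P \<subseteq> lists V \<times> lists E"
    by (auto simp: P_def graph_path_def in_lists_conv_set)
  then have "countable P"
    using assms by (meson countable_SIGMA countable_lists countable_subset)
  moreover have "{\<omega> \<in> space ?M. \<forall>e\<in>set es. \<omega> e} \<in> sets ?M" if "(vs, es) \<in> P" for vs es
    using that by (intro sets.sets_Collect_finite_All edge_open_measurable)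
      (auto simp: P_def graph_path_def)
  ultimately have "(\<Union>(vs, es)\<in>P. {\<omega> \<in> space ?M. \<forall>e\<in>set es. \<omega> e}) \<in> sets ?M"
    by (intro sets.countable_UN') auto
  moreover have "(\<Union>(vs, es)\<in>P. {\<omega> \<in> space ?M. \<forall>e\<in>set es. \<omega> e}) =
      {\<omega> \<in> space ?M. connects V (open_edges E \<omega>) A B}"
    unfolding P_def connects_def graph_path_open_edges by blast
  ultimately show ?thesis by simp
qed

text \<open>A connection uses finitely many edges, so along an exhaustion of \<open>H\<close> by
  finite sets the events increase to the one in question; a bound that does not depend on the finite
  set survives.\<close>

lemma percolation_limit:
  assumes H: "countable H" "H \<subseteq> E" and p: "0 \<le> p" "p \<le> 1"
    and bound: "\<And>F. finite F \<Longrightarrow> F \<subseteq> H \<Longrightarrow> bexp p F (\<lambda>\<eta>. of_bool (reaches inc \<eta> v T)) \<le> b"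
  shows "{\<omega> \<in> space (percolation E p). reaches inc {e \<in> H. \<omega> e} v T} \<in> sets (percolation E p)"
    and "\<P>(\<omega> in percolation E p. reaches inc {e \<in> H. \<omega> e} v T) \<le> b"
proof -
  interpret prob_space "percolation E p" by (rule prob_space_percolation)
  let ?M = "percolation E p"
  define Fn where "Fn n = {e \<in> H. to_nat_on H e \<le> n}" for n
  have fin: "finite (Fn n)" for n
  proof -
    have "inj_on (to_nat_on H) (Fn n)"
      using inj_on_to_nat_on[OF H(1)] by (rule inj_on_subset) (auto simp: Fn_def)
    moreover have "to_nat_on H ` Fn n \<subseteq> {..n}" by (auto simp: Fn_def)
    ultimately show ?thesis using finite_atMost inj_on_finite by blast
  qed
  define A where "A n = {\<omega> \<in> space ?M. reaches inc {e \<in> Fn n. \<omega> e} v T}" for n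
  have sub: "Fn n \<subseteq> H" "Fn n \<subseteq> E" for n using H by (auto simp: Fn_def)
  have A_sets: "A n \<in> sets ?M" for n
    unfolding A_def by (rule percolation_finite(1)[OF fin sub(2) p])
  have A_prob: "measure ?M (A n) \<le> b" for n
    unfolding A_def percolation_finite(2)[OF fin sub(2) p, where Q = "\<lambda>\<eta>. reaches inc \<eta> v T"] by (rule bound[OF fin sub(1)])
  have un: "{\<omega> \<in> space ?M. reaches inc {e \<in> H. \<omega> e} v T} = (\<Union>n. A n)"
  proof (intro equalityI subsetI)
    fix \<omega> assume "\<omega> \<in> {\<omega> \<in> space ?M. reaches inc {e \<in> H. \<omega> e} v T}"
    then obtain t where \<omega>: "\<omega> \<in> space ?M" and t: "t \<in> T" "conn inc {e \<in> H. \<omega> e} v t" by blast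
    from conn_finite[OF t(2)] obtain \<eta> where \<eta>: "finite \<eta>" "\<eta> \<subseteq> {e \<in> H. \<omega> e}" "conn inc \<eta> v t" by blast
    have "\<eta> \<subseteq> {e \<in> Fn (Max (to_nat_on H ` \<eta>)). \<omega> e}"
      using \<eta> by (auto simp: Fn_def)
    then have "conn inc {e \<in> Fn (Max (to_nat_on H ` \<eta>)). \<omega> e} v t"
      using \<eta>(3) conn_mono by metis
    then show "\<omega> \<in> (\<Union>n. A n)" using \<omega> t by (auto simp: A_def)
  next
    fix \<omega> assume "\<omega> \<in> (\<Union>n. A n)"
    then obtain n where n: "\<omega> \<in> space ?M" "reaches inc {e \<in> Fn n. \<omega> e} v T" by (auto simp: A_def)
    have "{e \<in> Fn n. \<omega> e} \<subseteq> {e \<in> H. \<omega> e}" using sub by blast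
    from reaches_mono[OF n(2) this] n(1)
    show "\<omega> \<in> {\<omega> \<in> space ?M. reaches inc {e \<in> H. \<omega> e} v T}" by blast
  qed
  show "{\<omega> \<in> space ?M. reaches inc {e \<in> H. \<omega> e} v T} \<in> sets ?M"
    unfolding un using A_sets by blast
  have "incseq A"
  proof (rule incseq_SucI)
    fix n
    have "{e \<in> Fn n. \<omega> e} \<subseteq> {e \<in> Fn (Suc n). \<omega> e}" for \<omega> by (auto simp: Fn_def)
    then show "A n \<le> A (Suc n)"
      unfolding A_def using reaches_mono[of T inc _ v] by blast
  qed
  then have "(\<lambda>n. measure ?M (A n)) \<longlonglongrightarrow> measure ?M (\<Union>n. A n)"
    using A_sets by (intro finite_Lim_measure_incseq) auto
  then show "\<P>(\<omega> in percolation E p. reaches inc {e \<in> H. \<omega> e} v T) \<le> b"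
    unfolding un using A_prob by (intro LIMSEQ_le_const2) auto
qed

text \<open>\<open>graph_path\<close> forbids repeated vertices whereas \<open>conn\<close> does
  not: when the next vertex has occurred already, the path is cut back to that occurrence.\<close>

lemma connects_conn:
  assumes "conn (\<lambda>e. e \<inter> V) \<eta> v t" "v \<in> V" "\<eta> \<subseteq> E"
  shows "connects V E {v} {t}"
proof -
  have "\<exists>vs es. graph_path V E vs es \<and> hd vs = v \<and> last vs = t"
    using assms(1)
  proof (induction rule: conn_induct)
    case refl
    have "graph_path V E [v] []" using assms(2) by (simp add: graph_path_def)
    then show ?case by (intro exI[of _ "[v]"] exI[of _ "[]"]) simp
  next
    case (step y z e)
    then obtain vs es where path: "graph_path V E vs es" "hd vs = v" "last vs = y" by blast
    have e: "e \<in> E" "y \<in> e" "z \<in> e" "z \<in> V" using step assms(3) by auto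
    have len: "length vs = Suc (length es)" using path(1) by (simp add: graph_path_def)
    show ?case
    proof (cases "z \<in> set vs")
      case True
      then obtain i where i: "i < length vs" "vs ! i = z" by (auto simp: in_set_conv_nth)
      have "graph_path V E (take (Suc i) vs) (take i es)"
        using path(1) i len unfolding graph_path_def
        by (auto dest: in_set_takeD)
      moreover have "last (take (Suc i) vs) = z"
        using i by (simp add: take_Suc_conv_app_nth)
      moreover have "hd (take (Suc i) vs) = v" using path(2) by simp
      ultimately show ?thesis by blast
    next
      case False
      have "vs \<noteq> []" using len by auto
      have "graph_path V E (vs @ [z]) (es @ [e])"
        unfolding graph_path_def
      proof (intro conjI allI impI)
        fix i assume i: "i < length (es @ [e])"
        have "vs ! length es = y" using path(3) len by (simp add: last_conv_nth \<open>vs \<noteq> []\<close>)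
        with i path(1) len e show "(vs @ [z]) ! i \<in> (es @ [e]) ! i" "(vs @ [z]) ! Suc i \<in> (es @ [e]) ! i"
          by (auto simp: nth_append graph_path_def less_Suc_eq)
      qed (use path(1) False e in \<open>auto simp: graph_path_def\<close>)
      then show ?thesis using path(2) \<open>vs \<noteq> []\<close>
        by (intro exI[of _ "vs @ [z]"] exI[of _ "es @ [e]"]) simp
    qed
  qed
  then obtain vs es where path: "graph_path V E vs es" "hd vs = v" "last vs = t" by blast
  then have "vs \<noteq> []" by (auto simp: graph_path_def)
  then have "v \<in> set vs" "t \<in> set vs" using path by auto
  then show ?thesis unfolding connects_def using path(1) by blast
qed

section \<open>No escape towards the point at infinity\<close>

lemma cayley_norm_diff_eq:
  assumes "hiso \<phi>" "\<phi> base_point = base_point" "y \<in> hspace" "z \<in> hspace"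
  shows "norm (cayley (\<phi> y) - cayley (\<phi> z)) = norm (cayley y - cayley z)"
proof -
  have "(norm (cayley (\<phi> y) - cayley (\<phi> z)))\<^sup>2 = (norm (cayley y - cayley z))\<^sup>2"
    unfolding power2_norm_eq_inner inner_diff_left inner_diff_right
    by (simp only: cayley_inner_eq[OF assms(1,2)] assms(3,4))
  then show ?thesis by simp
qed

text \<open>
  The point \<open>\<xi>\<close> approximates the point of the sphere that \<open>\<phi>\<close> sends to \<open>None\<close>; an approximation suffices and
  spares the extension of \<open>\<phi>\<close> to the sphere.
\<close>

lemma far_points_near_ideal_point:
  fixes \<phi> :: "'n::finite hpoint \<Rightarrow> 'n hpoint"
  assumes \<phi>: "hiso \<phi>" "snd (\<phi> base_point) \<le> 1" and M: "2 \<le> M"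
  shows "\<exists>\<xi>. norm \<xi> = 1 \<and>
    (\<forall>t\<in>hspace. M \<le> norm (fst (\<phi> t) - fst (\<phi> base_point)) \<longrightarrow> norm (cayley t - \<xi>) \<le> 4 / M)"
proof -
  define a where "a = snd (\<phi> base_point)"
  have a: "0 < a" "a \<le> 1"
    using \<phi> hiso_hspace[OF \<phi>(1) base_point_hspace] by (auto simp: a_def hspace_def)
  \<comment> \<open>Translation and dilation bring the image of \<open>base_point\<close> back to
    \<open>base_point\<close>. Since a is at most 1, the dilation does not shorten horizontal
    distances.\<close>
  define \<phi>1 where "\<phi>1 = (\<lambda>y. (1 / a) *\<^sub>R (\<phi> y - (fst (\<phi> base_point), 0)))"
  have iso: "hiso \<phi>1"
    unfolding \<phi>1_def using hiso_comp[OF hiso_affine \<phi>(1)] a by simp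
  have fix_o: "\<phi>1 base_point = base_point"
    using a by (simp add: \<phi>1_def prod_eq_iff) (simp add: a_def)
  \<comment> \<open>The point w, of norm s, lies at distance 1/M from the pole. The final 4/M
    consists of 2/M from the image of t to the pole, 1/M from the pole to w, and 1/M for the radial
    projection of \<open>cayley z\<close> to the sphere.\<close>
  define s where "s = 1 - 1 / M"
  have s: "0 < s" "s < 1" "1 - s = 1 / M" using M by (auto simp: s_def)
  define w :: "'n hpoint" where "w = - s *\<^sub>R base_point"
  have "norm w = s" using s by (simp add: w_def)
  then have "cayley w \<in> hspace" using s by (intro cayley_hspace) simp
  then have "cayley w \<in> \<phi>1 ` hspace"
    using iso by (simp add: hiso_def bij_betw_def)
  then obtain z where z: "z \<in> hspace" "\<phi>1 z = cayley w"
    by (metis imageE)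
  have "norm (cayley z) = s"
    using cayley_norm_diff_eq[OF iso fix_o z(1) base_point_hspace] fix_o z(2) \<open>norm w = s\<close> by simp
  define \<xi> where "\<xi> = (1 / s) *\<^sub>R cayley z"
  have "norm \<xi> = 1" using s \<open>norm (cayley z) = s\<close> by (simp add: \<xi>_def)
  moreover have "norm (cayley t - \<xi>) \<le> 4 / M"
    if t: "t \<in> hspace" "M \<le> norm (fst (\<phi> t) - fst (\<phi> base_point))" for t
  proof -
    have "norm (cayley z - \<xi>) = 1 / M"
    proof -
      have "cayley z - \<xi> = (s - 1) *\<^sub>R \<xi>" using s by (simp add: \<xi>_def scaleR_diff_left diff_divide_distrib)
      then show ?thesis using s M \<open>norm \<xi> = 1\<close> by simp
    qed
    moreover have "norm (cayley t - cayley z) \<le> 3 / M"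
    proof -
      have "norm (cayley t - cayley z) = norm (cayley (\<phi>1 t) - w)"
        using cayley_norm_diff_eq[OF iso fix_o t(1) z(1)] z(2) by simp
      also have "cayley (\<phi>1 t) - w = (cayley (\<phi>1 t) + base_point) - (1 - s) *\<^sub>R base_point"
        by (simp add: w_def algebra_simps)
      also have "norm \<dots> \<le> norm (cayley (\<phi>1 t) + base_point) + norm ((1 - s) *\<^sub>R (base_point :: 'n hpoint))"
        by (rule norm_triangle_ineq4)
      also have "\<dots> = 2 / norm (\<phi>1 t + base_point) + 1 / M"
        using s M by (simp add: norm_cayley_add)
      also have "2 / norm (\<phi>1 t + base_point) \<le> 2 / M"
      proof -
        have "M \<le> norm (fst (\<phi> t) - fst (\<phi> base_point)) / a"
          using t(2) a M by (simp add: pos_le_divide_eq) (smt (verit) mult_left_le)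
        also have "\<dots> = norm (fst (\<phi>1 t + base_point))"
          using a by (simp add: \<phi>1_def)
        also have "\<dots> \<le> norm (\<phi>1 t + base_point)"
          using norm_fst_le[of "fst (\<phi>1 t + base_point)" "snd (\<phi>1 t + base_point)"] unfolding prod.collapse .
        finally show ?thesis using M by (intro divide_left_mono mult_pos_pos) auto
      qed
      finally show ?thesis by simp
    qed
    ultimately have "norm (cayley t - \<xi>) \<le> 3 / M + 1 / M"
      using norm_triangle_ineq[of "cayley t - cayley z" "cayley z - \<xi>"] by simp
    then show ?thesis by simp
  qed
  ultimately show ?thesis by blast
qed

text \<open>The graph and its percolation stay fixed while the placement \<phi> varies: all points
  placed far away lie close, in the ball model, to one point of the sphere depending on \<phi>. So
  it suffices to bound, uniformly over the sphere, the probability that the cluster comes near a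
  given point.\<close>

lemma uniform_no_escape:
  fixes V :: "'n::finite hpoint set"
  assumes V: "V \<subseteq> hspace" "countable V" and E: "\<forall>e\<in>E. e \<subseteq> hspace" "countable E"
    and p: "p \<in> null_boundary_params V E" and c: "0 < c"
  shows "\<exists>M. \<forall>\<phi>. hiso \<phi> \<and> snd (\<phi> base_point) \<le> 1 \<longrightarrow>
    \<P>(\<omega> in percolation E p. connects V (open_edges E \<omega>) {base_point}
         {t \<in> hspace. M \<le> norm (fst (\<phi> t) - fst (\<phi> base_point))}) < c"
proof -
  interpret prob_space "percolation E p" by (rule prob_space_percolation)
  let ?M = "percolation E p"
  define D where "D \<xi> \<delta> = {\<omega> \<in> space ?M. connects V (open_edges E \<omega>) {base_point}
     {t \<in> hspace. norm (cayley t - \<xi>) \<le> \<delta>}}" for \<xi> \<delta>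
  have D_sets: "D \<xi> \<delta> \<in> sets ?M" for \<xi> \<delta>
    unfolding D_def using V E by (intro connects_measurable)
  have connects_mono: "connects V E' A B'" if "connects V E' A B" "B \<subseteq> B'" for E' A B B'
    using that unfolding connects_def by blast
  have D_mono: "D \<xi> \<delta> \<subseteq> D \<xi>' \<delta>'" if "norm (\<xi> - \<xi>') + \<delta> \<le> \<delta>'" for \<xi> \<xi>' \<delta> \<delta>'
  proof -
    have "norm (t - \<xi>') \<le> \<delta>'" if "norm (t - \<xi>) \<le> \<delta>" for t
      using norm_triangle_ineq[of "t - \<xi>" "\<xi> - \<xi>'"] that \<open>norm (\<xi> - \<xi>') + \<delta> \<le> \<delta>'\<close> by simp
    then show ?thesis unfolding D_def using connects_mono by (smt (verit) Collect_mono mem_Collect_eq)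
  qed
  \<comment> \<open>The events for shrinking radii decrease to the event that the ideal point lies
    in the closure of the cluster, which is null by the choice of p. The factor 2 leaves room for
    moving the centre by up to \<delta>.\<close>
  have local_bound: "\<exists>\<delta>>0. measure ?M (D \<xi> (2 * \<delta>)) < c" if \<xi>: "norm \<xi> = 1" for \<xi>
  proof -
    let ?D = "\<lambda>m. D \<xi> (inverse (real (Suc m)))"
    have "{\<omega> \<in> space ?M. ideal_point \<xi> \<in> boundary_at_infinity (cluster V E \<omega> base_point)} = (\<Inter>m. ?D m)"
    proof -
      have "ideal_point \<xi> \<in> boundary_at_infinity (cluster V E \<omega> base_point) \<longleftrightarrow>
         (\<forall>m. connects V (open_edges E \<omega>) {base_point} {t \<in> hspace. norm (cayley t - \<xi>) \<le> inverse (real (Suc m))})" for \<omega>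
      proof -
        have sub: "cluster V E \<omega> base_point \<subseteq> hspace"
          using V(1) E(1) unfolding cluster_def connects_def graph_path_def open_edges_def by blast
        have pointwise: "connects V E' A B \<longleftrightarrow> (\<exists>t\<in>B. connects V E' A {t})" for E' A B
          unfolding connects_def by blast
        have "(\<exists>y\<in>cluster V E \<omega> base_point. norm (cayley y - \<xi>) \<le> \<delta>) \<longleftrightarrow>
           connects V (open_edges E \<omega>) {base_point} {t \<in> hspace. norm (cayley t - \<xi>) \<le> \<delta>}" for \<delta>
          using sub unfolding cluster_def pointwise[of "open_edges E \<omega>" "{base_point}" "{t \<in> hspace. norm (cayley t - \<xi>) \<le> \<delta>}"]
          by blast
        then show ?thesis unfolding ideal_point_boundary_iff[OF sub \<xi>] by simp
      qed
      then show ?thesis by (auto simp: D_def)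
    qed
    moreover have "\<P>(\<omega> in ?M. ideal_point \<xi> \<in> boundary_at_infinity (cluster V E \<omega> base_point)) = 0"
      using p ideal_point_at_infinity[OF \<xi>] by (simp add: null_boundary_params_def)
    ultimately have "measure ?M (\<Inter>m. ?D m) = 0" by simp
    moreover have "(\<lambda>m. measure ?M (?D m)) \<longlonglongrightarrow> measure ?M (\<Inter>m. ?D m)"
    proof (rule finite_Lim_measure_decseq)
      show "decseq ?D"
      proof (intro decseq_SucI D_mono)
        fix m
        have "inverse (real (Suc (Suc m))) \<le> inverse (real (Suc m))"
          by (rule le_imp_inverse_le) auto
        then show "norm (\<xi> - \<xi>) + inverse (real (Suc (Suc m))) \<le> inverse (real (Suc m))" by simp
      qed
      show "range ?D \<subseteq> sets ?M" using D_sets by blast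
    qed
    ultimately have "\<forall>\<^sub>F m in sequentially. measure ?M (?D m) < c"
      using c by (simp add: order_tendstoD)
    then obtain m where "measure ?M (?D m) < c"
      using eventually_happens'[OF sequentially_bot] by blast
    then show ?thesis by (intro exI[of _ "inverse (real (Suc m)) / 2"]) simp
  qed
  then obtain \<delta> where \<delta>: "\<And>\<xi>. norm \<xi> = 1 \<Longrightarrow> 0 < \<delta> \<xi>" "\<And>\<xi>. norm \<xi> = 1 \<Longrightarrow> measure ?M (D \<xi> (2 * \<delta> \<xi>)) < c"
    by metis
  let ?S = "sphere (0 :: 'n hpoint) 1"
  obtain C where C: "C \<subseteq> ?S" "finite C" "?S \<subseteq> (\<Union>\<xi>\<in>C. ball \<xi> (\<delta> \<xi>))"
  proof (rule compactE_image[of ?S ?S "\<lambda>\<xi>. ball \<xi> (\<delta> \<xi>)"])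
    show "?S \<subseteq> (\<Union>\<xi>\<in>?S. ball \<xi> (\<delta> \<xi>))" using \<delta>(1) by force
  qed auto
  have "base_point \<in> ?S" by simp
  then have "C \<noteq> {}" using C(3) by blast
  define \<delta>0 where "\<delta>0 = Min (\<delta> ` C)"
  have \<delta>0: "0 < \<delta>0" "\<And>\<xi>. \<xi> \<in> C \<Longrightarrow> \<delta>0 \<le> \<delta> \<xi>"
    using C \<open>C \<noteq> {}\<close> \<delta>(1) by (auto simp: \<delta>0_def)
  \<comment> \<open>A ball of radius 4/M \<le> \<delta>0 about a point within \<delta> of a centre
    in \<open>C\<close> lies in the ball of radius 2 \<delta> about that centre.\<close>
  define M where "M = max 2 (4 / \<delta>0)"
  have M: "2 \<le> M" "4 / M \<le> \<delta>0"
    using \<delta>0(1) by (auto simp: M_def field_simps max_def)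
  show ?thesis
  proof (intro exI[of _ M] allI impI)
    fix \<phi> :: "'n hpoint \<Rightarrow> 'n hpoint"
    assume \<phi>: "hiso \<phi> \<and> snd (\<phi> base_point) \<le> 1"
    obtain \<xi> where \<xi>: "norm \<xi> = 1"
      "\<And>t. t \<in> hspace \<Longrightarrow> M \<le> norm (fst (\<phi> t) - fst (\<phi> base_point)) \<Longrightarrow> norm (cayley t - \<xi>) \<le> 4 / M"
      using far_points_near_ideal_point[of \<phi> M] \<phi> M(1) by blast
    have "\<xi> \<in> (\<Union>\<xi>\<in>C. ball \<xi> (\<delta> \<xi>))" using C(3) \<xi>(1) by (metis mem_sphere_0 subsetD)
    then obtain \<xi>' where \<xi>': "\<xi>' \<in> C" "\<xi> \<in> ball \<xi>' (\<delta> \<xi>')" by blast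
    have "{t \<in> hspace. M \<le> norm (fst (\<phi> t) - fst (\<phi> base_point))} \<subseteq> {t \<in> hspace. norm (cayley t - \<xi>) \<le> 4 / M}"
      using \<xi>(2) by blast
    from connects_mono[OF _ this]
    have "{\<omega> \<in> space ?M. connects V (open_edges E \<omega>) {base_point}
         {t \<in> hspace. M \<le> norm (fst (\<phi> t) - fst (\<phi> base_point))}} \<subseteq> D \<xi> (4 / M)"
      unfolding D_def by blast
    also have "\<dots> \<subseteq> D \<xi>' (2 * \<delta> \<xi>')"
      using \<xi>'(2) M(2) \<delta>0(2)[OF \<xi>'(1)] by (intro D_mono) (auto simp: dist_norm norm_minus_commute)
    finally have "\<P>(\<omega> in percolation E p. connects V (open_edges E \<omega>) {base_point}
         {t \<in> hspace. M \<le> norm (fst (\<phi> t) - fst (\<phi> base_point))}) \<le> measure ?M (D \<xi>' (2 * \<delta> \<xi>'))"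
      using D_sets by (intro finite_measure_mono)
    also have "\<dots> < c" using \<delta>(2)[of \<xi>'] subsetD[OF C(1) \<xi>'(1)] by simp
    finally show "\<P>(\<omega> in percolation E p. connects V (open_edges E \<omega>) {base_point}
         {t \<in> hspace. M \<le> norm (fst (\<phi> t) - fst (\<phi> base_point))}) < c" .
  qed
qed

section \<open>Isometric graphs\<close>

lemma points_at_infinity_ideal:
  assumes "x \<in> points_at_infinity"
  shows "\<exists>\<xi>. norm \<xi> = 1 \<and> ideal_point \<xi> = x"
proof (cases x)
  case None
  then show ?thesis by (intro exI[of _ "- base_point"]) (simp add: ideal_point_def)
next
  case (Some z)
  then have z: "snd z = 0" using assms by (auto simp: points_at_infinity_def)
  then have z0: "z + base_point \<noteq> 0" by (auto simp: prod_eq_iff)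
  then have "norm (cayley z) = 1" using norm_cayley[OF z0] z by (simp add: abs_square_eq_1)
  moreover have "cayley z \<noteq> - base_point"
    using norm_cayley_add[of z] z0 by (auto simp: eq_neg_iff_add_eq_0)
  ultimately show ?thesis using Some by (intro exI[of _ "cayley z"]) (simp add: ideal_point_def)
qed

lemma bexp_all_closed: "finite F \<Longrightarrow> bexp p F (\<lambda>\<eta>. of_bool (\<eta> = {})) = (1 - p) ^ card F"
  by (induction F rule: finite_induct) (simp_all add: bexp_insert bexp_const)

text \<open>Makes the set under the supremum in \<open>p0\<close> nonempty, so that p < p0 yields a
  larger parameter in it. At 0 almost surely all of the countably many edges are closed, and the
  cluster contains at most \<open>base_point\<close>, whose image 0 in the ball has distance 1 from
  the sphere.\<close>

lemma zero_in_null_boundary_params: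
  assumes "V \<subseteq> hspace" "\<forall>e\<in>E. e \<subseteq> hspace" "countable E"
  shows "0 \<in> null_boundary_params V E"
proof -
  interpret prob_space "percolation E 0" by (rule prob_space_percolation)
  let ?M = "percolation E 0"
  have "{\<omega> \<in> space ?M. \<omega> e} \<in> null_sets ?M" if "e \<in> E" for e
  proof -
    have "{\<omega> \<in> space ?M. e \<in> {f \<in> {e}. \<omega> f}} = {\<omega> \<in> space ?M. \<omega> e}" by auto
    then have "measure ?M {\<omega> \<in> space ?M. \<omega> e} = 0"
      using percolation_finite(2)[of "{e}" E 0 "\<lambda>\<eta>. e \<in> \<eta>"] that by (simp add: bexp_insert)
    then show ?thesis
      using edge_open_measurable[OF that] by (simp add: null_sets_def emeasure_eq_measure)
  qed
  then have null: "(\<Union>e\<in>E. {\<omega> \<in> space ?M. \<omega> e}) \<in> null_sets ?M"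
    by (intro null_sets_UN' assms)
  have "measure ?M {\<omega> \<in> space ?M. x \<in> boundary_at_infinity (cluster V E \<omega> base_point)} = 0"
    if x: "x \<in> points_at_infinity" for x
  proof -
    obtain \<xi> where \<xi>: "norm \<xi> = 1" "ideal_point \<xi> = x" using points_at_infinity_ideal[OF x] by blast
    have "x \<notin> boundary_at_infinity (cluster V E \<omega> base_point)" if "\<forall>e\<in>E. \<not> \<omega> e" for \<omega>
    proof
      have "open_edges E \<omega> = {}" using that by (auto simp: open_edges_def)
      then have "cluster V E \<omega> base_point \<subseteq> {base_point}"
        by (auto simp: cluster_def connects_def graph_path_def length_Suc_conv)
      then have C: "cluster V E \<omega> base_point \<subseteq> hspace" "\<And>y. y \<in> cluster V E \<omega> base_point \<Longrightarrow> y = base_point"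
        by auto
      assume "x \<in> boundary_at_infinity (cluster V E \<omega> base_point)"
      then obtain y where y: "y \<in> cluster V E \<omega> base_point" "norm (cayley y - \<xi>) \<le> inverse (real (Suc 1))"
        using ideal_point_boundary_iff[OF C(1) \<xi>(1)] \<xi>(2) by blast
      then show False using C(2)[OF y(1)] \<xi>(1) by simp
    qed
    then have "{\<omega> \<in> space ?M. x \<in> boundary_at_infinity (cluster V E \<omega> base_point)} \<subseteq> (\<Union>e\<in>E. {\<omega> \<in> space ?M. \<omega> e})"
      by blast
    from finite_measure_mono[OF this null_setsD2[OF null]] show ?thesis
      using null by (simp add: measure_eq_0_null_sets measure_le_0_iff)
  qed
  then show ?thesis by (simp add: null_boundary_params_def)
qed

text \<open>\<open>side_boundary\<close> uses the maximum norm, the estimates use the Euclidean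
  norm, which dominates it. Points with \<open>infnorm\<close> below r are interior and hence not on
  the frontier.\<close>

lemma side_boundary_horizontal_norm:
  fixes w :: "'n::finite hpoint"
  assumes "w \<in> side_boundary r"
  shows "r \<le> norm (fst w)"
proof -
  have "r \<le> infnorm (fst w)"
  proof (rule ccontr)
    assume "\<not> r \<le> infnorm (fst w)"
    let ?U = "hspace \<inter> {y :: 'n hpoint. infnorm (fst y) < r}"
    have "open {y :: 'n hpoint. infnorm (fst y) < r}"
      by (intro open_Collect_less continuous_on_infnorm continuous_intros)
    then have "openin hspace_top ?U" by auto
    then have "?U \<subseteq> hspace_top interior_of {y \<in> hspace. infnorm (fst y) \<le> r}"
      by (intro interior_of_maximal) auto
    moreover have "w \<in> hspace"
      using assms frontier_of_subset_topspace[of hspace_top] unfolding side_boundary_def by fastforce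
    ultimately show False
      using assms \<open>\<not> r \<le> infnorm (fst w)\<close> by (auto simp: side_boundary_def frontier_of_def)
  qed
  then show ?thesis using infnorm_le_norm[of "fst w"] by linarith
qed

text \<open>Long distances use the factor 1/2 per length \<open>L\<close>. On the bounded range left
  over, where n may be 0, the bound \<open>a\<close> below 1 takes over; this avoids a constant
  before the exponential.\<close>

lemma exponential_decay_from_steps:
  fixes g :: "real \<Rightarrow> real"
  assumes a: "a < 1" "\<And>r. 0 < r \<Longrightarrow> g r \<le> a"
    and L: "0 < L" "K \<le> L" "\<And>r n. 0 < r \<Longrightarrow> real n * L \<le> r - K \<Longrightarrow> g r \<le> (1 / 2) ^ n"
  shows "\<exists>\<psi>>0. \<forall>r>0. g r \<le> exp (- \<psi> * r)"
proof -
  \<comment> \<open>The lower bound 1/2 keeps the logarithm of b meaningful when a is not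
    positive.\<close>
  define b where "b = max a (1 / 2)"
  have b: "0 < b" "b < 1" "a \<le> b" using a by (auto simp: b_def)
  \<comment> \<open>The two rates serve r \<le> 4 L and r > 4 L. In the second range K \<le> L and
    the rounding give n L > r - 2 L, which is at least r / 2.\<close>
  define \<psi> where "\<psi> = min (- ln b / (4 * L)) (ln 2 / (2 * L))"
  have "0 < \<psi>" using b L by (simp add: \<psi>_def divide_neg_pos ln_less_zero)
  moreover have "g r \<le> exp (- \<psi> * r)" if r: "0 < r" for r
  proof (cases "r \<le> 4 * L")
    case True
    have "\<psi> * r \<le> - ln b / (4 * L) * (4 * L)"
      using True r L b by (intro mult_mono) (auto simp: \<psi>_def divide_nonpos_pos)
    also have "\<dots> = - ln b" using L by simp
    finally have "exp (ln b) \<le> exp (- \<psi> * r)" by simp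
    then show ?thesis using a(2)[OF r] b by simp
  next
    case False
    define n where "n = nat \<lfloor>(r - K) / L\<rfloor>"
    have pos: "0 \<le> (r - K) / L" using False L by simp
    have "real n \<le> (r - K) / L" using pos by (simp add: n_def)
    then have "real n * L \<le> r - K" using L(1) by (simp add: pos_le_divide_eq)
    then have "g r \<le> (1 / 2) ^ n" by (rule L(3)[OF r])
    also have "\<dots> = exp (- (ln 2 * real n))"
      by (simp add: exp_minus exp_of_nat2_mult power_one_over inverse_eq_divide)
    also have "\<dots> \<le> exp (- \<psi> * r)"
    proof -
      have "(r - K) / L < real n + 1" using pos by (simp add: n_def)
      then have "r - K < (real n + 1) * L" using L(1) by (simp add: pos_divide_less_eq)
      then have "r / 2 \<le> real n * L" using False L(2) by (simp add: algebra_simps)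
      then have "r / (2 * L) \<le> real n" using L(1) by (simp add: field_simps)
      then have "ln 2 * (r / (2 * L)) \<le> ln 2 * real n" by (intro mult_left_mono) auto
      moreover have "\<psi> * r \<le> ln 2 / (2 * L) * r"
        using r by (intro mult_right_mono) (auto simp: \<psi>_def)
      ultimately show ?thesis by simp
    qed
    finally show ?thesis .
  qed
  ultimately show ?thesis by blast
qed

section \<open>Uniform geometry of a transitive graph\<close>

locale isometric_graph =
  fixes V :: "'n::finite hpoint set" and E :: "'n hpoint set set"
  assumes embedded: "embedded_simple_graph V E"
    and locally_finite: "locally_finite_graph V E"
    and transitive: "transitive_under_isometries V E"
    and geodesic: "\<forall>e\<in>E. geodesic_segment e"
    and base: "base_point \<in> V"
begin

lemma V_hspace: "V \<subseteq> hspace" and E_hspace: "\<forall>e\<in>E. e \<subseteq> hspace"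
  using embedded by (auto simp: embedded_simple_graph_def)

lemma edge_ends: "e \<in> E \<Longrightarrow> \<exists>x y. e \<inter> V = {x, y}"
  using embedded unfolding embedded_simple_graph_def by metis

lemma edges_meet: "e \<in> E \<Longrightarrow> f \<in> E \<Longrightarrow> e \<noteq> f \<Longrightarrow> e \<inter> f \<subseteq> V"
  using embedded unfolding embedded_simple_graph_def by blast

text \<open>Hyperbolic space is a countable union of the compact sets \<open>K m\<close>, each of
  which meets finitely many vertices and edges.\<close>

lemma countable_graph: "countable V" "countable E"
proof -
  define K :: "nat \<Rightarrow> 'n hpoint set" where "K m = cball 0 (real m) \<inter> {y. inverse (real (Suc m)) \<le> snd y}" for m
  have "closed {y :: 'n hpoint. inverse (real (Suc m)) \<le> snd y}" for m
    by (intro closed_Collect_le continuous_intros)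
  then have "compact (K m)" for m unfolding K_def by (intro compact_Int_closed) auto
  moreover have "K m \<subseteq> hspace" for m
  proof
    fix y assume "y \<in> K m"
    then have "inverse (real (Suc m)) \<le> snd y" by (simp add: K_def)
    moreover have "0 < inverse (real (Suc m))" by simp
    ultimately have "0 < snd y" by (rule less_le_trans[rotated])
    then show "y \<in> hspace" by (simp add: hspace_def)
  qed
  ultimately have fin: "finite (V \<inter> K m)" "finite {e \<in> E. e \<inter> K m \<noteq> {}}" for m
    using locally_finite unfolding locally_finite_graph_def by blast+
  have cover: "\<exists>m. y \<in> K m" if y: "y \<in> hspace" for y
  proof -
    obtain m1 where m1: "norm y < real m1" using reals_Archimedean2 by blast
    obtain m2 where m2: "inverse (real (Suc m2)) < snd y"
      using reals_Archimedean[of "snd y"] y by (auto simp: hspace_def)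
    have "inverse (real (Suc (max m1 m2))) \<le> inverse (real (Suc m2))"
      by (intro le_imp_inverse_le) auto
    then have "inverse (real (Suc (max m1 m2))) \<le> snd y" using m2 by linarith
    moreover have "norm y \<le> real (max m1 m2)" using m1 by simp
    ultimately have "y \<in> K (max m1 m2)" by (simp only: K_def Int_iff mem_Collect_eq mem_cball_0)
    then show ?thesis by blast
  qed
  have "V \<subseteq> (\<Union>m. V \<inter> K m)" using cover V_hspace by blast
  moreover have "countable (\<Union>m. V \<inter> K m)" by (intro countable_UN[OF countableI_type] countable_finite fin)
  ultimately show "countable V" by (rule countable_subset)
  have "E \<subseteq> (\<Union>m. {e \<in> E. e \<inter> K m \<noteq> {}})"
  proof -
    have "\<exists>m. e \<inter> K m \<noteq> {}" if e: "e \<in> E" for e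
    proof -
      obtain y where y: "y \<in> e" using edge_ends[OF e] by blast
      then obtain m where "y \<in> K m" using cover subsetD[OF bspec[OF E_hspace e]] by blast
      then show ?thesis using y by blast
    qed
    then show ?thesis by blast
  qed
  moreover have "countable (\<Union>m. {e \<in> E. e \<inter> K m \<noteq> {}})" by (intro countable_UN[OF countableI_type] countable_finite fin)
  ultimately show "countable E" by (rule countable_subset)
qed

text \<open>Turns a change of starting vertex into a change of placement: \<phi> started at v
  becomes \<phi> after \<gamma> started at \<open>base_point\<close>.\<close>

lemma root_change:
  assumes "v \<in> V"
  obtains \<gamma> where "hiso \<gamma>" "\<gamma> base_point = v" "\<gamma> ` V = V" "(`) \<gamma> ` E = E"
proof -
  obtain \<Gamma> where \<Gamma>: "\<Gamma> \<subseteq> hisometries" "\<forall>\<phi>\<in>\<Gamma>. \<phi> ` V = V \<and> (`) \<phi> ` E = E"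
      "\<forall>u\<in>V. \<forall>v\<in>V. \<exists>\<phi>\<in>\<Gamma>. \<phi> u = v"
    using transitive unfolding transitive_under_isometries_def by (elim exE conjE)
  obtain \<gamma> where \<gamma>: "\<gamma> \<in> \<Gamma>" "\<gamma> base_point = v" using \<Gamma>(3) base assms by metis
  show ?thesis
  proof (rule that)
    show "hiso \<gamma>" using \<gamma>(1) \<Gamma>(1) hisometries_iff by (metis subsetD)
  qed (use \<gamma> \<Gamma>(2) in simp_all)
qed

lemma finite_edges_at_base: "finite {e \<in> E. base_point \<in> e}"
proof -
  have "finite {e \<in> E. e \<inter> {base_point} \<noteq> {}}"
    using locally_finite[unfolded locally_finite_graph_def, rule_format, of "{base_point}"] by simp
  then show ?thesis by simp
qed

text \<open>Geodesic edges have finite length, and a symmetry of the graph moves any edge to one of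
  the finitely many edges at \<open>base_point\<close>.\<close>

lemma edge_length_bounded: "\<exists>c\<ge>0. \<forall>e\<in>E. \<forall>a\<in>e. \<forall>b\<in>e. hratio a b \<le> c"
proof -
  have "\<exists>l. \<forall>a\<in>e. \<forall>b\<in>e. hratio a b \<le> l" if e: "e \<in> E" for e
  proof -
    obtain l \<gamma> where g: "\<gamma> ` {0..l} = e" "\<forall>s\<in>{0..l}. \<forall>t\<in>{0..l}. hdist (\<gamma> s) (\<gamma> t) = \<bar>s - t\<bar>"
      using geodesic e unfolding geodesic_segment_def by metis
    have "hratio a b \<le> 2 * (cosh l - 1)" if ab: "a \<in> e" "b \<in> e" for a b
    proof -
      obtain s t where st: "s \<in> {0..l}" "t \<in> {0..l}" "a = \<gamma> s" "b = \<gamma> t" using g(1) ab by blast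
      have "1 + hratio a b / 2 = cosh (hdist a b)"
        using cosh_hdist[of a b] subsetD[OF bspec[OF E_hspace e]] ab by simp
      also have "\<dots> = cosh \<bar>s - t\<bar>" using g(2) st by simp
      also have "\<dots> \<le> cosh l" using st by (intro cosh_real_nonneg_le_iff[THEN iffD2]) auto
      finally show ?thesis by simp
    qed
    then show ?thesis by blast
  qed
  then obtain l where l: "\<And>e a b. e \<in> E \<Longrightarrow> a \<in> e \<Longrightarrow> b \<in> e \<Longrightarrow> hratio a b \<le> l e" by metis
  define c where "c = Max (insert 0 (l ` {e \<in> E. base_point \<in> e}))"
  have c: "0 \<le> c" "\<And>e. e \<in> E \<Longrightarrow> base_point \<in> e \<Longrightarrow> l e \<le> c"
    using finite_edges_at_base by (auto simp: c_def)
  have "hratio a b \<le> c" if e: "e \<in> E" "a \<in> e" "b \<in> e" for e a b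
  proof -
    obtain v where v: "v \<in> e" "v \<in> V" using edge_ends[OF e(1)] by blast
    obtain \<gamma> where \<gamma>: "hiso \<gamma>" "\<gamma> base_point = v" "(`) \<gamma> ` E = E" using root_change[OF v(2)] by metis
    then obtain f where f: "f \<in> E" "e = \<gamma> ` f" using e(1) by blast
    have fh: "f \<subseteq> hspace" using E_hspace f(1) by blast
    obtain x where "x \<in> f" "\<gamma> x = v" using f(2) v(1) by blast
    then have "base_point \<in> f"
      using inj_onD[OF hiso_inj[OF \<gamma>(1)], of x base_point] \<gamma>(2) fh by auto
    moreover obtain a' b' where "a' \<in> f" "b' \<in> f" "a = \<gamma> a'" "b = \<gamma> b'" using f(2) e by blast
    moreover have "hratio (\<gamma> a') (\<gamma> b') = hratio a' b'"
      using calculation fh by (intro hiso_hratio[OF \<gamma>(1)]) auto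
    ultimately show ?thesis using l[OF f(1)] c(2)[OF f(1)] by fastforce
  qed
  with c(1) show ?thesis by blast
qed

text \<open>The hyperbolic bound on edge lengths is invariant under \<phi>, which is why one
  \<open>K\<close> serves all placements.\<close>

lemma edge_horizontal_bounded:
  "\<exists>K>0. \<forall>\<phi>. hiso \<phi> \<longrightarrow> (\<forall>e\<in>E. \<forall>a\<in>e. \<forall>b\<in>e. snd (\<phi> a) \<le> 1 \<longrightarrow> norm (fst (\<phi> a) - fst (\<phi> b)) \<le> K)"
proof -
  obtain c where c: "0 \<le> c" "\<forall>e\<in>E. \<forall>a\<in>e. \<forall>b\<in>e. hratio a b \<le> c" using edge_length_bounded by blast
  have "norm (fst (\<phi> a) - fst (\<phi> b)) \<le> 2 * (c + 1)"
    if "hiso \<phi>" "e \<in> E" "a \<in> e" "b \<in> e" "snd (\<phi> a) \<le> 1" for \<phi> e a b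
  proof -
    have "a \<in> hspace" "b \<in> hspace" using that E_hspace by auto
    then show ?thesis
      using that c by (intro hratio_bounds_horizontal) (auto simp: hiso_hspace hiso_hratio)
  qed
  then show ?thesis using c(1) by (intro exI[of _ "2 * (c + 1)"]) auto
qed

section \<open>Decay for finite sets of edges below the horosphere\<close>

abbreviation ends :: "'n hpoint set \<Rightarrow> 'n hpoint set" where
  "ends e \<equiv> e \<inter> V"

definition far :: "('n hpoint \<Rightarrow> 'n hpoint) \<Rightarrow> 'n hpoint \<Rightarrow> real \<Rightarrow> 'n hpoint set" where
  "far \<phi> v s = {t. s \<le> norm (fst (\<phi> t) - fst (\<phi> v))}"

text \<open>The class of starting situations, closed under restarts: leaving a set along an edge of
  \<open>F\<close> keeps \<phi> and \<open>F\<close> and moves v to an end of that edge, which is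
  low again.\<close>

definition admissible :: "('n hpoint \<Rightarrow> 'n hpoint) \<Rightarrow> 'n hpoint set set \<Rightarrow> 'n hpoint \<Rightarrow> bool" where
  "admissible \<phi> F v \<longleftrightarrow> hiso \<phi> \<and> finite F \<and> F \<subseteq> E \<and> v \<in> V \<and> snd (\<phi> v) \<le> 1 \<and>
     (\<forall>e\<in>F. \<forall>x\<in>ends e. snd (\<phi> x) \<le> 1)"

text \<open>Pulls a path in the image graph back to the graph. Injectivity of \<gamma> is known on
  \<open>hspace\<close>, so the preimages are chosen among the vertices.\<close>

lemma conn_image:
  assumes \<gamma>: "hiso \<gamma>" "\<gamma> base_point = v" "\<gamma> ` V = V" and \<eta>: "\<eta> \<subseteq> E"
    and conn: "conn ends ((`) \<gamma> ` \<eta>) v t"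
  shows "\<exists>t'\<in>V. \<gamma> t' = t \<and> conn ends \<eta> base_point t'"
  using conn
proof (induction rule: conn_induct)
  case refl
  then show ?case using base \<gamma>(2) by (intro bexI[of _ base_point]) auto
next
  case (step y z e)
  then obtain y' where y': "y' \<in> V" "\<gamma> y' = y" "conn ends \<eta> base_point y'" by blast
  obtain f where f: "f \<in> \<eta>" "e = \<gamma> ` f" using step by blast
  have fh: "f \<subseteq> hspace" using f(1) \<eta> E_hspace by blast
  have pre: "x' \<in> f" if x': "x' \<in> V" "\<gamma> x' \<in> e" for x'
  proof -
    obtain x where x: "x \<in> f" "\<gamma> x = \<gamma> x'" using f(2) x'(2) by (metis imageE)
    then show ?thesis
      using inj_onD[OF hiso_inj[OF \<gamma>(1)] x(2) subsetD[OF fh x(1)] subsetD[OF V_hspace x'(1)]] by simp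
  qed
  have "z \<in> \<gamma> ` V" using step \<gamma>(3) by simp
  then obtain z' where z': "z' \<in> V" "\<gamma> z' = z" by (metis imageE)
  have "y' \<in> f" "z' \<in> f" using pre step y' z' by auto
  then have "conn ends \<eta> y' z'" using f(1) y' z' by (intro conn_step[of f]) auto
  with y'(3) have "conn ends \<eta> base_point z'" by (rule conn_trans)
  then show ?case using z' by blast
qed

text \<open>A symmetry of the graph taking \<open>base_point\<close> to v reduces an arbitrary start
  to \<open>base_point\<close>, with \<phi> after \<gamma> as placement; the connection inside
  \<open>F\<close> then becomes part of one in the full percolation at p.\<close>

lemma no_escape:
  assumes p: "p \<in> null_boundary_params V E" and c: "0 < c"
  shows "\<exists>M>0. \<forall>\<phi> F v. admissible \<phi> F v \<longrightarrow> bexp p F (\<lambda>\<eta>. of_bool (reaches ends \<eta> v (far \<phi> v M))) < c"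
proof -
  have p01: "0 \<le> p" "p \<le> 1" using p by (auto simp: null_boundary_params_def)
  interpret prob_space "percolation E p" by (rule prob_space_percolation)
  obtain M0 where M0: "\<And>\<phi>. hiso \<phi> \<Longrightarrow> snd (\<phi> base_point) \<le> 1 \<Longrightarrow>
    \<P>(\<omega> in percolation E p. connects V (open_edges E \<omega>) {base_point}
         {t \<in> hspace. M0 \<le> norm (fst (\<phi> t) - fst (\<phi> base_point))}) < c"
    using uniform_no_escape[OF V_hspace countable_graph(1) E_hspace countable_graph(2) p c] by blast
  define M where "M = max M0 1"
  have "bexp p F (\<lambda>\<eta>. of_bool (reaches ends \<eta> v (far \<phi> v M))) < c" if adm: "admissible \<phi> F v" for \<phi> F v
  proof -
    have F: "finite F" "F \<subseteq> E" and v: "v \<in> V" "snd (\<phi> v) \<le> 1" and \<phi>: "hiso \<phi>"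
      using adm by (auto simp: admissible_def)
    obtain \<gamma> where \<gamma>: "hiso \<gamma>" "\<gamma> base_point = v" "\<gamma> ` V = V" "(`) \<gamma> ` E = E" using root_change[OF v(1)] by metis
    let ?\<phi> = "\<lambda>y. \<phi> (\<gamma> y)"
    define F0 where "F0 = {e \<in> E. \<gamma> ` e \<in> F}"
    have F0: "F0 \<subseteq> E" "(`) \<gamma> ` F0 = F"
    proof -
      have "e \<in> (`) \<gamma> ` F0" if e: "e \<in> F" for e
      proof -
        have "e \<in> (`) \<gamma> ` E" using \<gamma>(4) F(2) e by blast
        then show ?thesis using e by (auto simp: F0_def)
      qed
      then show "F0 \<subseteq> E" "(`) \<gamma> ` F0 = F" by (auto simp: F0_def)
    qed
    have inj: "inj_on ((`) \<gamma>) F0"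
    proof (rule inj_onI)
      fix e f assume "e \<in> F0" "f \<in> F0" "\<gamma> ` e = \<gamma> ` f"
      then show "e = f"
        using inj_on_image_eq_iff[OF hiso_inj[OF \<gamma>(1)], of e f] E_hspace F0(1) by blast
    qed
    have fin: "finite F0" using F(1) F0(2) inj finite_imageD by metis
    let ?B = "{t \<in> hspace. M0 \<le> norm (fst (?\<phi> t) - fst (?\<phi> base_point))}"
    have "bexp p F (\<lambda>\<eta>. of_bool (reaches ends \<eta> v (far \<phi> v M))) =
        bexp p F0 (\<lambda>\<eta>. of_bool (reaches ends ((`) \<gamma> ` \<eta>) v (far \<phi> v M)))"
      using bexp_reindex[OF inj] F0(2) by simp
    also have "\<dots> \<le> bexp p F0 (\<lambda>\<eta>. of_bool (reaches ends \<eta> base_point (?B \<inter> V)))"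
    proof (rule bexp_mono[OF p01])
      fix \<eta> assume \<eta>: "\<eta> \<subseteq> F0"
      have "reaches ends \<eta> base_point (?B \<inter> V)" if r: "reaches ends ((`) \<gamma> ` \<eta>) v (far \<phi> v M)"
      proof -
        obtain t where t: "t \<in> far \<phi> v M" "conn ends ((`) \<gamma> ` \<eta>) v t" using r by blast
        have "\<eta> \<subseteq> E" using \<eta> F0(1) by blast
        from conn_image[OF \<gamma>(1-3) this t(2)] obtain t'
          where t': "t' \<in> V" "\<gamma> t' = t" "conn ends \<eta> base_point t'" by blast
        have "t' \<in> ?B" using t' t(1) V_hspace \<gamma>(2) by (auto simp: far_def M_def)
        then show ?thesis using t' by blast
      qed
      then show "of_bool (reaches ends ((`) \<gamma> ` \<eta>) v (far \<phi> v M)) \<le> (of_bool (reaches ends \<eta> base_point (?B \<inter> V)) :: real)"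
        by (simp only: of_bool_def) auto
    qed
    also have "\<dots> = \<P>(\<omega> in percolation E p. reaches ends {e \<in> F0. \<omega> e} base_point (?B \<inter> V))"
      using percolation_finite(2)[OF fin F0(1) p01, of "\<lambda>\<eta>. reaches ends \<eta> base_point (?B \<inter> V)"] by simp
    also have "\<dots> \<le> \<P>(\<omega> in percolation E p. connects V (open_edges E \<omega>) {base_point} ?B)"
    proof (rule finite_measure_mono)
      have "connects V (open_edges E \<omega>) {base_point} ?B" if r: "reaches ends {e \<in> F0. \<omega> e} base_point (?B \<inter> V)" for \<omega>
      proof -
        obtain t where t: "t \<in> ?B" "conn ends {e \<in> F0. \<omega> e} base_point t" using r by blast
        have "{e \<in> F0. \<omega> e} \<subseteq> open_edges E \<omega>" using F0(1) by (auto simp: open_edges_def)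
        from connects_conn[OF t(2) base this] show ?thesis
          using t(1) unfolding connects_def by blast
      qed
      then show "{\<omega> \<in> space (percolation E p). reaches ends {e \<in> F0. \<omega> e} base_point (?B \<inter> V)} \<subseteq>
        {\<omega> \<in> space (percolation E p). connects V (open_edges E \<omega>) {base_point} ?B}" by blast
    qed (rule connects_measurable[OF countable_graph])
    also have "\<dots> < c" using M0[OF hiso_comp[OF \<phi> \<gamma>(1)]] \<gamma>(2) v(2) by simp
    finally show ?thesis .
  qed
  moreover have "0 < M" by (simp add: M_def)
  ultimately show ?thesis by blast
qed

text \<open>The bound \<open>small\<close> rules out the first alternative of the dichotomy, so each
  admissible start has its own \<open>S\<close> within distance M. Leaving it costs distance at most
  M + K and gains the factor 1/2. The edge set \<open>F\<close> stays the same throughout; only v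
  and s vary in the induction.\<close>

lemma geometric_decay:
  assumes p: "0 \<le> p" "p < p'" "p' \<le> 1" and M: "0 < M"
    and small: "\<And>\<phi> F v. admissible \<phi> F v \<Longrightarrow>
          bexp p' F (\<lambda>\<eta>. of_bool (reaches ends \<eta> v (far \<phi> v M))) < 1 - exp (- 2 * (p' - p))"
    and K: "0 < K" "\<And>\<phi> e a b. hiso \<phi> \<Longrightarrow> e \<in> E \<Longrightarrow> a \<in> e \<Longrightarrow> b \<in> e \<Longrightarrow> snd (\<phi> a) \<le> 1 \<Longrightarrow>
          norm (fst (\<phi> a) - fst (\<phi> b)) \<le> K"
    and adm: "admissible \<phi> F v" and s: "real n * (M + K) \<le> s"
  shows "bexp p F (\<lambda>\<eta>. of_bool (reaches ends \<eta> v (far \<phi> v s))) \<le> (1 / 2) ^ n"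
  using adm s
proof (induction n arbitrary: v s)
  case 0
  then show ?case using p by (simp add: bexp_le_1 admissible_def)
next
  case (Suc n)
  have F: "finite F" "F \<subseteq> E" and \<phi>: "hiso \<phi>"
    using Suc.prems(1) by (auto simp: admissible_def)
  have v: "v \<notin> far \<phi> v M" using M by (simp add: far_def)
  obtain S where S: "v \<in> S" "S \<inter> far \<phi> v M = {}" "dct_sum p F ends v S \<le> 1 / 2"
    using dct_dichotomy[OF F(1) p v, of ends] small[OF Suc.prems(1)] by force
  have sM: "real n * (M + K) \<le> s - M - K" using Suc.prems(2) by (simp add: algebra_simps)
  moreover have "0 \<le> real n * (M + K)" using M K(1) by simp
  ultimately have "M \<le> s" using K(1) by linarith
  then have disj: "S \<inter> far \<phi> v s = {}" using S(2) by (auto simp: far_def)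
  have pairs: "\<And>e. e \<in> F \<Longrightarrow> \<exists>x y. ends e = {x, y}" using F(2) edge_ends by blast
  have bound: "bexp p F (\<lambda>\<eta>. of_bool (\<exists>y\<in>ends e - S. reaches ends \<eta> y (far \<phi> v s))) \<le> (1 / 2) ^ n"
    if e: "e \<in> edge_boundary ends F S" for e
  proof -
    have eF: "e \<in> F" "e \<in> E" using e F(2) by (auto simp: edge_boundary_def)
    obtain a b where ab: "ends e = {a, b}" using pairs[OF eF(1)] by blast
    then have "a \<in> S \<and> b \<notin> S \<or> b \<in> S \<and> a \<notin> S" using e by (auto simp: edge_boundary_def)
    moreover have "ends e = {b, a}" using ab by auto
    ultimately obtain x y where xy: "x \<in> S" "y \<notin> S" "ends e = {x, y}"
      using ab by blast
    have low: "snd (\<phi> x) \<le> 1" "snd (\<phi> y) \<le> 1" "y \<in> V" "x \<in> e" "y \<in> e"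
      using Suc.prems(1) eF(1) xy(3) by (auto simp: admissible_def)
    then have adm_y: "admissible \<phi> F y" using Suc.prems(1) by (simp add: admissible_def)
    have x: "norm (fst (\<phi> x) - fst (\<phi> v)) < M" using xy(1) S(2) by (auto simp: far_def)
    have y: "norm (fst (\<phi> x) - fst (\<phi> y)) \<le> K" using K(2)[OF \<phi> eF(2), of x y] low by simp
    \<comment> \<open>The inner end x is within M of v and the outer end y within K of x, so at
      least n (M + K) of the distance s remains from y.\<close>
    have sub: "far \<phi> v s \<subseteq> far \<phi> y (real n * (M + K))"
    proof
      fix t assume "t \<in> far \<phi> v s"
      then have "s \<le> norm (fst (\<phi> t) - fst (\<phi> v))" by (simp add: far_def)
      also have "fst (\<phi> t) - fst (\<phi> v) = (fst (\<phi> t) - fst (\<phi> y)) + ((fst (\<phi> x) - fst (\<phi> v)) - (fst (\<phi> x) - fst (\<phi> y)))"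
        by simp
      also have "norm \<dots> \<le> norm (fst (\<phi> t) - fst (\<phi> y)) + norm ((fst (\<phi> x) - fst (\<phi> v)) - (fst (\<phi> x) - fst (\<phi> y)))"
        by (rule norm_triangle_ineq)
      also have "norm ((fst (\<phi> x) - fst (\<phi> v)) - (fst (\<phi> x) - fst (\<phi> y))) \<le>
          norm (fst (\<phi> x) - fst (\<phi> v)) + norm (fst (\<phi> x) - fst (\<phi> y))"
        by (rule norm_triangle_ineq4)
      finally show "t \<in> far \<phi> y (real n * (M + K))" using x y sM by (simp add: far_def)
    qed
    have "bexp p F (\<lambda>\<eta>. of_bool (\<exists>y\<in>ends e - S. reaches ends \<eta> y (far \<phi> v s))) \<le>
        bexp p F (\<lambda>\<eta>. of_bool (reaches ends \<eta> y (far \<phi> y (real n * (M + K)))))"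
    proof (rule bexp_mono)
      fix \<eta>
      have "reaches ends \<eta> y (far \<phi> y (real n * (M + K)))" if "\<exists>y\<in>ends e - S. reaches ends \<eta> y (far \<phi> v s)"
      proof -
        have "ends e - S = {y}" using xy by auto
        then show ?thesis using that sub by auto
      qed
      then show "of_bool (\<exists>y\<in>ends e - S. reaches ends \<eta> y (far \<phi> v s)) \<le>
          (of_bool (reaches ends \<eta> y (far \<phi> y (real n * (M + K)))) :: real)"
        by (simp only: of_bool_def) auto
    qed (use p in auto)
    also have "\<dots> \<le> (1 / 2) ^ n" by (rule Suc.IH[OF adm_y order_refl])
    finally show ?thesis .
  qed
  have "bexp p F (\<lambda>\<eta>. of_bool (reaches ends \<eta> v (far \<phi> v s))) \<le> dct_sum p F ends v S * (1 / 2) ^ n"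
    using p by (intro dct_iteration[OF F(1) _ _ S(1) disj pairs bound]) auto
  also have "\<dots> \<le> 1 / 2 * (1 / 2) ^ n" using S(3) by (intro mult_right_mono) auto
  finally show ?case by simp
qed

end

section \<open>Connections below the horosphere\<close>

context isometric_graph
begin

text \<open>
  A point \<open>z\<close> at which an open edge is cut by the horosphere lies on no other edge unless it is a
  vertex, so a path below the horosphere stays in the open pieces that contain a vertex connected
  to the base point inside the graph of edges with both ends below the horosphere.
\<close>

lemma lower_connection_far:
  assumes \<phi>: "hiso \<phi>" "fst (\<phi> base_point) = 0" "snd (\<phi> base_point) \<le> 1"
    and K: "\<And>e a b. e \<in> E \<Longrightarrow> a \<in> e \<Longrightarrow> b \<in> e \<Longrightarrow> snd (\<phi> a) \<le> 1 \<Longrightarrow>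
          norm (fst (\<phi> a) - fst (\<phi> b)) \<le> K" "0 < K"
    and con: "connects W (lower_edges ((`) \<phi> ` open_edges E \<omega>)) {\<phi> base_point} (side_boundary r)"
  shows "reaches ends {e \<in> {e \<in> E. \<forall>x\<in>ends e. snd (\<phi> x) \<le> 1}. \<omega> e} base_point (far \<phi> base_point (r - K))"
proof -
  define \<eta> where "\<eta> = {e \<in> {e \<in> E. \<forall>x\<in>ends e. snd (\<phi> x) \<le> 1}. \<omega> e}"
  define P where "P = lower_edges ((`) \<phi> ` open_edges E \<omega>)"
  \<comment> \<open>\<open>X\<close> collects the low vertices connected to
    \<open>base_point\<close> through edges with only low ends. \<open>Z\<close> adds to their
    images all points of open pieces that contain such an image; the path turns out to stay in
    \<open>Z\<close>.\<close>
  define X where "X = {x \<in> V. snd (\<phi> x) \<le> 1 \<and> conn ends \<eta> base_point x}"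
  define good where "good c \<longleftrightarrow> (\<exists>x\<in>X. \<phi> x \<in> c)" for c
  define Z where "Z = \<phi> ` X \<union> \<Union>{c \<in> P. good c}"
  have inj: "x = y" if "\<phi> x = \<phi> y" "x \<in> hspace" "y \<in> hspace" for x y
    using inj_onD[OF hiso_inj[OF \<phi>(1)]] that by blast
  have piece: "\<exists>e\<in>E. \<omega> e \<and> c \<in> components (\<phi> ` e \<inter> lower_region) \<and> c \<subseteq> \<phi> ` e \<inter> lower_region"
    if "c \<in> P" for c
    using that in_components_subset unfolding P_def lower_edges_def open_edges_def by blast
  have pre: "x \<in> e" if e: "e \<in> E" and x: "x \<in> V" "\<phi> x \<in> \<phi> ` e" for x e
  proof -
    obtain y where y: "y \<in> e" "\<phi> x = \<phi> y" using x(2) by blast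
    have "y \<in> hspace" using y(1) e E_hspace by blast
    then show ?thesis using inj[OF y(2)] y(1) subsetD[OF V_hspace x(1)] by simp
  qed
  have spread: "good c" if c: "c \<in> P" and z: "z \<in> c" "z \<in> Z" for c z
  proof -
    obtain e where e: "e \<in> E" "\<omega> e" "c \<in> components (\<phi> ` e \<inter> lower_region)" "c \<subseteq> \<phi> ` e \<inter> lower_region"
      using piece[OF c] by blast
    from z(2) consider "z \<in> \<phi> ` X" | c' where "c' \<in> P" "good c'" "z \<in> c'"
      unfolding Z_def by blast
    then show ?thesis
    proof cases
      case 1
      then show ?thesis using z(1) by (auto simp: good_def)
    next
      case 2
      obtain f where f: "f \<in> E" "\<omega> f" "c' \<in> components (\<phi> ` f \<inter> lower_region)" "c' \<subseteq> \<phi> ` f \<inter> lower_region"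
        using piece[OF 2(1)] by blast
      obtain x where x: "x \<in> X" "\<phi> x \<in> c'" using 2(2) by (auto simp: good_def)
      show ?thesis
      proof (cases "e = f")
        case True
        have "c = c'"
          using components_eq[of c "\<phi> ` e \<inter> lower_region" c'] e(3) f(3) z(1) 2(3) True by blast
        then show ?thesis using 2(2) by simp
      next
        case False
        \<comment> \<open>Two different edges meet only in vertices, so z is the image of a low
          vertex v. If v differs from x, these are the two ends of f, both low, so f itself belongs
          to \<eta>.\<close>
        obtain v where v: "v \<in> e" "\<phi> v = z" using z(1) e(4) by blast
        obtain v' where v': "v' \<in> f" "\<phi> v' = z" using 2(3) f(4) by blast
        have "v = v'"
        proof (rule inj)
          show "\<phi> v = \<phi> v'" using v v' by simp
        qed (use v(1) v'(1) e(1) f(1) E_hspace in auto)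
        then have vV: "v \<in> V" "v \<in> f" using edges_meet[OF e(1) f(1) False] v(1) v'(1) by auto
        have vlow: "snd (\<phi> v) \<le> 1" using v(2) z(1) e(4) by (auto simp: lower_region_def)
        have xV: "x \<in> V" "snd (\<phi> x) \<le> 1" "conn ends \<eta> base_point x" using x(1) by (auto simp: X_def)
        have xf: "x \<in> f" using pre[OF f(1) xV(1)] x(2) f(4) by blast
        have "conn ends \<eta> x v"
        proof (cases "x = v")
          case False
          obtain a b where ab: "ends f = {a, b}" using edge_ends[OF f(1)] by blast
          have "x \<in> ends f" "v \<in> ends f" using xf xV(1) vV by simp_all
          then have "ends f = {x, v}" using False unfolding ab by blast
          then have "f \<in> \<eta>" using f(1,2) xV(2) vlow by (simp add: \<eta>_def)
          then show ?thesis using xf xV(1) vV by (intro conn_step[of f]) auto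
        qed simp
        with xV(3) have "conn ends \<eta> base_point v" by (rule conn_trans)
        then have "v \<in> X" using vV(1) vlow by (simp add: X_def)
        then show ?thesis using v(2) z(1) by (auto simp: good_def)
      qed
    qed
  qed
  have goodZ: "z \<in> Z" if "c \<in> P" "good c" "z \<in> c" for c z
    using that by (auto simp: Z_def)
  obtain vs es where path: "graph_path W P vs es"
    and start: "\<phi> base_point \<in> set vs \<union> \<Union>(set es)"
    and target: "(set vs \<union> \<Union>(set es)) \<inter> side_boundary r \<noteq> {}"
    using con unfolding connects_def P_def[symmetric] by blast
  have len: "length vs = Suc (length es)" and esP: "set es \<subseteq> P"
    and inc: "\<And>i. i < length es \<Longrightarrow> vs ! i \<in> es ! i \<and> vs ! Suc i \<in> es ! i"
    using path by (auto simp: graph_path_def)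
  have esP': "es ! i \<in> P" if "i < length es" for i using esP that by (meson nth_mem subsetD)
  have oX: "base_point \<in> X" using base \<phi>(3) by (simp add: X_def)
  \<comment> \<open>The path need not start at \<open>base_point\<close> but merely meet its image,
    at a vertex or inside an edge; membership in \<open>Z\<close> spreads from there in both
    directions.\<close>
  obtain i0 where i0: "i0 \<le> length es" "vs ! i0 \<in> Z"
  proof (cases "\<phi> base_point \<in> set vs")
    case True
    then obtain i where "i < length vs" "vs ! i = \<phi> base_point" by (auto simp: in_set_conv_nth)
    then show ?thesis using that[of i] oX len by (auto simp: Z_def)
  next
    case False
    then obtain i where i: "i < length es" "\<phi> base_point \<in> es ! i"
      using start by (auto simp: in_set_conv_nth)
    then have "good (es ! i)" using oX by (auto simp: good_def)
    then have "vs ! i \<in> Z" using goodZ[OF esP'[OF i(1)]] inc[OF i(1)] by blast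
    then show ?thesis using that[of i] i(1) by simp
  qed
  have step: "vs ! i \<in> Z \<longleftrightarrow> vs ! Suc i \<in> Z" if i: "i < length es" for i
    using spread[OF esP'[OF i]] goodZ[OF esP'[OF i]] inc[OF i] by blast
  have all_Z: "vs ! i \<in> Z" if "i \<le> length es" for i
  proof -
    have "vs ! j \<in> Z \<longleftrightarrow> vs ! 0 \<in> Z" if "j \<le> length es" for j
      using that by (induction j) (use step in auto)
    then show ?thesis using i0 that by blast
  qed
  have all_good: "good (es ! i)" if i: "i < length es" for i
    by (rule spread[OF esP'[OF i] conjunct1[OF inc[OF i]]]) (use all_Z i in simp)
  obtain w where w: "w \<in> set vs \<union> \<Union>(set es)" "w \<in> side_boundary r" using target by blast
  have "w \<in> Z"
  proof (cases "w \<in> set vs")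
    case True
    then show ?thesis using all_Z len by (auto simp: in_set_conv_nth)
  next
    case False
    then obtain i where i: "i < length es" "w \<in> es ! i" using w(1) by (auto simp: in_set_conv_nth)
    then show ?thesis using goodZ[OF esP'[OF i(1)] all_good[OF i(1)]] by blast
  qed
  \<comment> \<open>w is the image of a vertex in \<open>X\<close> or lies on the same placed edge
    as one, so that at most K is lost.\<close>
  then have "\<exists>x\<in>X. norm (fst (\<phi> x) - fst w) \<le> K"
  proof -
    from \<open>w \<in> Z\<close> consider "w \<in> \<phi> ` X" | c where "c \<in> P" "good c" "w \<in> c" unfolding Z_def by blast
    then show ?thesis
    proof cases
      case 1
      then obtain x where "x \<in> X" "w = \<phi> x" by blast
      then show ?thesis using K(2) by (intro bexI[of _ x]) simp_all
    next
      case 2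
      obtain e where e: "e \<in> E" "c \<subseteq> \<phi> ` e \<inter> lower_region" using piece[OF 2(1)] by blast
      obtain x where x: "x \<in> X" "\<phi> x \<in> c" using 2(2) by (auto simp: good_def)
      obtain b where b: "b \<in> e" "\<phi> b = w" using 2(3) e(2) by blast
      have xV: "x \<in> V" "snd (\<phi> x) \<le> 1" using x(1) by (simp_all add: X_def)
      have "\<phi> x \<in> \<phi> ` e" using x(2) e(2) by blast
      then have "x \<in> e" by (rule pre[OF e(1) xV(1)])
      then have "norm (fst (\<phi> x) - fst (\<phi> b)) \<le> K" by (rule K(1)[OF e(1) _ b(1) xV(2)])
      then show ?thesis using x(1) b(2) by auto
    qed
  qed
  then obtain x where x: "x \<in> X" "norm (fst (\<phi> x) - fst w) \<le> K" by blast
  have "r \<le> norm (fst w)" by (rule side_boundary_horizontal_norm[OF w(2)])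
  also have "\<dots> \<le> norm (fst (\<phi> x)) + norm (fst (\<phi> x) - fst w)"
    using norm_triangle_ineq4[of "fst (\<phi> x)" "fst (\<phi> x) - fst w"] by simp
  finally have "x \<in> far \<phi> base_point (r - K)" using x(2) \<phi>(2) by (simp add: far_def)
  then show ?thesis using x(1) unfolding X_def \<eta>_def by blast
qed

text \<open>The image of \<open>base_point\<close> has horizontal part 0 and so is not on
  \<open>side_boundary r\<close>; the path has to leave it, along an open edge. The resulting bound
  depends neither on r nor on the placement.\<close>

lemma lower_connection_open_edge:
  assumes \<phi>: "hiso \<phi>" "fst (\<phi> base_point) = 0" and r: "0 < r"
    and con: "connects W (lower_edges ((`) \<phi> ` open_edges E \<omega>)) {\<phi> base_point} (side_boundary r)"
  shows "{e \<in> {e \<in> E. base_point \<in> e}. \<omega> e} \<noteq> {}"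
proof -
  obtain vs es where path: "graph_path W (lower_edges ((`) \<phi> ` open_edges E \<omega>)) vs es"
    and start: "\<phi> base_point \<in> set vs \<union> \<Union>(set es)"
    and target: "(set vs \<union> \<Union>(set es)) \<inter> side_boundary r \<noteq> {}"
    using con unfolding connects_def by blast
  have len: "length vs = Suc (length es)"
    and inc: "\<And>i. i < length es \<Longrightarrow> vs ! i \<in> es ! i \<and> vs ! Suc i \<in> es ! i"
    using path by (auto simp: graph_path_def)
  have "\<exists>c\<in>set es. \<phi> base_point \<in> c"
  proof (cases "\<phi> base_point \<in> set vs")
    case True
    then obtain i where i: "i < length vs" "vs ! i = \<phi> base_point" by (auto simp: in_set_conv_nth)
    have "es \<noteq> []"
    proof
      assume "es = []"
      then have "vs = [\<phi> base_point]" using len i by (auto simp: length_Suc_conv)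
      then have "\<phi> base_point \<in> side_boundary r" using target \<open>es = []\<close> by auto
      then show False using side_boundary_horizontal_norm[of "\<phi> base_point" r] \<phi>(2) r by simp
    qed
    show ?thesis
    proof (cases "i < length es")
      case True
      then show ?thesis using inc[of i] i(2) by (intro bexI[of _ "es ! i"]) auto
    next
      case False
      \<comment> \<open>Only the last vertex has no edge after it; there the edge before it
        serves.\<close>
      then have "i = Suc (length es - 1)" "length es - 1 < length es" using i(1) len \<open>es \<noteq> []\<close> by auto
      then show ?thesis using inc[of "length es - 1"] i(2) by (intro bexI[of _ "es ! (length es - 1)"]) auto
    qed
  next
    case False
    then show ?thesis using start by blast
  qed
  then obtain c where c: "c \<in> lower_edges ((`) \<phi> ` open_edges E \<omega>)" "\<phi> base_point \<in> c"
    using path by (auto simp: graph_path_def)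
  then obtain e where e: "e \<in> E" "\<omega> e" "\<phi> base_point \<in> \<phi> ` e"
    using in_components_subset unfolding lower_edges_def open_edges_def by blast
  then obtain y where y: "y \<in> e" "\<phi> base_point = \<phi> y" by blast
  then have "y \<in> hspace" using e(1) E_hspace by blast
  then have "base_point = y" using inj_onD[OF hiso_inj[OF \<phi>(1)] y(2)] by simp
  then show ?thesis using e(1,2) y(1) by blast
qed

theorem g_fun_decay:
  assumes p: "0 \<le> p" "p \<le> 1" "p < p0 V E"
  shows "\<exists>\<psi>>0. \<forall>r>0. g_fun V E p r \<le> exp (- \<psi> * r)"
proof -
  interpret prob_space "percolation E p" by (rule prob_space_percolation)
  have "null_boundary_params V E \<noteq> {}"
    using zero_in_null_boundary_params[OF V_hspace E_hspace countable_graph(2)] by blast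
  then obtain p' where p': "p' \<in> null_boundary_params V E" "p < p'"
    using p(3) less_cSupD unfolding p0_def by metis
  then have p'1: "p' \<le> 1" by (simp add: null_boundary_params_def)
  \<comment> \<open>This threshold is the one in \<open>dct_dichotomy\<close>: an escape probability
    below it at p' leaves only the second alternative.\<close>
  have "0 < 1 - exp (- 2 * (p' - p))" using p'(2) by simp
  from no_escape[OF p'(1) this] obtain M where M: "0 < M"
    "\<And>\<phi> F v. admissible \<phi> F v \<Longrightarrow> bexp p' F (\<lambda>\<eta>. of_bool (reaches ends \<eta> v (far \<phi> v M))) < 1 - exp (- 2 * (p' - p))"
    by blast
  obtain K where K: "0 < K" "\<And>\<phi> e a b. hiso \<phi> \<Longrightarrow> e \<in> E \<Longrightarrow> a \<in> e \<Longrightarrow> b \<in> e \<Longrightarrow> snd (\<phi> a) \<le> 1 \<Longrightarrow>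
          norm (fst (\<phi> a) - fst (\<phi> b)) \<le> K"
    using edge_horizontal_bounded by blast
  let ?E0 = "{e \<in> E. base_point \<in> e}"
  \<comment> \<open>The probability that some edge at \<open>base_point\<close> is open; it is below
    1 because p < p' \<le> 1.\<close>
  define a where "a = 1 - (1 - p) ^ card ?E0"
  let ?ev = "\<lambda>h R r \<omega>. connects (lower_vertices (Phi h R ` V) ((`) (Phi h R) ` E))
                    (lower_edges ((`) (Phi h R) ` open_edges E \<omega>)) {Phi h R base_point} (side_boundary r)"
  let ?I = "{0<..1 :: real} \<times> {R :: 'n hpoint \<Rightarrow> 'n hpoint. orthogonal_transformation R}"
  have sup: "g_fun V E p r \<le> b"
    if b: "\<And>h R. 0 < h \<Longrightarrow> h \<le> 1 \<Longrightarrow> orthogonal_transformation R \<Longrightarrow> \<P>(\<omega> in percolation E p. ?ev h R r \<omega>) \<le> b" for r b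
    unfolding g_fun_def
  proof (rule cSUP_least)
    have "(1, \<lambda>x. x) \<in> ?I" by simp
    then show "?I \<noteq> {}" by blast
    fix x assume "x \<in> ?I"
    then obtain h R where x: "x = (h, R)" "0 < h" "h \<le> 1" "orthogonal_transformation R" by force
    show "(case x of (h, R) \<Rightarrow> \<P>(\<omega> in percolation E p. ?ev h R r \<omega>)) \<le> b"
      unfolding x(1) prod.case by (rule b[OF x(2-4)])
  qed
  have near: "g_fun V E p r \<le> a" if r: "0 < r" for r
  proof (rule sup)
    fix h :: real and R :: "'n hpoint \<Rightarrow> 'n hpoint" assume hR: "0 < h" "h \<le> 1" "orthogonal_transformation R"
    have "\<P>(\<omega> in percolation E p. ?ev h R r \<omega>) \<le> \<P>(\<omega> in percolation E p. {e \<in> ?E0. \<omega> e} \<noteq> {})"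
    proof (rule finite_measure_mono)
      have "{e \<in> ?E0. \<omega> e} \<noteq> {}" if "?ev h R r \<omega>" for \<omega>
        by (rule lower_connection_open_edge[OF Phi(1)[OF hR(1,3)] _ r that]) (simp add: Phi[OF hR(1,3)])
      then show "{\<omega> \<in> space (percolation E p). ?ev h R r \<omega>} \<subseteq> {\<omega> \<in> space (percolation E p). {e \<in> ?E0. \<omega> e} \<noteq> {}}"
        by blast
      show "{\<omega> \<in> space (percolation E p). {e \<in> ?E0. \<omega> e} \<noteq> {}} \<in> events"
        by (rule percolation_finite(1)[OF finite_edges_at_base _ p(1,2)]) auto
    qed
    also have "\<dots> = bexp p ?E0 (\<lambda>\<eta>. of_bool (\<eta> \<noteq> {}))"
      by (rule percolation_finite(2)[OF finite_edges_at_base _ p(1,2)]) auto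
    also have "\<dots> = bexp p ?E0 (\<lambda>\<eta>. 1 - of_bool (\<eta> = {}))"
      by (rule bexp_cong) simp
    also have "\<dots> = a"
      using finite_edges_at_base by (simp add: bexp_diff bexp_const bexp_all_closed a_def)
    finally show "\<P>(\<omega> in percolation E p. ?ev h R r \<omega>) \<le> a" .
  qed
  have decay: "g_fun V E p r \<le> (1 / 2) ^ n" if "0 < r" and n: "real n * (M + K) \<le> r - K" for r n
  proof (rule sup)
    fix h :: real and R :: "'n hpoint \<Rightarrow> 'n hpoint" assume hR: "0 < h" "h \<le> 1" "orthogonal_transformation R"
    let ?\<phi> = "Phi h R"
    have \<phi>: "hiso ?\<phi>" "fst (?\<phi> base_point) = 0" "snd (?\<phi> base_point) \<le> 1"
      using Phi[OF hR(1,3)] hR(2) by simp_all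
    \<comment> \<open>An edge with two low ends may still rise above the horosphere in between;
      counting it as a connection only enlarges the event.\<close>
    let ?H = "{e \<in> E. \<forall>x\<in>ends e. snd (?\<phi> x) \<le> 1}"
    have H: "countable ?H" "?H \<subseteq> E" using countable_graph(2) by (auto intro: countable_subset)
    have lim: "bexp p F (\<lambda>\<eta>. of_bool (reaches ends \<eta> base_point (far ?\<phi> base_point (r - K)))) \<le> (1 / 2) ^ n"
      if F: "finite F" "F \<subseteq> ?H" for F
    proof -
      have adm: "admissible ?\<phi> F base_point" using F \<phi> base by (auto simp: admissible_def)
      show ?thesis
        by (rule geometric_decay[where M = M and K = K and p' = p'])
           (rule p(1) p'(2) p'1 M(1) K(1) adm n | rule M(2), assumption | rule K(2), assumption+)+
    qed
    note limit = percolation_limit[OF H p(1,2) lim]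
    \<comment> \<open>Monotonicity of the measure rests on measurability of the larger event, which
      \<open>limit\<close> provides.\<close>
    have "\<P>(\<omega> in percolation E p. ?ev h R r \<omega>) \<le>
        \<P>(\<omega> in percolation E p. reaches ends {e \<in> ?H. \<omega> e} base_point (far ?\<phi> base_point (r - K)))"
    proof (rule finite_measure_mono)
      show "{\<omega> \<in> space (percolation E p). ?ev h R r \<omega>} \<subseteq>
         {\<omega> \<in> space (percolation E p). reaches ends {e \<in> ?H. \<omega> e} base_point (far ?\<phi> base_point (r - K))}"
      proof (intro Collect_mono impI conjI)
        fix \<omega> assume "\<omega> \<in> space (percolation E p) \<and> ?ev h R r \<omega>"
        then show "\<omega> \<in> space (percolation E p)"
          "reaches ends {e \<in> ?H. \<omega> e} base_point (far ?\<phi> base_point (r - K))"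
          using lower_connection_far[OF \<phi> _ K(1)] K(2)[OF \<phi>(1)] by blast+
      qed
    qed (rule limit(1))
    also have "\<dots> \<le> (1 / 2) ^ n" by (rule limit(2))
    finally show "\<P>(\<omega> in percolation E p. ?ev h R r \<omega>) \<le> (1 / 2) ^ n" .
  qed
  have "a < 1" using p'(2) p'1 by (simp add: a_def)
  then show ?thesis
    using M(1) K(1) by (intro exponential_decay_from_steps[of a _ "M + K" K] near decay) auto
qed

end

theorem theorem3p3p6:
  fixes V :: "('n::finite) hpoint set" and E :: "'n hpoint set set" and p :: real
  assumes "embedded_simple_graph V E"
    and "connected_graph V E"
    and "locally_finite_graph V E"
    and "transitive_under_isometries V E"
    and "\<forall>e\<in>E. geodesic_segment e"
    and "base_point \<in> V"
    and "0 \<le> p" and "p \<le> 1" and "p < p0 V E"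
  shows "\<exists>\<psi>>0. \<forall>r>0. g_fun V E p r \<le> exp (- \<psi> * r)"
proof -
  interpret isometric_graph V E by (unfold_locales) (use assms in auto)
  show ?thesis using assms by (intro g_fun_decay)
qed

end
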